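(* Let $X$, $\alpha$, $C$, $\lambda$, $n$, $r$ and $X_{r:n}$ be as in the context. Then for every function $f$ that is positive and non-decreasing on some interval $[T,\infty)$, $T>0$, $$\mathbb P\big(X_{r:n}(t)>f(t)\ \text{i.o.}\big)=0\quad\text{or}\quad 1$$ according as the integral $$\mathscr I_f:=\int_T^\infty \mathbb P\Big(\sup_{t\in[0,1]}X_{r:n}(t)>f(u)\Big)\,du$$ is finite or infinite, respectively.
   Context: $X=\{X(t):t\in\mathbb R_+\}$ is a stationary Gaussian process with almost surely continuous sample paths, $\mathbb E X(t)=0$, $\mathbb E X^2(t)=1$, whose correlation function $r(t)=\mathbb E X(t)X(0)$ satisfies: (i) $r(t)=1-C|t|^\alpha+o(|t|^\alpha)$ as $t\to0$, for some $0<\alpha\le2$ and $C>0$; (ii) $r^*(s):=\sup_{t\ge s}|r(t)|<1$ for each $s>0$; (iii) $r(t)=O(t^{-2\lambda})$ as $t\to\infty$, for some $\lambda>0$. For $n\ge1$, $X_1,\dots,X_n$ are mutually independent copies of $X$, and for an integer $1\le r\le n$ (not to be confused with the correlation function $r(\cdot)$), $X_{r:n}=\{X_{r:n}(t):t\ge0\}$ is the $r$th smallest order statistics process: for each $t\ge 0$, $X_{r:n}(t)$ is the $r$th smallest of $X_1(t),\dots,X_n(t)$, so that $X_{1:n}(t)=\min_j X_j(t)\le\dots\le X_{n:n}(t)=\max_j X_j(t)$. "$X_{r:n}(t)>f(t)$ i.o." denotes the event that the set of $t\ge T$ with $X_{r:n}(t)>f(t)$ is unbounded. *)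

theory Defs
  imports "HOL-Probability.Probability" "HOL-Library.Landau_Symbols"
begin

text \<open>
  A real process indexed by the half-line \<open>[0, \<infinity>)\<close> is a function \<open>X\<close> with \<open>X t w\<close> the value at time
  \<open>t\<close> for the outcome \<open>w\<close>; its values at negative times are never looked at.
\<close>

abbreviation path_space :: "(real \<Rightarrow> real) measure" where
  "path_space \<equiv> PiM {0..} (\<lambda>_. borel)"

definition sample_path :: "(real \<Rightarrow> 'a \<Rightarrow> real) \<Rightarrow> 'a \<Rightarrow> real \<Rightarrow> real" where
  "sample_path X w = (\<lambda>t\<in>{0..}. X t w)"

text \<open>The law on the product sigma-algebra, i.e. the family of finite-dimensional distributions.\<close>

definition process_law :: "'a measure \<Rightarrow> (real \<Rightarrow> 'a \<Rightarrow> real) \<Rightarrow> (real \<Rightarrow> real) measure" where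
  "process_law M X = distr M path_space (sample_path X)"

definition continuous_paths_ae :: "'a measure \<Rightarrow> (real \<Rightarrow> 'a \<Rightarrow> real) \<Rightarrow> bool" where
  "continuous_paths_ae M X \<longleftrightarrow> (AE w in M. continuous_on {0..} (\<lambda>t. X t w))"

text \<open>Degenerate (almost surely constant) variables count as Gaussian, with variance zero.\<close>

definition gaussian_variable :: "'a measure \<Rightarrow> ('a \<Rightarrow> real) \<Rightarrow> bool" where
  "gaussian_variable M Y \<longleftrightarrow> Y \<in> borel_measurable M \<and>
     ((\<exists>\<mu>. AE w in M. Y w = \<mu>) \<or>
      (\<exists>\<mu> \<sigma>. \<sigma> > 0 \<and> distributed M lborel Y (\<lambda>x. ennreal (normal_density \<mu> \<sigma> x))))"

definition gaussian_process :: "'a measure \<Rightarrow> (real \<Rightarrow> 'a \<Rightarrow> real) \<Rightarrow> bool" where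
  "gaussian_process M X \<longleftrightarrow>
     (\<forall>J c. finite J \<and> J \<subseteq> {0..} \<longrightarrow> gaussian_variable M (\<lambda>w. \<Sum>t\<in>J. c t * X t w))"

definition stationary_process :: "'a measure \<Rightarrow> (real \<Rightarrow> 'a \<Rightarrow> real) \<Rightarrow> bool" where
  "stationary_process M X \<longleftrightarrow>
     (\<forall>h\<ge>0. process_law M (\<lambda>t. X (t + h)) = process_law M X)"

definition corr_fun :: "'a measure \<Rightarrow> (real \<Rightarrow> 'a \<Rightarrow> real) \<Rightarrow> real \<Rightarrow> real" where
  "corr_fun M X t = (\<integral>w. X t w * X 0 w \<partial>M)"

text \<open>
  The law on the product sigma-algebra does not determine path continuity, so a copy of a process
  with continuous paths is required to have almost surely continuous paths as well.
\<close>

definition copy_of_process ::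
  "'a measure \<Rightarrow> (real \<Rightarrow> 'a \<Rightarrow> real) \<Rightarrow> 'b measure \<Rightarrow> (real \<Rightarrow> 'b \<Rightarrow> real) \<Rightarrow> bool" where
  "copy_of_process N X M Y \<longleftrightarrow>
     (\<forall>t\<ge>0. Y t \<in> borel_measurable M) \<and> process_law M Y = process_law N X \<and>
     continuous_paths_ae M Y"

definition independent_processes ::
  "'b measure \<Rightarrow> (nat \<Rightarrow> real \<Rightarrow> 'b \<Rightarrow> real) \<Rightarrow> nat set \<Rightarrow> bool" where
  "independent_processes M Xs I \<longleftrightarrow>
     prob_space.indep_vars M (\<lambda>_. path_space) (\<lambda>j. sample_path (Xs j)) I"

text \<open>The \<open>r\<close>th smallest of \<open>Xs 1 t w, \<dots>, Xs n t w\<close>, counted with multiplicity.\<close>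

definition order_stat ::
  "nat \<Rightarrow> nat \<Rightarrow> (nat \<Rightarrow> real \<Rightarrow> 'b \<Rightarrow> real) \<Rightarrow> real \<Rightarrow> 'b \<Rightarrow> real" where
  "order_stat r n Xs t w = sort (map (\<lambda>j. Xs j t w) [1..<Suc n]) ! (r - 1)"

definition exceeds_io ::
  "'b measure \<Rightarrow> real \<Rightarrow> (real \<Rightarrow> real) \<Rightarrow> (real \<Rightarrow> 'b \<Rightarrow> real) \<Rightarrow> 'b set" where
  "exceeds_io M T f Y = {w \<in> space M. \<not> bdd_above {t. t \<ge> T \<and> Y t w > f t}}"

text \<open>
  Paths are continuous only almost surely, so this event and the one in \<open>exceeds_io\<close> are measurable
  only up to null sets; their probabilities are taken in the completion of \<open>M\<close>. The supremum is that
  of a nonempty bounded set whenever the path is continuous.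
\<close>

definition sup_exceeds :: "'b measure \<Rightarrow> (real \<Rightarrow> 'b \<Rightarrow> real) \<Rightarrow> real \<Rightarrow> 'b set" where
  "sup_exceeds M Y x = {w \<in> space M. (SUP t\<in>{0..1}. Y t w) > x}"

definition test_integral ::
  "'b measure \<Rightarrow> real \<Rightarrow> (real \<Rightarrow> real) \<Rightarrow> (real \<Rightarrow> 'b \<Rightarrow> real) \<Rightarrow> ennreal" where
  "test_integral M T f Y =
     (\<integral>\<^sup>+u\<in>{T..}. emeasure (completion M) (sup_exceeds M Y (f u)) \<partial>lborel)"

end

theory Submission
  imports Defs "HOL-Real_Asymp.Real_Asymp"
begin

text \<open>
  Write \<open>Y\<close> for the order statistics process, \<open>p u\<close> for the probability that \<open>Y\<close> exceeds \<open>u\<close> somewhere on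
  a fixed interval, and \<open>k = n + 1 - r\<close>, so that \<open>Y t > u\<close> means that at least \<open>k\<close> of the \<open>n\<close> copies
  exceed \<open>u\<close> at time \<open>t\<close>. By stationarity and monotonicity the test integral converges exactly when
  \<open>p\<close> has a finite sum over the values of \<open>f\<close> at the left ends of consecutive intervals
  (\<open>antimono_integral_series\<close>). If it converges, the Borel--Cantelli lemma for unit intervals gives
  probability \<open>0\<close> (\<open>io_event_null\<close>).

  If it diverges, let \<open>A i\<close> be the event that \<open>Y\<close> exceeds the level \<open>u i\<close> on the \<open>i\<close>th of a sequence
  of blocks of length \<open>b\<close> with gaps of length \<open>b\<close> between them. The tail sigma-algebra of \<open>X\<close> may be
  far from trivial (paths can even be analytic), so a zero-one law is not at hand; instead Chebyshev's
  inequality for the number of events that occur gives probability \<open>1\<close> as soon as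
  \<open>P (A i \<inter> A j) \<le> (1 + \<epsilon>) P (A i) P (A j)\<close> up to summable errors
  (\<open>second_moment_infinitely_often\<close>). Two regimes give this bound. Let \<open>l = ln j\<close> and \<open>i < j\<close>.

  Far blocks, \<open>j - i \<ge> l ^ D\<close> (\<open>far_blocks\<close>, \<open>far_pairs\<close>). The correlations between the blocks are at
  most a large negative power of \<open>l\<close>. This alone does not make the blocks nearly independent, because
  the covariance within a block can be almost degenerate. So read the first block on a grid with
  polynomially many points in \<open>l\<close>, which costs a small change of level by chaining, and add a tiny
  independent noise \<open>\<sigma> G\<close> at every grid point. The noise bounds the coefficients of the linear
  regression of the second block on the noisy grid values (\<open>ridge_regression\<close>), so the predictable
  part of the second block is uniformly small with overwhelming probability, while the residual is
  uncorrelated with, hence independent of, the noisy grid values. All changes of level are at most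
  \<open>3 \<eta>\<close> with \<open>\<eta> = 1 / l\<^sup>2\<close>, and they change \<open>p\<close> only by a factor close to \<open>1\<close>: raising all copies
  by about \<open>\<eta>\<close> is a shift of a single normal variable (\<open>hit_level_regularity\<close>).

  Near blocks (\<open>near_blocks\<close>, \<open>near_pairs\<close>). Exceedances in both blocks force, up to the choice of grid
  points, \<open>k\<close> copies to be large at one time and a further value to be large at another time, where
  that value has correlation at most \<open>\<kappa> < 1\<close> with the others. This costs
  \<open>exp (- (k / 2 + const) u\<^sup>2)\<close>, against \<open>p u \<ge> exp (- (k / 2) (u + 1)\<^sup>2)\<close> up to a constant, and so
  the conditional probability is a negative power of \<open>i\<close> once \<open>u i \<ge> const * sqrt (ln i)\<close>. The levels may
  be raised to this size without losing the divergence of the series (\<open>min_series_diverges\<close>).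

  Two tools underlie this. Gaussian families are handled through the set of their linear
  combinations; their law is determined by the covariances (\<open>gauss_law_eqI\<close>), which by the
  Cramer--Wold theorem reduces to uniqueness of characteristic functions on the line. Hence a family may
  be replaced by any other one with the same covariances: by a time shift of itself for stationarity
  (\<open>hit_stationary\<close>), and by families on product spaces for independence (\<open>gauss_uncorrelated_indep\<close>) and for
  integration over a single normal variable (\<open>hit_level_regularity\<close>).
\<close>

section \<open>Laws determined by linear combinations\<close>

lemma (in finite_measure) weighted_distribution:
  fixes X g :: "'a \<Rightarrow> real"
  assumes [measurable]: "X \<in> borel_measurable M" "g \<in> borel_measurable M"
    and g: "\<And>w. 0 \<le> g w" "\<And>w. g w \<le> C"
    and c: "c = (\<integral>w. g w \<partial>M)" "c > 0"
  defines "\<mu> \<equiv> distr (density M (\<lambda>w. ennreal (g w / c))) borel X"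
  shows "real_distribution \<mu>"
    and "char \<mu> t = (CLINT w|M. of_real (g w) * iexp (t * X w)) / of_real c"
    and "B \<in> sets borel \<Longrightarrow> measure \<mu> B = (\<integral>w. g w * indicator B (X w) \<partial>M) / c"
proof -
  have int: "integrable M g"
    using g by (intro integrable_const_bound[of _ C]) auto
  have nn: "0 \<le> g w / c" for w using g c by simp
  have "emeasure (density M (\<lambda>w. ennreal (g w / c))) (space M) = (\<integral>\<^sup>+w. ennreal (g w / c) \<partial>M)"
    by (subst emeasure_density) (auto intro!: nn_integral_cong)
  also have "\<dots> = ennreal (\<integral>w. g w / c \<partial>M)"
    using int nn by (intro nn_integral_eq_integral) auto
  also have "(\<integral>w. g w / c \<partial>M) = 1" using c by simp
  finally have "prob_space (density M (\<lambda>w. ennreal (g w / c)))"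
    by (intro prob_spaceI) simp
  then interpret D: prob_space "density M (\<lambda>w. ennreal (g w / c))" .
  show "real_distribution \<mu>"
    unfolding \<mu>_def by (intro D.real_distribution_distr) auto
  show "char \<mu> t = (CLINT w|M. of_real (g w) * iexp (t * X w)) / of_real c"
  proof -
    have "char \<mu> t = (CLINT w|density M (\<lambda>w. ennreal (g w / c)). iexp (t * X w))"
      unfolding char_def \<mu>_def by (subst integral_distr) auto
    also have "\<dots> = (CLINT w|M. (g w / c) *\<^sub>R iexp (t * X w))"
      by (subst integral_density) (auto simp: nn)
    also have "\<dots> = (CLINT w|M. (of_real (g w) * iexp (t * X w)) / of_real c)"
      by (simp add: scaleR_conv_of_real)
    finally show ?thesis by simp
  qed
  show "measure \<mu> B = (\<integral>w. g w * indicator B (X w) \<partial>M) / c" if [measurable]: "B \<in> sets borel"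
  proof -
    have "measure \<mu> B = (\<integral>x. indicator B x \<partial>\<mu>)" by (simp add: \<mu>_def)
    also have "\<dots> = (\<integral>w. indicator B (X w) \<partial>density M (\<lambda>w. ennreal (g w / c)))"
      unfolding \<mu>_def by (subst integral_distr) auto
    also have "\<dots> = (\<integral>w. (g w / c) *\<^sub>R indicator B (X w) \<partial>M)"
      by (subst integral_density) (auto simp: nn)
    finally show ?thesis by simp
  qed
qed

text \<open>
  Nonnegative weights extend Levy's uniqueness theorem to finite measures. Evaluation at \<open>t = 0\<close> shows
  that the total masses agree; if they vanish there is nothing to normalise, but then both sides are zero.
\<close>

lemma weighted_Levy_uniqueness:
  fixes X g :: "'a \<Rightarrow> real" and Y h :: "'b \<Rightarrow> real"
  assumes fin: "finite_measure M" "finite_measure M'"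
    and X: "X \<in> borel_measurable M" "g \<in> borel_measurable M" "\<And>w. 0 \<le> g w" "\<And>w. g w \<le> C"
    and Y: "Y \<in> borel_measurable M'" "h \<in> borel_measurable M'" "\<And>w. 0 \<le> h w" "\<And>w. h w \<le> C"
    and eq: "\<And>t. (CLINT w|M. of_real (g w) * iexp (t * X w))
                  = (CLINT w|M'. of_real (h w) * iexp (t * Y w))"
    and B: "B \<in> sets borel"
  shows "(\<integral>w. g w * indicator B (X w) \<partial>M) = (\<integral>w. h w * indicator B (Y w) \<partial>M')"
proof -
  interpret M: finite_measure M by fact
  interpret M': finite_measure M' by fact
  define c where "c = (\<integral>w. g w \<partial>M)"
  have c': "c = (\<integral>w. h w \<partial>M')"
    using eq[of 0] by (simp add: c_def integral_complex_of_real)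
  have "c \<ge> 0" unfolding c_def using X by (intro integral_nonneg_AE) auto
  have ig: "integrable M g" using X by (intro M.integrable_const_bound[of _ C]) auto
  have ih: "integrable M' h" using Y by (intro M'.integrable_const_bound[of _ C]) auto
  show ?thesis
  proof (cases "c = 0")
    case True
    have "AE w in M. g w = 0"
      using True X ig unfolding c_def by (subst (asm) integral_nonneg_eq_0_iff_AE) auto
    then have "(\<integral>w. g w * indicator B (X w) \<partial>M) = (\<integral>w. 0 \<partial>M)"
      using X B by (intro integral_cong_AE) auto
    moreover have "AE w in M'. h w = 0"
      using True Y ih unfolding c' by (subst (asm) integral_nonneg_eq_0_iff_AE) auto
    then have "(\<integral>w. h w * indicator B (Y w) \<partial>M') = (\<integral>w. 0 \<partial>M')"
      using Y B by (intro integral_cong_AE) auto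
    ultimately show ?thesis by simp
  next
    case False
    with \<open>c \<ge> 0\<close> have c: "c > 0" by simp
    let ?\<mu> = "distr (density M (\<lambda>w. ennreal (g w / c))) borel X"
    let ?\<nu> = "distr (density M' (\<lambda>w. ennreal (h w / c))) borel Y"
    note W = M.weighted_distribution[OF X c_def c] M'.weighted_distribution[OF Y c' c]
    have "?\<mu> = ?\<nu>"
      by (intro Levy_uniqueness W ext) (simp only: W eq)
    then have "(\<integral>w. g w * indicator B (X w) \<partial>M) / c = (\<integral>w. h w * indicator B (Y w) \<partial>M') / c"
      using W(3)[OF B] W(6)[OF B] by metis
    with c show ?thesis by simp
  qed
qed

lemma prod_indicator_conv:
  "finite J \<Longrightarrow> (\<Prod>i\<in>J. indicator (A i) (x i)) = (if \<forall>i\<in>J. x i \<in> A i then 1 else (0::real))"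
  by (induction J rule: finite_induct) (auto simp: indicator_def)

text \<open>
  The coordinates in \<open>J\<close> are moved from the exponent to the indicators one at a time. To move one of them,
  the remaining factors serve as a weight in the uniqueness theorem on the line; they are first made real
  and nonnegative by replacing the exponential by \<open>1 + cos\<close>.
\<close>

lemma Cramer_Wold_step:
  fixes X :: "'i \<Rightarrow> 'a \<Rightarrow> real" and Y :: "'i \<Rightarrow> 'b \<Rightarrow> real"
  assumes P: "prob_space M" "prob_space M'"
    and fin: "finite J" "finite K" "J \<inter> K = {}"
    and X: "\<And>i. i \<in> J \<union> K \<Longrightarrow> X i \<in> borel_measurable M"
    and Y: "\<And>i. i \<in> J \<union> K \<Longrightarrow> Y i \<in> borel_measurable M'"
    and eq: "\<And>c. (CLINT w|M. iexp (\<Sum>i\<in>J\<union>K. c i * X i w))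
                  = (CLINT w|M'. iexp (\<Sum>i\<in>J\<union>K. c i * Y i w))"
    and B: "\<And>i. i \<in> J \<Longrightarrow> B i \<in> sets borel"
  shows "(CLINT w|M. of_real (\<Prod>i\<in>J. indicator (B i) (X i w)) * iexp (\<Sum>i\<in>K. c i * X i w))
       = (CLINT w|M'. of_real (\<Prod>i\<in>J. indicator (B i) (Y i w)) * iexp (\<Sum>i\<in>K. c i * Y i w))"
  using fin X Y eq B
proof (induction J arbitrary: K c rule: finite_induct)
  case empty
  then show ?case by simp
next
  case (insert j J)
  interpret M: prob_space M by fact
  interpret M': prob_space M' by fact
  have [measurable]: "\<And>i. i \<in> J \<Longrightarrow> X i \<in> borel_measurable M" "\<And>i. i \<in> K \<Longrightarrow> X i \<in> borel_measurable M"
    "X j \<in> borel_measurable M"  "\<And>i. i \<in> J \<Longrightarrow> Y i \<in> borel_measurable M'"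
    "\<And>i. i \<in> K \<Longrightarrow> Y i \<in> borel_measurable M'" "Y j \<in> borel_measurable M'"
    "\<And>i. i \<in> J \<Longrightarrow> B i \<in> sets borel" "B j \<in> sets borel"
    using insert.prems by auto
  define pX where "pX w = (\<Prod>i\<in>J. indicator (B i) (X i w) :: real)" for w
  define pY where "pY w = (\<Prod>i\<in>J. indicator (B i) (Y i w) :: real)" for w
  define aX where "aX c w = (\<Sum>i\<in>K. c i * X i w)" for c w
  define aY where "aY c w = (\<Sum>i\<in>K. c i * Y i w)" for c w
  have [measurable]: "pX \<in> borel_measurable M" "pY \<in> borel_measurable M'"
    "aX c \<in> borel_measurable M" "aY c \<in> borel_measurable M'" for c
    unfolding pX_def[abs_def] pY_def[abs_def] aX_def[abs_def] aY_def[abs_def] by measurable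
  have p01: "0 \<le> pX w" "pX w \<le> 1" for w
    unfolding pX_def by (auto intro!: prod_nonneg prod_le_1 simp: indicator_def)
  have q01: "0 \<le> pY w" "pY w \<le> 1" for w
    unfolding pY_def by (auto intro!: prod_nonneg prod_le_1 simp: indicator_def)
  have jK: "j \<notin> K" "j \<notin> J" using insert by auto
  have IH: "(CLINT w|M. of_real (pX w) * iexp (t * X j w + aX c w))
          = (CLINT w|M'. of_real (pY w) * iexp (t * Y j w + aY c w))" for t c
  proof -
    have *: "(\<Sum>i\<in>insert j K. (c(j:=t)) i * X i w) = t * X j w + aX c w"
            "(\<Sum>i\<in>insert j K. (c(j:=t)) i * Y i w') = t * Y j w' + aY c w'" for w w'
      using insert.prems(1) jK unfolding aX_def aY_def by (auto intro!: sum.cong)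
    show ?thesis
      unfolding *[symmetric] pX_def pY_def
      by (rule insert.IH) (use insert.prems jK in auto)
  qed
  \<comment> \<open>Nonnegative trigonometric weights, whose transforms are combinations of the known ones.\<close>
  have weight: "(CLINT w|M. of_real (pX w * (1 + cos (aX c w + \<theta>))) * iexp (t * X j w))
      = (CLINT w|M'. of_real (pY w * (1 + cos (aY c w + \<theta>))) * iexp (t * Y j w))" for t \<theta> c
  proof -
    have expand: "of_real (p * (1 + cos (a + \<theta>))) * iexp (t * x)
      = of_real p * iexp (t * x + 0)
        + iexp \<theta> / 2 * (of_real p * iexp (t * x + a)) + iexp (-\<theta>) / 2 * (of_real p * iexp (t * x + (- a)))"
      for p a x :: real
    proof -
      have e: "complex_of_real (cos (a + \<theta>)) = (exp (\<i> * (of_real a + of_real \<theta>)) + exp (- (\<i> * (of_real a + of_real \<theta>)))) / 2"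
        by (simp add: cos_exp_eq flip: cos_of_real)
      show ?thesis
        unfolding of_real_mult of_real_add of_real_1 e
        by (simp add: algebra_simps exp_add exp_minus exp_diff add_divide_distrib)
    qed
    have neg: "- aX c w = aX (\<lambda>i. - c i) w" "- aY c w' = aY (\<lambda>i. - c i) w'" "aX (\<lambda>_. 0) w = 0" "aY (\<lambda>_. 0) w' = 0" for w w'
      by (simp_all add: aX_def aY_def sum_negf)
    define eX where "eX t c w = complex_of_real (pX w) * iexp (t * X j w + aX c w)" for t c w
    define eY where "eY t c w = complex_of_real (pY w) * iexp (t * Y j w + aY c w)" for t c w
    have iX: "integrable M (eX t c)" for t c
      unfolding eX_def[abs_def] using p01 by (intro M.integrable_const_bound[of _ 1]) (auto simp: norm_mult)
    have iY: "integrable M' (eY t c)" for t c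
      unfolding eY_def[abs_def] using q01 by (intro M'.integrable_const_bound[of _ 1]) (auto simp: norm_mult)
    have IH': "integral\<^sup>L M (eX t c) = integral\<^sup>L M' (eY t c)" for t c
      using IH unfolding eX_def[abs_def] eY_def[abs_def] .
    have "(CLINT w|M. of_real (pX w * (1 + cos (aX c w + \<theta>))) * iexp (t * X j w))
        = (CLINT w|M. eX t (\<lambda>_. 0) w + iexp \<theta> / 2 * eX t c w + iexp (-\<theta>) / 2 * eX t (\<lambda>i. - c i) w)"
      by (simp only: expand neg eX_def)
    also have "\<dots> = (CLINT w|M'. eY t (\<lambda>_. 0) w + iexp \<theta> / 2 * eY t c w + iexp (-\<theta>) / 2 * eY t (\<lambda>i. - c i) w)"
      by (simp add: iX iY IH')
    also have "\<dots> = (CLINT w|M'. of_real (pY w * (1 + cos (aY c w + \<theta>))) * iexp (t * Y j w))"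
      by (simp only: expand neg eY_def)
    finally show ?thesis .
  qed
  have wb: "0 \<le> p * (1 + cos x)" "p * (1 + cos x) \<le> 2" if "0 \<le> p" "p \<le> 1" for p x :: real
  proof -
    have "0 \<le> 1 + cos x" "1 + cos x \<le> 2" using cos_ge_minus_one[of x] cos_le_one[of x] by linarith+
    then show "0 \<le> p * (1 + cos x)" "p * (1 + cos x) \<le> 2"
      using that mult_mono[of p 1 "1 + cos x" 2] by auto
  qed
  have L: "(\<integral>w. pX w * (1 + cos (aX c w + \<theta>)) * indicator (B j) (X j w) \<partial>M)
      = (\<integral>w. pY w * (1 + cos (aY c w + \<theta>)) * indicator (B j) (Y j w) \<partial>M')" for c \<theta>
    by (rule weighted_Levy_uniqueness[where C=2])
       (use weight wb p01 q01 in \<open>auto intro: M.finite_measure_axioms M'.finite_measure_axioms\<close>)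
  have L0: "(\<integral>w. pX w * indicator (B j) (X j w) \<partial>M) = (\<integral>w. pY w * indicator (B j) (Y j w) \<partial>M')"
    using L[of "\<lambda>_. 0" 0] by (simp add: aX_def aY_def mult.assoc mult.left_commute[of _ 2])
  have bi: "integrable M (\<lambda>w. pX w * u w * indicator (B j) (X j w))"
    if "u \<in> borel_measurable M" "\<And>w. \<bar>u w\<bar> \<le> 1" for u
    using that p01 by (intro M.integrable_const_bound[of _ 1]) (auto simp: abs_mult indicator_def intro!: mult_le_one)
  have bi': "integrable M' (\<lambda>w. pY w * u w * indicator (B j) (Y j w))"
    if "u \<in> borel_measurable M'" "\<And>w. \<bar>u w\<bar> \<le> 1" for u
    using that q01 by (intro M'.integrable_const_bound[of _ 1]) (auto simp: abs_mult indicator_def intro!: mult_le_one)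
  have Lc: "(\<integral>w. pX w * cos (aX c w + \<theta>) * indicator (B j) (X j w) \<partial>M)
      = (\<integral>w. pY w * cos (aY c w + \<theta>) * indicator (B j) (Y j w) \<partial>M')" for \<theta>
  proof -
    have "(\<integral>w. pX w * cos (aX c w + \<theta>) * indicator (B j) (X j w) \<partial>M)
        = (\<integral>w. pX w * (1 + cos (aX c w + \<theta>)) * indicator (B j) (X j w) \<partial>M)
          - (\<integral>w. pX w * indicator (B j) (X j w) \<partial>M)"
      using bi[of "\<lambda>w. cos (aX c w + \<theta>)"] bi[of "\<lambda>w. 1"]
      by (subst Bochner_Integration.integral_diff[symmetric])
         (auto simp: algebra_simps)
    moreover have "(\<integral>w. pY w * cos (aY c w + \<theta>) * indicator (B j) (Y j w) \<partial>M')
        = (\<integral>w. pY w * (1 + cos (aY c w + \<theta>)) * indicator (B j) (Y j w) \<partial>M')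
          - (\<integral>w. pY w * indicator (B j) (Y j w) \<partial>M')"
      using bi'[of "\<lambda>w. cos (aY c w + \<theta>)"] bi'[of "\<lambda>w. 1"]
      by (subst Bochner_Integration.integral_diff[symmetric])
         (auto simp: algebra_simps)
    ultimately show ?thesis using L L0 by simp
  qed
  \<comment> \<open>The weights with phases 0 and - pi / 2 recover the real and the imaginary part.\<close>
  have ie: "iexp x = of_real (cos (x + 0)) + \<i> * of_real (cos (x + - pi/2))" for x
    using cos_sin_eq[of "x - pi/2 + pi/2"]
    by (simp add: cis_conv_exp[symmetric] complex_eq_iff cos_diff)
  have split: "(CLINT w|M. of_real (pX w * indicator (B j) (X j w)) * iexp (aX c w))
     = of_real (\<integral>w. pX w * cos (aX c w + 0) * indicator (B j) (X j w) \<partial>M)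
      + \<i> * of_real (\<integral>w. pX w * cos (aX c w + -pi/2) * indicator (B j) (X j w) \<partial>M)"
  proof -
    have "(CLINT w|M. of_real (pX w * indicator (B j) (X j w)) * iexp (aX c w))
       = (CLINT w|M. of_real (pX w * cos (aX c w + 0) * indicator (B j) (X j w))
         + \<i> * of_real (pX w * cos (aX c w + -pi/2) * indicator (B j) (X j w)))"
      by (subst ie) (simp add: algebra_simps)
    also have "\<dots> = (CLINT w|M. of_real (pX w * cos (aX c w + 0) * indicator (B j) (X j w)))
       + (CLINT w|M. \<i> * of_real (pX w * cos (aX c w + -pi/2) * indicator (B j) (X j w)))"
      using bi[of "\<lambda>w. cos (aX c w + 0)"] bi[of "\<lambda>w. cos (aX c w + -pi/2)"]
      by (intro Bochner_Integration.integral_add integrable_mult_right integrable_of_real) auto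
    finally show ?thesis by (simp only: integral_mult_right_zero integral_complex_of_real)
  qed
  have split': "(CLINT w|M'. of_real (pY w * indicator (B j) (Y j w)) * iexp (aY c w))
     = of_real (\<integral>w. pY w * cos (aY c w + 0) * indicator (B j) (Y j w) \<partial>M')
      + \<i> * of_real (\<integral>w. pY w * cos (aY c w + -pi/2) * indicator (B j) (Y j w) \<partial>M')"
  proof -
    have "(CLINT w|M'. of_real (pY w * indicator (B j) (Y j w)) * iexp (aY c w))
       = (CLINT w|M'. of_real (pY w * cos (aY c w + 0) * indicator (B j) (Y j w))
         + \<i> * of_real (pY w * cos (aY c w + -pi/2) * indicator (B j) (Y j w)))"
      by (subst ie) (simp add: algebra_simps)
    also have "\<dots> = (CLINT w|M'. of_real (pY w * cos (aY c w + 0) * indicator (B j) (Y j w)))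
       + (CLINT w|M'. \<i> * of_real (pY w * cos (aY c w + -pi/2) * indicator (B j) (Y j w)))"
      using bi'[of "\<lambda>w. cos (aY c w + 0)"] bi'[of "\<lambda>w. cos (aY c w + -pi/2)"]
      by (intro Bochner_Integration.integral_add integrable_mult_right integrable_of_real) auto
    finally show ?thesis by (simp only: integral_mult_right_zero integral_complex_of_real)
  qed
  have "(CLINT w|M. of_real (pX w * indicator (B j) (X j w)) * iexp (aX c w))
      = (CLINT w|M'. of_real (pY w * indicator (B j) (Y j w)) * iexp (aY c w))"
    unfolding split split' Lc ..
  then show ?case
    using insert.hyps jK by (simp add: pX_def pY_def aX_def aY_def mult.commute)
qed

proposition Cramer_Wold:
  fixes X :: "'i \<Rightarrow> 'a \<Rightarrow> real" and Y :: "'i \<Rightarrow> 'b \<Rightarrow> real"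
  assumes P: "prob_space M" "prob_space M'"
    and X: "\<And>i. i \<in> I \<Longrightarrow> X i \<in> borel_measurable M"
    and Y: "\<And>i. i \<in> I \<Longrightarrow> Y i \<in> borel_measurable M'"
    and eq: "\<And>J c. finite J \<Longrightarrow> J \<subseteq> I \<Longrightarrow> (CLINT w|M. iexp (\<Sum>i\<in>J. c i * X i w))
                  = (CLINT w|M'. iexp (\<Sum>i\<in>J. c i * Y i w))"
  shows "distr M (PiM I (\<lambda>_. borel)) (\<lambda>w. \<lambda>i\<in>I. X i w) = distr M' (PiM I (\<lambda>_. borel)) (\<lambda>w. \<lambda>i\<in>I. Y i w)"
proof (rule measure_eqI_PiM_infinite)
  interpret M: prob_space M by fact
  interpret M': prob_space M' by fact
  have m: "(\<lambda>w. \<lambda>i\<in>I. X i w) \<in> M \<rightarrow>\<^sub>M PiM I (\<lambda>_. borel)" "(\<lambda>w. \<lambda>i\<in>I. Y i w) \<in> M' \<rightarrow>\<^sub>M PiM I (\<lambda>_. borel)"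
    using X Y by (auto intro!: measurable_restrict)
  interpret DX: prob_space "distr M (PiM I (\<lambda>_. borel)) (\<lambda>w. \<lambda>i\<in>I. X i w)"
    by (rule M.prob_space_distr[OF m(1)])
  show "finite_measure (distr M (PiM I (\<lambda>_. borel)) (\<lambda>w. \<lambda>i\<in>I. X i w))"
    by unfold_locales
  fix A :: "'i \<Rightarrow> real set" and J assume J: "finite J" "J \<subseteq> I" and A: "\<And>i. i \<in> J \<Longrightarrow> A i \<in> sets borel"
  have emb: "prod_emb I (\<lambda>_. borel) J (Pi\<^sub>E J A) \<in> sets (PiM I (\<lambda>_. borel))"
    using J A by (intro sets_PiM_I) auto
  have sX: "(\<lambda>w. \<lambda>i\<in>I. X i w) -` prod_emb I (\<lambda>_. borel) J (Pi\<^sub>E J A) \<inter> space M = {w\<in>space M. \<forall>i\<in>J. X i w \<in> A i}"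
    using J by (fastforce simp: prod_emb_def PiE_iff subset_eq)
  have sY: "(\<lambda>w. \<lambda>i\<in>I. Y i w) -` prod_emb I (\<lambda>_. borel) J (Pi\<^sub>E J A) \<inter> space M' = {w\<in>space M'. \<forall>i\<in>J. Y i w \<in> A i}"
    using J by (fastforce simp: prod_emb_def PiE_iff subset_eq)
  have X': "\<And>i. i \<in> J \<Longrightarrow> X i \<in> borel_measurable M" and Y': "\<And>i. i \<in> J \<Longrightarrow> Y i \<in> borel_measurable M'"
    using X Y J by auto
  have meas: "{w\<in>space M. \<forall>i\<in>J. X i w \<in> A i} \<in> sets M" "{w\<in>space M'. \<forall>i\<in>J. Y i w \<in> A i} \<in> sets M'"
    using measurable_sets[OF m(1) emb] measurable_sets[OF m(2) emb] sX sY by auto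
  have pr: "(\<Prod>i\<in>J. indicator (A i) (X i w) :: real) = indicator {w\<in>space M. \<forall>i\<in>J. X i w \<in> A i} w" if "w \<in> space M" for w
    using that J(1) by (simp add: prod_indicator_conv)
  have pr': "(\<Prod>i\<in>J. indicator (A i) (Y i w) :: real) = indicator {w\<in>space M'. \<forall>i\<in>J. Y i w \<in> A i} w" if "w \<in> space M'" for w
    using that J(1) by (simp add: prod_indicator_conv)
  have "(CLINT w|M. of_real (\<Prod>i\<in>J. indicator (A i) (X i w)) * iexp (\<Sum>i\<in>{}. 0 * X i w))
       = (CLINT w|M'. of_real (\<Prod>i\<in>J. indicator (A i) (Y i w)) * iexp (\<Sum>i\<in>{}. 0 * Y i w))"
    using Cramer_Wold_step[OF P J(1) finite.emptyI, of X Y A "\<lambda>_. 0"] eq[OF J] X' Y' A by simp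
  then have "complex_of_real (measure M {w\<in>space M. \<forall>i\<in>J. X i w \<in> A i}) = of_real (measure M' {w\<in>space M'. \<forall>i\<in>J. Y i w \<in> A i})"
    using meas by (simp add: integral_complex_of_real pr pr' cong: Bochner_Integration.integral_cong del: of_real_prod)
  then show "emeasure (distr M (PiM I (\<lambda>_. borel)) (\<lambda>w. \<lambda>i\<in>I. X i w)) (prod_emb I (\<lambda>_. borel) J (Pi\<^sub>E J A))
     = emeasure (distr M' (PiM I (\<lambda>_. borel)) (\<lambda>w. \<lambda>i\<in>I. Y i w)) (prod_emb I (\<lambda>_. borel) J (Pi\<^sub>E J A))"
    by (simp add: emeasure_distr m emb sX sY M.emeasure_eq_measure M'.emeasure_eq_measure)
qed simp_all

section \<open>Centred Gaussian variables\<close>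

text \<open>
  The scale may be zero, so almost surely vanishing variables are included.
\<close>

definition centered_gaussian :: "'a measure \<Rightarrow> ('a \<Rightarrow> real) \<Rightarrow> bool" where
  "centered_gaussian M Y \<longleftrightarrow> Y \<in> borel_measurable M \<and>
     (\<exists>s\<ge>0. distr M borel Y = distr std_normal_distribution borel (\<lambda>x. s * x))"

lemma centered_gaussian_measurable: "centered_gaussian M Y \<Longrightarrow> Y \<in> borel_measurable M"
  by (simp add: centered_gaussian_def)

lemma centered_gaussian_scaled_std_normal:
  assumes "centered_gaussian M Y"
  obtains s where "s \<ge> 0" "(\<integral>w. (Y w)\<^sup>2 \<partial>M) = s\<^sup>2" "integrable M (\<lambda>w. (Y w)\<^sup>2)"
    "integrable M Y" "(\<integral>w. Y w \<partial>M) = 0"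
    "distr M borel Y = distr std_normal_distribution borel (\<lambda>x. s * x)"
proof -
  from assms obtain s where s: "s \<ge> 0" "distr M borel Y = distr std_normal_distribution borel (\<lambda>x. s * x)"
    and [measurable]: "Y \<in> borel_measurable M"
    by (auto simp: centered_gaussian_def)
  have tr: "(\<integral>w. f (Y w) \<partial>M) = (\<integral>x. f (s * x) \<partial>std_normal_distribution)"
    "integrable M (\<lambda>w. f (Y w)) \<longleftrightarrow> integrable std_normal_distribution (\<lambda>x. f (s * x))"
    if [measurable]: "f \<in> borel_measurable borel" for f :: "real \<Rightarrow> real"
    using integral_distr[of Y M borel f] integrable_distr_eq[of Y M borel f]
      integral_distr[of "\<lambda>x. s * x" std_normal_distribution borel f]
      integrable_distr_eq[of "\<lambda>x. s * x" std_normal_distribution borel f] s(2) by simp_all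
  show thesis
  proof (rule that[OF s(1) _ _ _ _ s(2)])
    show "(\<integral>w. (Y w)\<^sup>2 \<partial>M) = s\<^sup>2"
      using tr(1)[of "\<lambda>x. x\<^sup>2"] std_normal_distribution_even_moments(1)[of 1]
      by (simp add: power_mult_distrib)
    show "integrable M (\<lambda>w. (Y w)\<^sup>2)"
      using tr(2)[of "\<lambda>x. x\<^sup>2"] integrable_std_normal_distribution_moment[of 2]
      by (simp add: power_mult_distrib)
    show "integrable M Y"
      using tr(2)[of "\<lambda>x. x"] integrable_std_normal_distribution_moment[of 1] by simp
    show "(\<integral>w. Y w \<partial>M) = 0"
      using tr(1)[of "\<lambda>x. x"] integral_std_normal_distribution_moment_odd[of 1] by simp
  qed
qed

lemma centered_gaussian_integrable:
  assumes "centered_gaussian M Y"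
  shows "integrable M Y" "integrable M (\<lambda>w. (Y w)\<^sup>2)" "(\<integral>w. Y w \<partial>M) = 0"
  using centered_gaussian_scaled_std_normal[OF assms] by auto

lemma char_scaled_std_normal:
  "char (distr std_normal_distribution borel (\<lambda>x. s * x)) t = of_real (exp (- (s\<^sup>2 * t\<^sup>2) / 2))"
proof -
  have "char (distr std_normal_distribution borel (\<lambda>x. s * x)) t = char std_normal_distribution (s * t)"
    unfolding char_def by (subst integral_distr) (auto simp: mult_ac)
  then show ?thesis by (simp add: char_std_normal_distribution power_mult_distrib)
qed

lemma (in prob_space) centered_gaussian_char:
  assumes "centered_gaussian M Y"
  shows "(CLINT w|M. iexp (t * Y w)) = of_real (exp (- ((\<integral>w. (Y w)\<^sup>2 \<partial>M) * t\<^sup>2) / 2))"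
proof -
  have [measurable]: "Y \<in> borel_measurable M" using assms by (rule centered_gaussian_measurable)
  obtain s where "distr M borel Y = distr std_normal_distribution borel (\<lambda>x. s * x)" "(\<integral>w. (Y w)\<^sup>2 \<partial>M) = s\<^sup>2"
    using assms by (elim centered_gaussian_scaled_std_normal)
  moreover have "(CLINT w|M. iexp (t * Y w)) = char (distr M borel Y) t"
    unfolding char_def by (subst integral_distr) auto
  ultimately show ?thesis by (simp only: char_scaled_std_normal)
qed

lemma (in prob_space) centered_gaussian_charI:
  assumes [measurable]: "Y \<in> borel_measurable M" and "v \<ge> 0"
    and ch: "\<And>t. (CLINT w|M. iexp (t * Y w)) = of_real (exp (- (v * t\<^sup>2) / 2))"
  shows "centered_gaussian M Y"
proof -
  interpret std: real_distribution std_normal_distribution by (rule real_dist_normal_dist)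
  have "distr M borel Y = distr std_normal_distribution borel (\<lambda>x. sqrt v * x)"
  proof (rule Levy_uniqueness)
    show "real_distribution (distr M borel Y)" by simp
    show "real_distribution (distr std_normal_distribution borel (\<lambda>x. sqrt v * x))"
      by (rule std.real_distribution_distr) auto
    show "char (distr M borel Y) = char (distr std_normal_distribution borel (\<lambda>x. sqrt v * x))"
    proof
      fix t
      have "char (distr M borel Y) t = (CLINT w|M. iexp (t * Y w))"
        unfolding char_def by (subst integral_distr) auto
      then show "char (distr M borel Y) t = char (distr std_normal_distribution borel (\<lambda>x. sqrt v * x)) t"
        unfolding char_scaled_std_normal using ch \<open>v \<ge> 0\<close> by simp
    qed
  qed
  then show ?thesis unfolding centered_gaussian_def using \<open>v \<ge> 0\<close>
    by (auto intro!: exI[of _ "sqrt v"])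
qed

lemma prob_space_std_normal: "prob_space std_normal_distribution"
  by (rule prob_space_normal_density) simp

text \<open>
  Beyond \<open>y \<ge> 0\<close> one has \<open>x\<^sup>2 \<ge> y\<^sup>2 + (x - y)\<^sup>2\<close>, so the density is at most \<open>exp (- y\<^sup>2 / 2)\<close> times
  the normal density centred at \<open>y\<close>.
\<close>

lemma std_normal_tail: "y \<ge> 0 \<Longrightarrow> measure std_normal_distribution {y<..} \<le> exp (- y\<^sup>2 / 2)"
proof -
  assume y: "y \<ge> 0"
  interpret std: prob_space std_normal_distribution by (rule prob_space_std_normal)
  have "emeasure std_normal_distribution {y<..} = (\<integral>\<^sup>+x. ennreal (std_normal_density x) * indicator {y<..} x \<partial>lborel)"
    by (subst emeasure_density) auto
  also have "\<dots> \<le> (\<integral>\<^sup>+x. ennreal (exp (- y\<^sup>2 / 2)) * ennreal (normal_density y 1 x) \<partial>lborel)"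
  proof (intro nn_integral_mono)
    fix x :: real
    show "ennreal (std_normal_density x) * indicator {y<..} x \<le> ennreal (exp (- y\<^sup>2 / 2)) * ennreal (normal_density y 1 x)"
    proof (cases "x > y")
      case True
      then have "y\<^sup>2 + (x - y)\<^sup>2 \<le> x\<^sup>2"
        using y mult_nonneg_nonneg[of y "x - y"] by (simp add: power2_eq_square algebra_simps)
      then have "exp (- x\<^sup>2 / 2) \<le> exp (- y\<^sup>2 / 2 + (- (x - y)\<^sup>2 / 2))" by simp
      then have "std_normal_density x \<le> exp (- y\<^sup>2 / 2) * normal_density y 1 x"
        unfolding normal_density_def exp_add by (simp add: field_simps)
      with True show ?thesis
        by (simp flip: ennreal_mult add: normal_density_nonneg ennreal_leI)
    qed simp
  qed
  also have "\<dots> = ennreal (exp (- y\<^sup>2 / 2)) * emeasure (density lborel (normal_density y 1)) UNIV"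
    by (subst emeasure_density) (auto simp: nn_integral_cmult)
  also have "emeasure (density lborel (normal_density y 1)) UNIV = 1"
    using prob_space.emeasure_space_1[OF prob_space_normal_density[of 1 y]] by simp
  finally show ?thesis
    by (simp add: std.emeasure_eq_measure)
qed

lemma std_normal_tail_lower:
  assumes "y \<ge> 0" shows "std_normal_density (y + 1) \<le> measure std_normal_distribution {y<..}"
proof -
  interpret std: prob_space std_normal_distribution by (rule prob_space_std_normal)
  have "ennreal (std_normal_density (y + 1)) = (\<integral>\<^sup>+x. ennreal (std_normal_density (y + 1)) * indicator {y<..y+1} x \<partial>lborel)"
    by (subst nn_integral_cmult_indicator) auto
  also have "\<dots> \<le> (\<integral>\<^sup>+x. ennreal (std_normal_density x) * indicator {y<..} x \<partial>lborel)"
  proof (intro nn_integral_mono)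
    fix x :: real
    show "ennreal (std_normal_density (y + 1)) * indicator {y<..y+1} x \<le> ennreal (std_normal_density x) * indicator {y<..} x"
    proof (cases "x \<in> {y<..y+1}")
      case True
      then have "x\<^sup>2 \<le> (y + 1)\<^sup>2" using assms by (intro power_mono) auto
      with True show ?thesis by (auto simp: std_normal_density_def intro!: ennreal_leI divide_right_mono)
    qed simp
  qed
  also have "\<dots> = emeasure std_normal_distribution {y<..}"
    by (subst emeasure_density) auto
  finally show ?thesis by (simp add: std.emeasure_eq_measure)
qed

lemma centered_gaussian_tail:
  assumes "prob_space M" "centered_gaussian M Y" and v: "(\<integral>w. (Y w)\<^sup>2 \<partial>M) \<le> v" "v > 0" and "x \<ge> 0"
  shows "measure M {w\<in>space M. Y w > x} \<le> exp (- x\<^sup>2 / (2 * v))"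
proof -
  have [measurable]: "Y \<in> borel_measurable M" using assms by (simp add: centered_gaussian_measurable)
  obtain s where s: "s \<ge> 0" "(\<integral>w. (Y w)\<^sup>2 \<partial>M) = s\<^sup>2"
    and d: "distr M borel Y = distr std_normal_distribution borel (\<lambda>x. s * x)"
    using assms by (elim centered_gaussian_scaled_std_normal)
  have "measure M {w\<in>space M. Y w > x} = measure (distr M borel Y) {x<..}"
    by (subst measure_distr) (auto intro!: arg_cong[of _ _ "measure M"])
  also have "\<dots> = measure std_normal_distribution {z. s * z > x}"
    unfolding d by (subst measure_distr) (auto simp: vimage_def)
  also have "\<dots> \<le> exp (- x\<^sup>2 / (2 * v))"
  proof (cases "s = 0")
    case True
    then have "{z. s * z > x} = {}" using \<open>x \<ge> 0\<close> by auto
    then show ?thesis by simp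
  next
    case False
    with s have "s > 0" by simp
    then have "{z. s * z > x} = {x / s<..}" by (auto simp: field_simps)
    then have "measure std_normal_distribution {z. s * z > x} \<le> exp (- (x / s)\<^sup>2 / 2)"
      using std_normal_tail[of "x / s"] \<open>x \<ge> 0\<close> \<open>s > 0\<close> by simp
    also have "(x / s)\<^sup>2 / 2 \<ge> x\<^sup>2 / (2 * v)"
      using s v \<open>s > 0\<close> by (simp add: power_divide frac_le)
    then have "exp (- (x / s)\<^sup>2 / 2) \<le> exp (- x\<^sup>2 / (2 * v))" by simp
    finally show ?thesis .
  qed
  finally show ?thesis .
qed

lemma centered_gaussian_cmult:
  assumes "centered_gaussian M Y" shows "centered_gaussian M (\<lambda>w. c * Y w)"
proof -
  have [measurable]: "Y \<in> borel_measurable M" using assms by (simp add: centered_gaussian_measurable)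
  obtain s where s: "s \<ge> 0" and d: "distr M borel Y = distr std_normal_distribution borel (\<lambda>x. s * x)"
    using assms by (elim centered_gaussian_scaled_std_normal)
  have "distr M borel (\<lambda>w. c * Y w) = distr (distr M borel Y) borel (\<lambda>x. c * x)"
    by (subst distr_distr) (auto simp: o_def)
  also have "\<dots> = distr std_normal_distribution borel (\<lambda>x. c * (s * x))"
    unfolding d by (subst distr_distr) (auto simp: o_def)
  also have "\<dots> = distr std_normal_distribution borel (\<lambda>x. (\<bar>c\<bar> * s) * x)"
  proof (rule Levy_uniqueness)
    interpret std: real_distribution std_normal_distribution by (rule real_dist_normal_dist)
    show "real_distribution (distr std_normal_distribution borel (\<lambda>x. c * (s * x)))"
         "real_distribution (distr std_normal_distribution borel (\<lambda>x. \<bar>c\<bar> * s * x))"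
      by (rule std.real_distribution_distr; simp)+
    have "char (distr std_normal_distribution borel (\<lambda>x. c * (s * x))) t =
          char (distr std_normal_distribution borel (\<lambda>x. \<bar>c\<bar> * s * x)) t" for t
      unfolding mult.assoc[symmetric] char_scaled_std_normal by (simp add: power_mult_distrib)
    then show "char (distr std_normal_distribution borel (\<lambda>x. c * (s * x))) =
          char (distr std_normal_distribution borel (\<lambda>x. \<bar>c\<bar> * s * x))" ..
  qed
  finally show ?thesis
    unfolding centered_gaussian_def using s by (auto intro!: exI[of _ "\<bar>c\<bar> * s"])
qed

lemma centered_gaussian_abs_tail:
  assumes "prob_space M" "centered_gaussian M Y" "(\<integral>w. (Y w)\<^sup>2 \<partial>M) \<le> v" "v > 0" "x \<ge> 0"
  shows "measure M {w\<in>space M. \<bar>Y w\<bar> > x} \<le> 2 * exp (- x\<^sup>2 / (2 * v))"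
proof -
  interpret prob_space M by fact
  have [measurable]: "Y \<in> borel_measurable M" using assms by (simp add: centered_gaussian_measurable)
  have "{w\<in>space M. \<bar>Y w\<bar> > x} = {w\<in>space M. Y w > x} \<union> {w\<in>space M. - 1 * Y w > x}"
    by auto
  then have "measure M {w\<in>space M. \<bar>Y w\<bar> > x} \<le> measure M {w\<in>space M. Y w > x} + measure M {w\<in>space M. - 1 * Y w > x}"
    using measure_Un_le[of "{w\<in>space M. Y w > x}" M "{w\<in>space M. - 1 * Y w > x}"] by simp
  also have "\<dots> \<le> exp (- x\<^sup>2 / (2 * v)) + exp (- x\<^sup>2 / (2 * v))"
    by (intro add_mono centered_gaussian_tail assms centered_gaussian_cmult) (use assms in simp)
  finally show ?thesis by simp
qed

section \<open>Gaussian spaces\<close>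

text \<open>
  Linear combinations are generated one term at a time, so that closure properties follow by induction and
  no coefficient families have to be rearranged. The elements are functions, not classes of functions modulo
  null sets; this allows composition with the projections of a product space.
\<close>

inductive_set lin_span :: "('a \<Rightarrow> real) set \<Rightarrow> ('a \<Rightarrow> real) set" for S where
  lin_span_zero: "(\<lambda>_. 0) \<in> lin_span S"
| lin_span_step: "Y \<in> lin_span S \<Longrightarrow> X \<in> S \<Longrightarrow> (\<lambda>w. Y w + c * X w) \<in> lin_span S"

lemma lin_span_base: "X \<in> S \<Longrightarrow> X \<in> lin_span S"
  using lin_span_step[OF lin_span_zero, of X S 1] by simp

lemma lin_span_add_cmult:
  "X \<in> lin_span S \<Longrightarrow> Y \<in> lin_span S \<Longrightarrow> (\<lambda>w. Y w + c * X w) \<in> lin_span S"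
proof (induction X rule: lin_span.induct)
  case (lin_span_step X Z d)
  then have "(\<lambda>w. (Y w + c * X w) + (c * d) * Z w) \<in> lin_span S"
    using lin_span.lin_span_step[of "\<lambda>w. Y w + c * X w" S Z "c * d"] by simp
  then show ?case by (simp add: algebra_simps)
qed simp

lemma lin_span_cmult: "X \<in> lin_span S \<Longrightarrow> (\<lambda>w. c * X w) \<in> lin_span S"
  using lin_span_add_cmult[OF _ lin_span_zero] by simp

lemma lin_span_add: "X \<in> lin_span S \<Longrightarrow> Y \<in> lin_span S \<Longrightarrow> (\<lambda>w. X w + Y w) \<in> lin_span S"
  using lin_span_add_cmult[of Y S X 1] by simp

lemma lin_span_diff: "X \<in> lin_span S \<Longrightarrow> Y \<in> lin_span S \<Longrightarrow> (\<lambda>w. X w - Y w) \<in> lin_span S"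
  using lin_span_add_cmult[of Y S X "-1"] by simp

lemma lin_span_sum:
  "(\<And>i. i \<in> J \<Longrightarrow> X i \<in> lin_span S) \<Longrightarrow> (\<lambda>w. \<Sum>i\<in>J. c i * X i w) \<in> lin_span S"
  by (induction J rule: infinite_finite_induct)
     (auto intro!: lin_span_zero lin_span_add lin_span_cmult)

lemma lin_span_subset: "S' \<subseteq> lin_span S \<Longrightarrow> lin_span S' \<subseteq> lin_span S"
proof
  fix Y assume S: "S' \<subseteq> lin_span S" and "Y \<in> lin_span S'"
  from this(2) show "Y \<in> lin_span S"
    by (induction) (use S in \<open>auto intro: lin_span_zero lin_span_add_cmult\<close>)
qed

definition gauss_set :: "'a measure \<Rightarrow> ('a \<Rightarrow> real) set \<Rightarrow> bool" where
  "gauss_set M S \<longleftrightarrow> (\<forall>Y\<in>lin_span S. centered_gaussian M Y)"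

lemma gauss_setD: "gauss_set M S \<Longrightarrow> Y \<in> lin_span S \<Longrightarrow> centered_gaussian M Y"
  by (simp add: gauss_set_def)

lemma gauss_set_mono: "gauss_set M S \<Longrightarrow> S' \<subseteq> lin_span S \<Longrightarrow> gauss_set M S'"
  using lin_span_subset[of S' S] by (auto simp: gauss_set_def)

lemma (in prob_space) gauss_set_integrable:
  assumes "gauss_set M S" "X \<in> lin_span S" "Y \<in> lin_span S"
  shows "integrable M (\<lambda>w. X w * Y w)"
proof -
  have cg: "centered_gaussian M X" "centered_gaussian M Y" "centered_gaussian M (\<lambda>w. X w + Y w)"
    using assms by (auto intro!: gauss_setD lin_span_add)
  have "integrable M (\<lambda>w. ((X w + Y w)\<^sup>2 - (X w)\<^sup>2 - (Y w)\<^sup>2) / 2)"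
    using cg[THEN centered_gaussian_integrable(2)] by auto
  also have "(\<lambda>w. ((X w + Y w)\<^sup>2 - (X w)\<^sup>2 - (Y w)\<^sup>2) / 2) = (\<lambda>w. X w * Y w)"
    by (auto simp: power2_eq_square algebra_simps)
  finally show ?thesis .
qed

lemma (in prob_space) integral_sum_square:
  assumes "gauss_set M S" "\<And>i. i \<in> J \<Longrightarrow> Z i \<in> lin_span S"
  shows "(\<integral>w. (\<Sum>i\<in>J. c i * Z i w)\<^sup>2 \<partial>M) = (\<Sum>i\<in>J. \<Sum>j\<in>J. c i * c j * (\<integral>w. Z i w * Z j w \<partial>M))"
proof -
  have "(\<integral>w. (\<Sum>i\<in>J. c i * Z i w)\<^sup>2 \<partial>M) = (\<integral>w. (\<Sum>i\<in>J. \<Sum>j\<in>J. c i * c j * (Z i w * Z j w)) \<partial>M)"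
    by (simp add: power2_eq_square sum_product mult_ac)
  also have "\<dots> = (\<Sum>i\<in>J. \<Sum>j\<in>J. c i * c j * (\<integral>w. Z i w * Z j w \<partial>M))"
    using gauss_set_integrable[OF assms(1)] assms(2)
    by (subst Bochner_Integration.integral_sum; (intro Bochner_Integration.integrable_sum integrable_mult_right)?;
        auto intro!: sum.cong simp: Bochner_Integration.integral_sum)
  finally show ?thesis .
qed

text \<open>
  The variance of a linear combination is a quadratic form in the covariances, and it determines the
  characteristic function of that combination; so the Cramer--Wold theorem applies.
\<close>

theorem gauss_law_eqI:
  fixes Z :: "'i \<Rightarrow> 'a \<Rightarrow> real" and Z' :: "'i \<Rightarrow> 'b \<Rightarrow> real"
  assumes P: "prob_space M" "prob_space M'"
    and G: "gauss_set M (Z ` I)" "gauss_set M' (Z' ` I)"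
    and cov: "\<And>i j. i \<in> I \<Longrightarrow> j \<in> I \<Longrightarrow> (\<integral>w. Z i w * Z j w \<partial>M) = (\<integral>w. Z' i w * Z' j w \<partial>M')"
  shows "distr M (PiM I (\<lambda>_. borel)) (\<lambda>w. \<lambda>i\<in>I. Z i w) = distr M' (PiM I (\<lambda>_. borel)) (\<lambda>w. \<lambda>i\<in>I. Z' i w)"
proof (rule Cramer_Wold[OF P])
  interpret M: prob_space M by fact
  interpret M': prob_space M' by fact
  show "Z i \<in> borel_measurable M" "Z' i \<in> borel_measurable M'" if "i \<in> I" for i
    using that by (auto intro!: centered_gaussian_measurable gauss_setD[OF G(1)] gauss_setD[OF G(2)] lin_span_base)
  fix J :: "'i set" and c :: "'i \<Rightarrow> real" assume J: "finite J" "J \<subseteq> I"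
  have Zl: "Z i \<in> lin_span (Z ` I)" "Z' i \<in> lin_span (Z' ` I)" if "i \<in> J" for i
    using that J by (auto intro: lin_span_base)
  have "(\<integral>w. (\<Sum>i\<in>J. c i * Z i w)\<^sup>2 \<partial>M) = (\<integral>w. (\<Sum>i\<in>J. c i * Z' i w)\<^sup>2 \<partial>M')"
    using J Zl by (subst M.integral_sum_square[OF G(1)], blast, subst M'.integral_sum_square[OF G(2)], blast)
       (intro sum.cong refl arg_cong2[of _ _ _ _ "(*)"] cov; auto)
  moreover have cg: "centered_gaussian M (\<lambda>w. \<Sum>i\<in>J. c i * Z i w)" "centered_gaussian M' (\<lambda>w. \<Sum>i\<in>J. c i * Z' i w)"
    using Zl G by (auto intro!: gauss_setD lin_span_sum)
  ultimately show "(CLINT w|M. iexp (\<Sum>i\<in>J. c i * Z i w)) = (CLINT w|M'. iexp (\<Sum>i\<in>J. c i * Z' i w))"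
    using M.centered_gaussian_char[OF cg(1), of 1] M'.centered_gaussian_char[OF cg(2), of 1]
    by simp
qed

lemma gauss_law_measure_eq:
  fixes Z :: "'i \<Rightarrow> 'a \<Rightarrow> real" and Z' :: "'i \<Rightarrow> 'b \<Rightarrow> real"
  assumes "prob_space M" "prob_space M'"
    and "gauss_set M (Z ` I)" "gauss_set M' (Z' ` I)"
    and "\<And>i j. i \<in> I \<Longrightarrow> j \<in> I \<Longrightarrow> (\<integral>w. Z i w * Z j w \<partial>M) = (\<integral>w. Z' i w * Z' j w \<partial>M')"
    and E: "{x \<in> space (PiM I (\<lambda>_. borel)). Q x} \<in> sets (PiM I (\<lambda>_. borel))"
  shows "measure M {w\<in>space M. Q (\<lambda>i\<in>I. Z i w)} = measure M' {w\<in>space M'. Q (\<lambda>i\<in>I. Z' i w)}"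
proof -
  let ?E = "{x \<in> space (PiM I (\<lambda>_. borel)). Q x}"
  have m: "(\<lambda>w. \<lambda>i\<in>I. Z i w) \<in> M \<rightarrow>\<^sub>M PiM I (\<lambda>_. borel)" "(\<lambda>w. \<lambda>i\<in>I. Z' i w) \<in> M' \<rightarrow>\<^sub>M PiM I (\<lambda>_. borel)"
    by (auto intro!: measurable_restrict centered_gaussian_measurable gauss_setD[OF assms(3)] gauss_setD[OF assms(4)] lin_span_base)
  have "measure M {w\<in>space M. Q (\<lambda>i\<in>I. Z i w)} = measure (distr M (PiM I (\<lambda>_. borel)) (\<lambda>w. \<lambda>i\<in>I. Z i w)) ?E"
    using measurable_space[OF m(1)]
    by (subst measure_distr[OF m(1) E]) (auto intro!: arg_cong[of _ _ "measure M"])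
  also have "\<dots> = measure (distr M' (PiM I (\<lambda>_. borel)) (\<lambda>w. \<lambda>i\<in>I. Z' i w)) ?E"
    by (subst gauss_law_eqI[OF assms(1-5)]) auto
  also have "\<dots> = measure M' {w\<in>space M'. Q (\<lambda>i\<in>I. Z' i w)}"
    using measurable_space[OF m(2)]
    by (subst measure_distr[OF m(2) E]) (auto intro!: arg_cong[of _ _ "measure M'"])
  finally show ?thesis .
qed

text \<open>
  A linear combination of elements of the union is a sum with one summand for each index. The summands are
  independent centred Gaussian variables, and their characteristic functions multiply.
\<close>

lemma gauss_set_indep_Union:
  fixes X :: "'j \<Rightarrow> 'a \<Rightarrow> 'c"
  assumes "prob_space M" and fin: "finite J" and ind: "prob_space.indep_vars M N X J"
    and G: "\<And>j. j \<in> J \<Longrightarrow> gauss_set M (S j)"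
    and F: "\<And>j Y. j \<in> J \<Longrightarrow> Y \<in> S j \<Longrightarrow> \<exists>F\<in>borel_measurable (N j). Y = (\<lambda>w. F (X j w))"
  shows "gauss_set M (\<Union>j\<in>J. S j)"
proof -
  interpret prob_space M by fact
  have rep: "\<exists>F. (\<forall>j\<in>J. F j \<in> borel_measurable (N j) \<and> (\<lambda>w. F j (X j w)) \<in> lin_span (S j)) \<and>
     Y = (\<lambda>w. \<Sum>j\<in>J. F j (X j w))" if "Y \<in> lin_span (\<Union>j\<in>J. S j)" for Y
    using that
  proof induction
    case lin_span_zero
    then show ?case by (intro exI[of _ "\<lambda>_ _. 0"]) (auto intro: lin_span.lin_span_zero)
  next
    case (lin_span_step Y Z c)
    then obtain F where F': "\<And>j. j \<in> J \<Longrightarrow> F j \<in> borel_measurable (N j)"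
        "\<And>j. j \<in> J \<Longrightarrow> (\<lambda>w. F j (X j w)) \<in> lin_span (S j)" "Y = (\<lambda>w. \<Sum>j\<in>J. F j (X j w))" by auto
    from lin_span_step obtain j0 where j0: "j0 \<in> J" "Z \<in> S j0" by auto
    from F[OF this] obtain H where H: "H \<in> borel_measurable (N j0)" "Z = (\<lambda>w. H (X j0 w))" by auto
    define F2 where "F2 j = (\<lambda>x. F j x + (if j = j0 then c * H x else 0))" for j
    have "F2 j \<in> borel_measurable (N j)" "(\<lambda>w. F2 j (X j w)) \<in> lin_span (S j)" if "j \<in> J" for j
      using F'(1,2)[OF that] H j0 lin_span.lin_span_step[OF F'(2)[OF j0(1)] j0(2), of c]
      by (cases "j = j0"; simp add: F2_def[abs_def])+
    moreover have "(\<lambda>w. Y w + c * Z w) = (\<lambda>w. \<Sum>j\<in>J. F2 j (X j w))"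
      using j0 fin by (auto simp: F'(3) H F2_def sum.distrib sum.delta)
    ultimately show ?case by blast
  qed
  show ?thesis
    unfolding gauss_set_def
  proof
    fix Y assume "Y \<in> lin_span (\<Union>j\<in>J. S j)"
    from rep[OF this] obtain F where F': "\<And>j. j \<in> J \<Longrightarrow> F j \<in> borel_measurable (N j)"
        "\<And>j. j \<in> J \<Longrightarrow> (\<lambda>w. F j (X j w)) \<in> lin_span (S j)" "Y = (\<lambda>w. \<Sum>j\<in>J. F j (X j w))" by auto
    have cg: "centered_gaussian M (\<lambda>w. F j (X j w))" if "j \<in> J" for j
      by (rule gauss_setD[OF G[OF that] F'(2)[OF that]])
    note cgm = cg[THEN centered_gaussian_measurable]
    have iv: "indep_vars (\<lambda>_. borel) (\<lambda>j w. F j (X j w)) J"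
      using F'(1) by (intro indep_vars_compose2[OF ind]) auto
    show "centered_gaussian M Y"
    proof (rule centered_gaussian_charI)
      show Ym: "Y \<in> borel_measurable M" unfolding F'(3) using cgm by auto
      show "0 \<le> (\<Sum>j\<in>J. \<integral>w. (F j (X j w))\<^sup>2 \<partial>M)" by (intro sum_nonneg) auto
      fix t
      have "(CLINT w|M. iexp (t * Y w)) = char (distr M borel Y) t"
        unfolding char_def using Ym by (subst integral_distr) auto
      also have "\<dots> = (\<Prod>j\<in>J. char (distr M borel (\<lambda>w. F j (X j w))) t)"
        unfolding F'(3) by (rule char_distr_sum[OF iv])
      also have "\<dots> = (\<Prod>j\<in>J. CLINT w|M. iexp (t * F j (X j w)))"
        unfolding char_def using cgm by (intro prod.cong refl, subst integral_distr) auto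
      also have "\<dots> = (\<Prod>j\<in>J. of_real (exp (- ((\<integral>w. (F j (X j w))\<^sup>2 \<partial>M) * t\<^sup>2) / 2)))"
        by (intro prod.cong refl centered_gaussian_char cg)
      also have "\<dots> = of_real (exp (\<Sum>j\<in>J. - ((\<integral>w. (F j (X j w))\<^sup>2 \<partial>M) * t\<^sup>2) / 2))"
        unfolding exp_sum[OF fin] by simp
      also have "(\<Sum>j\<in>J. - ((\<integral>w. (F j (X j w))\<^sup>2 \<partial>M) * t\<^sup>2) / 2) = - ((\<Sum>j\<in>J. \<integral>w. (F j (X j w))\<^sup>2 \<partial>M) * t\<^sup>2) / 2"
        by (simp add: sum_distrib_right sum_negf sum_divide_distrib[symmetric])
      finally show "(CLINT w|M. iexp (t * Y w)) = of_real (exp (- ((\<Sum>j\<in>J. \<integral>w. (F j (X j w))\<^sup>2 \<partial>M) * t\<^sup>2) / 2))" .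
    qed
  qed
qed

lemma pair_integral_fst_snd:
  fixes f :: "'a \<Rightarrow> 'c::{real_normed_field, banach, second_countable_topology}" and g :: "'b \<Rightarrow> 'c"
  assumes "prob_space M" "prob_space M'" "integrable M f" "integrable M' g"
  shows "integrable (M \<Otimes>\<^sub>M M') (\<lambda>p. f (fst p) * g (snd p))"
    and "(\<integral>p. f (fst p) * g (snd p) \<partial>(M \<Otimes>\<^sub>M M')) = (\<integral>x. f x \<partial>M) * (\<integral>y. g y \<partial>M')"
proof -
  interpret M: prob_space M by fact
  interpret M': prob_space M' by fact
  interpret pair_prob_space M M' ..
  have [measurable]: "f \<in> borel_measurable M" "g \<in> borel_measurable M'" using assms by auto
  show int: "integrable (M \<Otimes>\<^sub>M M') (\<lambda>p. f (fst p) * g (snd p))"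
    using assms by (intro Fubini_integrable) (auto simp: norm_mult)
  show "(\<integral>p. f (fst p) * g (snd p) \<partial>(M \<Otimes>\<^sub>M M')) = (\<integral>x. f x \<partial>M) * (\<integral>y. g y \<partial>M')"
    using integral_fst'[OF int] by simp
qed

text \<open>
  Two Gaussian families, placed on the factors of a product space, are jointly Gaussian. With
  \<open>pair_integral_cov\<close> this provides the uncorrelated model families used in comparisons.
\<close>

lemma gauss_set_pair:
  assumes P: "prob_space M" "prob_space M'"
    and G: "gauss_set M S" "gauss_set M' S'"
  shows "gauss_set (M \<Otimes>\<^sub>M M') ((\<lambda>Y p. Y (fst p)) ` S \<union> (\<lambda>Y p. Y (snd p)) ` S')"
  unfolding gauss_set_def
proof
  interpret M: prob_space M by fact
  interpret M': prob_space M' by fact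
  interpret MM: pair_prob_space M M' ..
  fix Y assume "Y \<in> lin_span ((\<lambda>Y p. Y (fst p)) ` S \<union> (\<lambda>Y p. Y (snd p)) ` S')"
  then have "\<exists>Y1\<in>lin_span S. \<exists>Y2\<in>lin_span S'. Y = (\<lambda>p. Y1 (fst p) + Y2 (snd p))"
  proof induction
    case lin_span_zero
    then show ?case by (intro bexI[of _ "\<lambda>_. 0"]) (auto intro: lin_span.lin_span_zero)
  next
    case (lin_span_step Y X c)
    then obtain Y1 Y2 where Y: "Y1 \<in> lin_span S" "Y2 \<in> lin_span S'" "Y = (\<lambda>p. Y1 (fst p) + Y2 (snd p))"
      by auto
    from \<open>X \<in> _\<close> show ?case
    proof
      assume "X \<in> (\<lambda>Y p. Y (fst p)) ` S"
      then obtain X1 where X: "X1 \<in> S" "X = (\<lambda>p. X1 (fst p))" by auto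
      show ?thesis
        by (rule bexI[of _ "\<lambda>w. Y1 w + c * X1 w"], rule bexI[of _ Y2])
           (use X Y in \<open>auto intro: lin_span.lin_span_step\<close>)
    next
      assume "X \<in> (\<lambda>Y p. Y (snd p)) ` S'"
      then obtain X1 where X: "X1 \<in> S'" "X = (\<lambda>p. X1 (snd p))" by auto
      show ?thesis
        by (rule bexI[of _ Y1], rule bexI[of _ "\<lambda>w. Y2 w + c * X1 w"])
           (use X Y in \<open>auto intro: lin_span.lin_span_step\<close>)
    qed
  qed
  then obtain Y1 Y2 where Y: "Y1 \<in> lin_span S" "Y2 \<in> lin_span S'" "Y = (\<lambda>p. Y1 (fst p) + Y2 (snd p))" by auto
  have cg: "centered_gaussian M Y1" "centered_gaussian M' Y2" by (intro gauss_setD[OF G(1)] gauss_setD[OF G(2)] Y)+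
  note [measurable] = cg[THEN centered_gaussian_measurable]
  let ?v = "(\<integral>w. (Y1 w)\<^sup>2 \<partial>M) + (\<integral>w. (Y2 w)\<^sup>2 \<partial>M')"
  show "centered_gaussian (M \<Otimes>\<^sub>M M') Y"
  proof (rule MM.centered_gaussian_charI)
    show "Y \<in> borel_measurable (M \<Otimes>\<^sub>M M')" unfolding Y(3) by measurable
    show "0 \<le> ?v" by simp
    fix t
    have "(CLINT p|(M \<Otimes>\<^sub>M M'). iexp (t * Y p)) = (CLINT p|(M \<Otimes>\<^sub>M M'). iexp (t * Y1 (fst p)) * iexp (t * Y2 (snd p)))"
      unfolding Y(3) by (simp add: distrib_left exp_add)
    also have "\<dots> = (CLINT w|M. iexp (t * Y1 w)) * (CLINT w|M'. iexp (t * Y2 w))"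
      by (intro pair_integral_fst_snd P M.integrable_iexp M'.integrable_iexp) auto
    also have "\<dots> = of_real (exp (- ((\<integral>w. (Y1 w)\<^sup>2 \<partial>M) * t\<^sup>2) / 2) * exp (- ((\<integral>w. (Y2 w)\<^sup>2 \<partial>M') * t\<^sup>2) / 2))"
      unfolding M.centered_gaussian_char[OF cg(1)] M'.centered_gaussian_char[OF cg(2)] by simp
    also have "\<dots> = of_real (exp (- (?v * t\<^sup>2) / 2))"
      by (simp add: exp_add[symmetric] algebra_simps add_divide_distrib)
    finally show "(CLINT p|(M \<Otimes>\<^sub>M M'). iexp (t * Y p)) = of_real (exp (- (?v * t\<^sup>2) / 2))" .
  qed
qed

lemma lin_span_pair:
  "Y \<in> lin_span S \<Longrightarrow> (\<lambda>p. Y (fst p)) \<in> lin_span ((\<lambda>Y p. Y (fst p)) ` S \<union> (\<lambda>Y p. Y (snd p)) ` S')"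
  "Y' \<in> lin_span S' \<Longrightarrow> (\<lambda>p. Y' (snd p)) \<in> lin_span ((\<lambda>Y p. Y (fst p)) ` S \<union> (\<lambda>Y p. Y (snd p)) ` S')"
proof -
  show "(\<lambda>p. Y (fst p)) \<in> lin_span ((\<lambda>Y p. Y (fst p)) ` S \<union> (\<lambda>Y p. Y (snd p)) ` S')"
    if "Y \<in> lin_span S"
    using that by induction (auto intro: lin_span_zero lin_span_step)
  show "(\<lambda>p. Y' (snd p)) \<in> lin_span ((\<lambda>Y p. Y (fst p)) ` S \<union> (\<lambda>Y p. Y (snd p)) ` S')"
    if "Y' \<in> lin_span S'"
    using that by induction (auto intro: lin_span_zero lin_span_step)
qed

lemma pair_integral_cov:
  assumes P: "prob_space M" "prob_space M'"
    and G: "gauss_set M S" "gauss_set M' S'"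
  shows "X \<in> lin_span S \<Longrightarrow> Y \<in> lin_span S \<Longrightarrow>
       (\<integral>p. X (fst p) * Y (fst p) \<partial>(M \<Otimes>\<^sub>M M')) = (\<integral>w. X w * Y w \<partial>M)"
    and "X' \<in> lin_span S' \<Longrightarrow> Y' \<in> lin_span S' \<Longrightarrow>
       (\<integral>p. X' (snd p) * Y' (snd p) \<partial>(M \<Otimes>\<^sub>M M')) = (\<integral>w. X' w * Y' w \<partial>M')"
    and "X \<in> lin_span S \<Longrightarrow> Y' \<in> lin_span S' \<Longrightarrow>
       (\<integral>p. X (fst p) * Y' (snd p) \<partial>(M \<Otimes>\<^sub>M M')) = 0"
    and "X \<in> lin_span S \<Longrightarrow> Y' \<in> lin_span S' \<Longrightarrow>
       (\<integral>p. Y' (snd p) * X (fst p) \<partial>(M \<Otimes>\<^sub>M M')) = 0"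
proof -
  interpret M: prob_space M by fact
  interpret M': prob_space M' by fact
  show "(\<integral>p. X (fst p) * Y (fst p) \<partial>(M \<Otimes>\<^sub>M M')) = (\<integral>w. X w * Y w \<partial>M)"
    if "X \<in> lin_span S" "Y \<in> lin_span S"
    using pair_integral_fst_snd(2)[OF P M.gauss_set_integrable[OF G(1) that], of "\<lambda>_. 1"]
    by (simp add: M'.prob_space)
  show "(\<integral>p. X' (snd p) * Y' (snd p) \<partial>(M \<Otimes>\<^sub>M M')) = (\<integral>w. X' w * Y' w \<partial>M')"
    if "X' \<in> lin_span S'" "Y' \<in> lin_span S'"
    using pair_integral_fst_snd(2)[OF P _ M'.gauss_set_integrable[OF G(2) that], of "\<lambda>_. 1"]
    by (simp add: M.prob_space)
  show *: "(\<integral>p. X (fst p) * Y' (snd p) \<partial>(M \<Otimes>\<^sub>M M')) = 0"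
    if "X \<in> lin_span S" "Y' \<in> lin_span S'"
    using pair_integral_fst_snd(2)[OF P centered_gaussian_integrable(1)[OF gauss_setD[OF G(1) that(1)]]
          centered_gaussian_integrable(1)[OF gauss_setD[OF G(2) that(2)]]]
      centered_gaussian_integrable(3)[OF gauss_setD[OF G(1) that(1)]] by simp
  show "(\<integral>p. Y' (snd p) * X (fst p) \<partial>(M \<Otimes>\<^sub>M M')) = 0"
    if "X \<in> lin_span S" "Y' \<in> lin_span S'"
    using *[OF that] by (simp add: mult.commute)
qed

lemma distr_std_normal_mult_one: "distr std_normal_distribution borel ((*) 1) = std_normal_distribution"
proof -
  have "distr std_normal_distribution borel ((*) 1) = distr std_normal_distribution borel (\<lambda>x. x)"
    by (intro distr_cong) auto
  also have "\<dots> = std_normal_distribution" by (intro distr_id2) simp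
  finally show ?thesis .
qed

lemma centered_gaussian_std_normal:
  "centered_gaussian std_normal_distribution (\<lambda>x. x)"
  unfolding centered_gaussian_def
  by (auto intro!: exI[of _ 1] simp: distr_std_normal_mult_one distr_id2)

lemma std_normal_second_moment: "(\<integral>x. x * x \<partial>std_normal_distribution) = 1"
  using std_normal_distribution_even_moments(1)[of 1] by (simp add: power2_eq_square)

lemma gauss_set_singleton:
  assumes "centered_gaussian M Y" shows "gauss_set M {Y}"
  unfolding gauss_set_def
proof
  fix Z assume "Z \<in> lin_span {Y}"
  then have "\<exists>c. Z = (\<lambda>w. c * Y w)"
  proof induction
    case lin_span_zero then show ?case by (intro exI[of _ 0]) simp
  next
    case (lin_span_step Z X c)
    then obtain d where "Z = (\<lambda>w. d * Y w)" "X = Y" by auto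
    then show ?case by (intro exI[of _ "d + c"]) (simp add: algebra_simps)
  qed
  then show "centered_gaussian M Z" using centered_gaussian_cmult[OF assms] by auto
qed

text \<open>White noise serves both as the noise added to grid values and as the reference family for the joint
  law of copies at a single time.\<close>

lemma
  assumes F: "finite F"
  shows gauss_set_white_noise: "gauss_set (PiM F (\<lambda>_. std_normal_distribution)) ((\<lambda>i x. x i) ` F)"
    and white_noise_cov: "\<And>i j. i \<in> F \<Longrightarrow> j \<in> F \<Longrightarrow>
      (\<integral>x. x i * x j \<partial>PiM F (\<lambda>_. std_normal_distribution)) = (if i = j then 1 else 0)"
proof -
  interpret P: product_prob_space "\<lambda>_. std_normal_distribution" F
    by (intro product_prob_spaceI prob_space_std_normal)
  interpret fP: finite_product_prob_space "\<lambda>_. std_normal_distribution" F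
    by unfold_locales (rule F)
  let ?P = "PiM F (\<lambda>_. std_normal_distribution)"
  have comp: "distr ?P borel (\<lambda>x. x i) = std_normal_distribution" if "i \<in> F" for i
  proof -
    have "distr ?P borel (\<lambda>x. x i) = distr ?P std_normal_distribution (\<lambda>x. x i)"
      by (intro distr_cong) auto
    then show ?thesis using P.PiM_component[OF that] by simp
  qed
  have cm[measurable]: "(\<lambda>x. x i) \<in> borel_measurable ?P" if "i \<in> F" for i
    using measurable_component_singleton[OF that, of "\<lambda>_. std_normal_distribution"] by simp
  have cg: "centered_gaussian ?P (\<lambda>x. x i)" if "i \<in> F" for i
    using cm[OF that] unfolding centered_gaussian_def comp[OF that]
    by (auto intro!: exI[of _ 1] simp: distr_std_normal_mult_one)
  have iv: "P.indep_vars (\<lambda>_. borel) (\<lambda>i x. x i) F"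
  proof (cases "F = {}")
    case True
    then show ?thesis
      unfolding prob_space.indep_vars_def[OF P.P.prob_space_axioms] prob_space.indep_sets_def[OF P.P.prob_space_axioms]
      by auto
  next
    case False
    have "distr ?P (PiM F (\<lambda>_. borel)) (\<lambda>x. \<lambda>i\<in>F. x i) = distr ?P ?P (\<lambda>x. x)"
      by (intro distr_cong sets_PiM_cong) (auto simp: space_PiM PiE_def extensional_restrict)
    also have "\<dots> = PiM F (\<lambda>i. distr ?P borel (\<lambda>x. x i))"
      by (subst distr_id) (rule PiM_cong[OF refl comp[symmetric]])
    finally show ?thesis
      by (subst P.indep_vars_iff_distr_eq_PiM'[OF False]) auto
  qed
  have "gauss_set ?P (\<Union>i\<in>F. {\<lambda>x. x i})"
    by (rule gauss_set_indep_Union[OF P.P.prob_space_axioms F iv])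
       (auto intro!: gauss_set_singleton cg bexI[of _ "\<lambda>x. x"])
  then show "gauss_set ?P ((\<lambda>i x. x i) ` F)" by (simp add: UNION_singleton_eq_range)
  fix i j assume ij: "i \<in> F" "j \<in> F"
  show "(\<integral>x. x i * x j \<partial>?P) = (if i = j then 1 else 0)"
  proof (cases "i = j")
    case True
    have "(\<integral>x. x i * x i \<partial>?P) = (\<integral>x. x * x \<partial>distr ?P borel (\<lambda>x. x i))"
      using ij by (subst integral_distr) auto
    with True show ?thesis using comp[OF ij(1)] std_normal_second_moment by simp
  next
    case False
    have "P.indep_vars (\<lambda>_. borel) (\<lambda>i x. x i) {i, j}"
      using ij by (intro P.indep_vars_subset[OF iv]) auto
    then have "(\<integral>x. (\<Prod>k\<in>{i,j}. x k) \<partial>?P) = (\<Prod>k\<in>{i,j}. \<integral>x. x k \<partial>?P)"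
      using cg[THEN centered_gaussian_integrable(1)] ij
      by (intro P.indep_vars_lebesgue_integral) auto
    with False show ?thesis using cg[THEN centered_gaussian_integrable(3)] ij by simp
  qed
qed

text \<open>Uncorrelated families inside one Gaussian space have the law of two families on independent spaces.\<close>

lemma (in prob_space) gauss_uncorrelated_indep:
  fixes U :: "'i \<Rightarrow> 'a \<Rightarrow> real" and R :: "'j \<Rightarrow> 'a \<Rightarrow> real"
  assumes G: "gauss_set M S"
    and U: "\<And>i. i \<in> I \<Longrightarrow> U i \<in> lin_span S" and R: "\<And>j. j \<in> J \<Longrightarrow> R j \<in> lin_span S"
    and zero: "\<And>i j. i \<in> I \<Longrightarrow> j \<in> J \<Longrightarrow> (\<integral>w. R j w * U i w \<partial>M) = 0"
    and P: "{x\<in>space (PiM I (\<lambda>_. borel)). P x} \<in> sets (PiM I (\<lambda>_. borel))"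
    and Q: "{x\<in>space (PiM J (\<lambda>_. borel)). Q x} \<in> sets (PiM J (\<lambda>_. borel))"
  shows "prob {w\<in>space M. P (\<lambda>i\<in>I. U i w) \<and> Q (\<lambda>j\<in>J. R j w)}
     = prob {w\<in>space M. P (\<lambda>i\<in>I. U i w)} * prob {w\<in>space M. Q (\<lambda>j\<in>J. R j w)}"
proof -
  interpret MM: pair_prob_space M M ..
  let ?K = "Inl ` I \<union> Inr ` J"
  let ?B = "PiM ?K (\<lambda>_. borel :: real measure)"
  define X where "X k = (case k of Inl i \<Rightarrow> U i | Inr j \<Rightarrow> R j)" for k
  define X' where "X' k = (case k of Inl i \<Rightarrow> (\<lambda>p. U i (fst p)) | Inr j \<Rightarrow> (\<lambda>p. R j (snd p)))" for k
  define T where "T x \<longleftrightarrow> P (\<lambda>i\<in>I. x (Inl i)) \<and> Q (\<lambda>j\<in>J. x (Inr j))" for x :: "'i + 'j \<Rightarrow> real"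
  have restr: "T (\<lambda>k\<in>?K. f k) \<longleftrightarrow> T f" for f
    unfolding T_def by (intro arg_cong2[of _ _ _ _ "(\<and>)"] arg_cong[of _ _ P] arg_cong[of _ _ Q] ext) auto
  have mI: "(\<lambda>x. \<lambda>i\<in>I. x (Inl i)) \<in> ?B \<rightarrow>\<^sub>M PiM I (\<lambda>_. borel)"
    by (intro measurable_restrict measurable_component_singleton) auto
  have mJ: "(\<lambda>x. \<lambda>j\<in>J. x (Inr j)) \<in> ?B \<rightarrow>\<^sub>M PiM J (\<lambda>_. borel)"
    by (intro measurable_restrict measurable_component_singleton) auto
  have Tm: "{x\<in>space ?B. T x} \<in> sets ?B"
  proof -
    have "{x\<in>space ?B. T x} = ((\<lambda>x. \<lambda>i\<in>I. x (Inl i)) -` {x\<in>space (PiM I (\<lambda>_. borel)). P x} \<inter> space ?B)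
       \<inter> ((\<lambda>x. \<lambda>j\<in>J. x (Inr j)) -` {x\<in>space (PiM J (\<lambda>_. borel)). Q x} \<inter> space ?B)"
      using measurable_space[OF mI] measurable_space[OF mJ] unfolding T_def by blast
    then show ?thesis using measurable_sets[OF mI P] measurable_sets[OF mJ Q] by auto
  qed
  have gU: "(\<lambda>w. \<lambda>i\<in>I. U i w) \<in> M \<rightarrow>\<^sub>M PiM I (\<lambda>_. borel)"
    using U G by (auto intro!: measurable_restrict intro: centered_gaussian_measurable gauss_setD)
  have gR: "(\<lambda>w. \<lambda>j\<in>J. R j w) \<in> M \<rightarrow>\<^sub>M PiM J (\<lambda>_. borel)"
    using R G by (auto intro!: measurable_restrict intro: centered_gaussian_measurable gauss_setD)
  have E1: "{w\<in>space M. P (\<lambda>i\<in>I. U i w)} \<in> sets M"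
    using measurable_sets[OF gU P] measurable_space[OF gU] by (simp add: vimage_def Int_def conj_commute cong: conj_cong)
  have E2: "{w\<in>space M. Q (\<lambda>j\<in>J. R j w)} \<in> sets M"
    using measurable_sets[OF gR Q] measurable_space[OF gR] by (simp add: vimage_def Int_def conj_commute cong: conj_cong)
  have gp: "gauss_set (M \<Otimes>\<^sub>M M) ((\<lambda>Y p. Y (fst p)) ` S \<union> (\<lambda>Y p. Y (snd p)) ` S)"
    by (intro gauss_set_pair prob_space_axioms G)
  have "prob {w\<in>space M. T (\<lambda>k\<in>?K. X k w)} = measure (M \<Otimes>\<^sub>M M) {p\<in>space (M \<Otimes>\<^sub>M M). T (\<lambda>k\<in>?K. X' k p)}"
  proof (rule gauss_law_measure_eq)
    show "gauss_set M (X ` ?K)"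
      using U R by (intro gauss_set_mono[OF G]) (auto simp: X_def)
    show "gauss_set (M \<Otimes>\<^sub>M M) (X' ` ?K)"
      by (intro gauss_set_mono[OF gp]) (auto simp: X'_def intro!: lin_span_pair(1)[OF U] lin_span_pair(2)[OF R])
    show "{x\<in>space ?B. T x} \<in> sets ?B" by (rule Tm)
    fix i j assume "i \<in> ?K" "j \<in> ?K"
    note cv = pair_integral_cov[OF prob_space_axioms prob_space_axioms G G]
    show "(\<integral>w. X i w * X j w \<partial>M) = (\<integral>p. X' i p * X' j p \<partial>(M \<Otimes>\<^sub>M M))"
      using \<open>i \<in> ?K\<close> \<open>j \<in> ?K\<close> U R zero
      by (auto simp: X_def X'_def cv mult.commute[of "U _ _" "R _ _"])
  qed (auto simp: prob_space_axioms MM.prob_space_axioms)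
  also have "{p\<in>space (M \<Otimes>\<^sub>M M). T (\<lambda>k\<in>?K. X' k p)} = {w\<in>space M. P (\<lambda>i\<in>I. U i w)} \<times> {w\<in>space M. Q (\<lambda>j\<in>J. R j w)}"
    unfolding restr by (auto simp: T_def X'_def space_pair_measure)
  also have "measure (M \<Otimes>\<^sub>M M) \<dots> = prob {w\<in>space M. P (\<lambda>i\<in>I. U i w)} * prob {w\<in>space M. Q (\<lambda>j\<in>J. R j w)}"
    using emeasure_pair_measure_Times[OF E1 E2]
    by (simp add: emeasure_eq_measure MM.emeasure_eq_measure flip: ennreal_mult)
  finally show ?thesis unfolding restr by (simp add: T_def X_def)
qed

section \<open>Order statistics\<close>

text \<open>
  For \<open>k = n + 1 - r\<close> this says that the \<open>r\<close>th smallest of \<open>z 1, \<dots>, z n\<close> exceeds \<open>x\<close>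
  (\<open>order_stat_gt_iff\<close>). In this form the event is visibly increasing in every coordinate and a finite union
  of intersections of half-spaces.
\<close>

definition rank_exceeds :: "nat \<Rightarrow> nat \<Rightarrow> (nat \<Rightarrow> real) \<Rightarrow> real \<Rightarrow> bool" where
  "rank_exceeds n k z x \<longleftrightarrow> k \<le> card {j\<in>{1..n}. z j > x}"

lemma sorted_nth_gt_iff:
  fixes ys :: "real list"
  assumes "sorted ys" "i < length ys"
  shows "ys ! i > x \<longleftrightarrow> length ys - i \<le> length (filter (\<lambda>y. y > x) ys)"
proof
  assume gt: "ys ! i > x"
  have "y > x" if "y \<in> set (drop i ys)" for y
  proof -
    from that obtain j where "y = ys ! (i + j)" "i + j < length ys"
      by (auto simp: in_set_conv_nth)
    with sorted_nth_mono[OF assms(1), of i "i + j"] gt show ?thesis by simp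
  qed
  then have "filter (\<lambda>y. y > x) (drop i ys) = drop i ys" by (simp add: filter_id_conv)
  then have "length ys - i = length (filter (\<lambda>y. y > x) (drop i ys))" by simp
  also have "\<dots> \<le> length (filter (\<lambda>y. y > x) (take i ys @ drop i ys))"
    unfolding filter_append length_append by simp
  finally show "length ys - i \<le> length (filter (\<lambda>y. y > x) ys)" by simp
next
  assume le: "length ys - i \<le> length (filter (\<lambda>y. y > x) ys)"
  show "ys ! i > x"
  proof (rule ccontr)
    assume "\<not> ys ! i > x"
    have "\<not> y > x" if "y \<in> set (take (Suc i) ys)" for y
    proof -
      from that obtain j where "y = ys ! j" "j \<le> i"
        using assms(2) by (auto simp: in_set_conv_nth)
      with sorted_nth_mono[OF assms(1), of j i] assms(2) \<open>\<not> ys ! i > x\<close> show ?thesis by simp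
    qed
    then have "filter (\<lambda>y. y > x) (take (Suc i) ys) = []" by (simp add: filter_empty_conv)
    moreover have "filter (\<lambda>y. y > x) ys = filter (\<lambda>y. y > x) (take (Suc i) ys) @ filter (\<lambda>y. y > x) (drop (Suc i) ys)"
      by (simp only: filter_append[symmetric] append_take_drop_id)
    ultimately have "length (filter (\<lambda>y. y > x) ys) = length (filter (\<lambda>y. y > x) (drop (Suc i) ys))"
      by (simp only: append_Nil)
    also have "\<dots> \<le> length (drop (Suc i) ys)" by (rule length_filter_le)
    finally have "length (filter (\<lambda>y. y > x) ys) \<le> length ys - Suc i" by (simp only: length_drop)
    then show False using le assms(2) by linarith
  qed
qed

lemma order_stat_gt_iff:
  assumes "1 \<le> r" "r \<le> n"
  shows "order_stat r n Xs t w > x \<longleftrightarrow> rank_exceeds n (n + 1 - r) (\<lambda>j. Xs j t w) x"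
proof -
  let ?ys = "map (\<lambda>j. Xs j t w) [1..<Suc n]"
  have "length (filter (\<lambda>y. y > x) (sort ?ys)) = length (filter (\<lambda>y. y > x) ?ys)"
    by (simp add: filter_sort)
  also have "\<dots> = length (filter (\<lambda>j. Xs j t w > x) [1..<Suc n])"
    by (simp add: filter_map o_def del: upt_Suc)
  also have "\<dots> = card (set (filter (\<lambda>j. Xs j t w > x) [1..<Suc n]))"
    by (rule distinct_card[symmetric]) simp
  also have "set (filter (\<lambda>j. Xs j t w > x) [1..<Suc n]) = {j\<in>{1..n}. Xs j t w > x}"
    by auto
  finally show ?thesis
    using sorted_nth_gt_iff[of "sort ?ys" "r - 1" x] assms
    by (simp add: order_stat_def rank_exceeds_def del: upt_Suc)
qed

lemma rank_exceeds_iff_subset: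
  "rank_exceeds n k z x \<longleftrightarrow> (\<exists>J\<in>Pow {1..n}. card J = k \<and> (\<forall>j\<in>J. z j > x))"
proof
  assume "rank_exceeds n k z x"
  then obtain J where "J \<subseteq> {j\<in>{1..n}. z j > x}" "card J = k"
    unfolding rank_exceeds_def by (meson obtain_subset_with_card_n)
  then show "\<exists>J\<in>Pow {1..n}. card J = k \<and> (\<forall>j\<in>J. z j > x)" by blast
next
  assume "\<exists>J\<in>Pow {1..n}. card J = k \<and> (\<forall>j\<in>J. z j > x)"
  then obtain J where "J \<subseteq> {j\<in>{1..n}. z j > x}" "card J = k" by blast
  then show "rank_exceeds n k z x"
    unfolding rank_exceeds_def using card_mono[of "{j\<in>{1..n}. z j > x}" J] by simp
qed

lemma rank_exceeds_mono:
  assumes "rank_exceeds n k z x" "\<And>j. j \<in> {1..n} \<Longrightarrow> z j > x \<Longrightarrow> z' j > y"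
  shows "rank_exceeds n k z' y"
  using assms unfolding rank_exceeds_iff_subset by (meson PowD subsetD)

lemma rank_exceeds_perturb:
  assumes "rank_exceeds n k z x" "\<And>j. j \<in> {1..n} \<Longrightarrow> \<bar>z j - z' j\<bar> \<le> e" "y \<le> x - e"
  shows "rank_exceeds n k z' y"
  by (rule rank_exceeds_mono[OF assms(1)]) (use assms(2,3) in fastforce)

lemma rank_exceeds_cong:
  "(\<And>j. j \<in> {1..n} \<Longrightarrow> z j = z' j) \<Longrightarrow> rank_exceeds n k z x = rank_exceeds n k z' x"
  unfolding rank_exceeds_def by (metis (mono_tags, lifting) Collect_cong)

lemma rank_exceeds_measurable:
  assumes "\<And>j. j \<in> {1..n} \<Longrightarrow> Z j \<in> borel_measurable N"
  shows "{w\<in>space N. rank_exceeds n k (\<lambda>j. Z j w) x} \<in> sets N"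
proof -
  have "{w\<in>space N. rank_exceeds n k (\<lambda>j. Z j w) x}
      = (\<Union>J\<in>{J. J \<subseteq> {1..n} \<and> card J = k}. {w\<in>space N. \<forall>j\<in>J. Z j w > x})"
    unfolding rank_exceeds_iff_subset by auto
  also have "\<dots> \<in> sets N"
  proof (intro sets.finite_UN)
    fix J assume "J \<in> {J. J \<subseteq> {1..n} \<and> card J = k}"
    then have J: "finite J" "J \<subseteq> {1..n}" using finite_subset by auto
    have m: "{w\<in>space N. Z j w > x} \<in> sets N" if "j \<in> J" for j
      using assms[of j] that J by (auto intro: borel_measurable_less)
    show "{w\<in>space N. \<forall>j\<in>J. Z j w > x} \<in> sets N"
      using J m by (intro sets.sets_Collect_finite_All) auto
  qed simp
  finally show ?thesis .
qed

lemma countable_rank_exceeds_measurable: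
  assumes "countable D" "\<And>q j. q \<in> D \<Longrightarrow> j \<in> {1..n} \<Longrightarrow> f q j \<in> borel_measurable N"
  shows "{w\<in>space N. \<exists>q\<in>D. rank_exceeds n k (\<lambda>j. f q j w) (u q)} \<in> sets N"
proof -
  have "{w\<in>space N. \<exists>q\<in>D. rank_exceeds n k (\<lambda>j. f q j w) (u q)}
     = (\<Union>q\<in>D. {w\<in>space N. rank_exceeds n k (\<lambda>j. f q j w) (u q)})" by auto
  then show ?thesis
    using assms by (auto intro!: sets.countable_UN' rank_exceeds_measurable)
qed

lemma open_rank_exceeds:
  fixes t :: real
  assumes "\<And>j. j \<in> {1..n} \<Longrightarrow> continuous_on S (\<lambda>t. z j t)" "t \<in> S" "rank_exceeds n k (\<lambda>j. z j t) x"
  shows "\<exists>d>0. \<forall>s\<in>S. \<bar>s - t\<bar> < d \<longrightarrow> rank_exceeds n k (\<lambda>j. z j s) x"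
proof -
  from assms(3) obtain J where J: "J \<subseteq> {1..n}" "card J = k" "\<And>j. j \<in> J \<Longrightarrow> z j t > x"
    unfolding rank_exceeds_iff_subset by auto
  then have fin: "finite J" using finite_subset by auto
  have "\<forall>j\<in>J. \<exists>d>0. \<forall>s\<in>S. \<bar>s - t\<bar> < d \<longrightarrow> z j s > x"
  proof
    fix j assume j: "j \<in> J"
    then have "continuous_on S (\<lambda>t. z j t)" "z j t - x > 0" using assms J by auto
    then obtain d where "d > 0" "\<forall>s\<in>S. dist s t < d \<longrightarrow> dist (z j s) (z j t) < z j t - x"
      using assms(2) unfolding continuous_on_iff by meson
    then show "\<exists>d>0. \<forall>s\<in>S. \<bar>s - t\<bar> < d \<longrightarrow> z j s > x"
      by (intro exI[of _ d]) (auto simp: dist_real_def abs_if split: if_splits)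
  qed
  then obtain d where d: "\<And>j. j \<in> J \<Longrightarrow> d j > 0" "\<And>j s. j \<in> J \<Longrightarrow> s \<in> S \<Longrightarrow> \<bar>s - t\<bar> < d j \<Longrightarrow> z j s > x"
    by metis
  define e where "e = Min (insert 1 (d ` J))"
  have "e > 0" unfolding e_def using fin d(1) by (subst Min_gr_iff) auto
  moreover have "e \<le> d j" if "j \<in> J" for j unfolding e_def using fin that by (intro Min_le) auto
  ultimately have "\<forall>s\<in>S. \<bar>s - t\<bar> < e \<longrightarrow> (\<forall>j\<in>J. z j s > x)"
    using d(2) less_le_trans by blast
  then have "\<forall>s\<in>S. \<bar>s - t\<bar> < e \<longrightarrow> rank_exceeds n k (\<lambda>j. z j s) x"
    unfolding rank_exceeds_iff_subset using J(1,2) by blast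
  with \<open>e > 0\<close> show ?thesis by blast
qed

section \<open>Orthogonal projection and ridge regression\<close>

lemma (in prob_space) integral_lin_comb_mult:
  assumes G: "gauss_set M S" and X: "X \<in> lin_span S" and Y: "Y \<in> lin_span S" and Z: "Z \<in> lin_span S"
  shows "(\<integral>w. (X w + c * Y w) * Z w \<partial>M) = (\<integral>w. X w * Z w \<partial>M) + c * (\<integral>w. Y w * Z w \<partial>M)"
  using gauss_set_integrable[OF G X Z] gauss_set_integrable[OF G Y Z]
  by (simp only: distrib_right mult.assoc Bochner_Integration.integral_add integrable_mult_right integral_mult_right_zero)

lemma (in prob_space) integral_sum_mult:
  assumes G: "gauss_set M S" and X: "\<And>i. i \<in> F \<Longrightarrow> X i \<in> lin_span S" and Z: "Z \<in> lin_span S"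
  shows "(\<integral>w. (\<Sum>i\<in>F. c i * X i w) * Z w \<partial>M) = (\<Sum>i\<in>F. c i * (\<integral>w. X i w * Z w \<partial>M))"
proof -
  have "(\<integral>w. (\<Sum>i\<in>F. c i * X i w) * Z w \<partial>M) = (\<integral>w. (\<Sum>i\<in>F. c i * (X i w * Z w)) \<partial>M)"
    by (simp add: sum_distrib_right mult.assoc)
  also have "\<dots> = (\<Sum>i\<in>F. \<integral>w. c i * (X i w * Z w) \<partial>M)"
    by (intro Bochner_Integration.integral_sum integrable_mult_right gauss_set_integrable[OF G X Z])
  finally show ?thesis by simp
qed

text \<open>
  Gram--Schmidt: a new regressor \<open>U a\<close> contributes through its part \<open>W\<close> orthogonal to the earlier ones. The
  regressors may be linearly dependent, in which case \<open>W\<close> can be degenerate.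
\<close>

lemma (in prob_space) orthogonal_projection_exists:
  assumes G: "gauss_set M S" and F: "finite F" and U: "\<And>g. g \<in> F \<Longrightarrow> U g \<in> lin_span S"
    and V: "V \<in> lin_span S"
  shows "\<exists>c. \<forall>g\<in>F. (\<integral>w. (V w - (\<Sum>h\<in>F. c h * U h w)) * U g w \<partial>M) = 0"
  using F U V
proof (induction F arbitrary: V rule: finite_induct)
  case empty
  then show ?case by simp
next
  case (insert a F)
  have Ua: "U a \<in> lin_span S" and UF: "\<And>g. g \<in> F \<Longrightarrow> U g \<in> lin_span S" using insert.prems by auto
  obtain d where d: "\<And>g. g \<in> F \<Longrightarrow> (\<integral>w. (U a w - (\<Sum>h\<in>F. d h * U h w)) * U g w \<partial>M) = 0"
    using insert.IH[OF UF Ua] by auto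
  obtain c where c: "\<And>g. g \<in> F \<Longrightarrow> (\<integral>w. (V w - (\<Sum>h\<in>F. c h * U h w)) * U g w \<partial>M) = 0"
    using insert.IH[OF UF insert.prems(2)] by auto
  define W where "W w = U a w - (\<Sum>h\<in>F. d h * U h w)" for w
  define V' where "V' w = V w - (\<Sum>h\<in>F. c h * U h w)" for w
  have W: "W \<in> lin_span S" and V': "V' \<in> lin_span S"
    unfolding W_def[abs_def] V'_def[abs_def] using insert.prems by (auto intro!: lin_span_diff lin_span_sum)
  define e where "e = (\<integral>w. V' w * W w \<partial>M) / (\<integral>w. W w * W w \<partial>M)"
  \<comment> \<open>If the second moment of W vanishes then e = 0, and V' * W vanishes almost surely.\<close>
  have "(\<integral>w. V' w * W w \<partial>M) = e * (\<integral>w. W w * W w \<partial>M)"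
  proof (cases "(\<integral>w. W w * W w \<partial>M) = 0")
    case True
    then have "AE w in M. W w * W w = 0"
      using integral_nonneg_eq_0_iff_AE[OF gauss_set_integrable[OF G W W]] by auto
    then have "AE w in M. V' w * W w = 0" by auto
    then have "(\<integral>w. V' w * W w \<partial>M) = (\<integral>w. 0 \<partial>M)"
      using gauss_set_integrable[OF G V' W] by (intro integral_cong_AE) auto
    then show ?thesis using True by simp
  qed (simp add: e_def)
  define R where "R w = V' w + (- e) * W w" for w
  have R: "R \<in> lin_span S" unfolding R_def[abs_def] using V' W by (rule lin_span_add_cmult[rotated])
  have RF: "(\<integral>w. R w * U g w \<partial>M) = 0" if "g \<in> F" for g
    unfolding R_def integral_lin_comb_mult[OF G V' W UF[OF that]]
    using d[OF that] c[OF that] by (simp add: W_def V'_def)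
  have RW: "(\<integral>w. R w * W w \<partial>M) = 0"
    unfolding R_def integral_lin_comb_mult[OF G V' W W] using \<open>_ = e * _\<close> by simp
  have "(\<integral>w. R w * U a w \<partial>M) = (\<integral>w. (W w + 1 * (\<Sum>h\<in>F. d h * U h w)) * R w \<partial>M)"
    by (simp add: W_def mult.commute)
  also have "\<dots> = 0"
    using integral_lin_comb_mult[OF G W lin_span_sum[where J=F and X=U and c=d, OF UF] R, of 1]
      integral_sum_mult[where X=U and F=F and c=d, OF G UF R] RF RW by (simp add: mult.commute)
  finally have Ra: "(\<integral>w. R w * U a w \<partial>M) = 0" .
  have "R w = V w - (\<Sum>h\<in>insert a F. ((\<lambda>h. c h - e * d h)(a := e)) h * U h w)" for w
  proof -
    have "(\<Sum>h\<in>insert a F. ((\<lambda>h. c h - e * d h)(a := e)) h * U h w) = e * U a w + (\<Sum>h\<in>F. (c h - e * d h) * U h w)"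
      using insert.hyps by (subst sum.insert) (auto intro!: sum.cong)
    also have "(\<Sum>h\<in>F. (c h - e * d h) * U h w) = (\<Sum>h\<in>F. c h * U h w) - e * (\<Sum>h\<in>F. d h * U h w)"
      by (simp add: left_diff_distrib sum_subtractf sum_distrib_left mult.assoc)
    finally show ?thesis by (simp add: R_def V'_def W_def algebra_simps)
  qed
  then show ?case
    using RF Ra by (intro exI[of _ "(\<lambda>h. c h - e * d h)(a := e)"]) auto
qed

lemma sum_abs_square_le: "(\<Sum>g\<in>F. \<bar>c g\<bar>)\<^sup>2 \<le> card F * (\<Sum>g\<in>F. (c g)\<^sup>2)" for c :: "'g \<Rightarrow> real"
  using sum_squared_le_sum_of_squares[of "\<lambda>g. \<bar>c g\<bar>" F]
  by (cases "finite F") (auto simp: mult.commute)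

text \<open>
  Let \<open>c\<close> be the vector of regression coefficients. If the regressors contain independent noise of variance
  \<open>\<sigma>\<^sup>2\<close>, the second moment of the projection \<open>\<Sum>h\<in>F. c h * U h\<close> is at least \<open>\<sigma>\<^sup>2 |c|\<^sup>2\<close>. By orthogonality it
  also equals \<open>\<Sum>g\<in>F. c g * cov (V, U g)\<close>, which is at most \<open>\<delta>\<close> times the \<open>l\<^sup>1\<close>-norm of \<open>c\<close>. The Cauchy--Schwarz
  inequality then bounds that norm, however degenerate the regressors are without the noise.
\<close>

lemma (in prob_space) ridge_regression:
  fixes \<sigma> \<delta> :: real
  assumes G: "gauss_set M S" and F: "finite F" and U: "\<And>g. g \<in> F \<Longrightarrow> U g \<in> lin_span S"
    and V: "V \<in> lin_span S" and "\<sigma> > 0" "\<delta> \<ge> 0"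
    and noise: "\<And>c. \<sigma>\<^sup>2 * (\<Sum>g\<in>F. (c g)\<^sup>2) \<le> (\<integral>w. (\<Sum>g\<in>F. c g * U g w)\<^sup>2 \<partial>M)"
    and cov: "\<And>g. g \<in> F \<Longrightarrow> \<bar>\<integral>w. V w * U g w \<partial>M\<bar> \<le> \<delta>"
  shows "\<exists>c. (\<forall>g\<in>F. (\<integral>w. (V w - (\<Sum>h\<in>F. c h * U h w)) * U g w \<partial>M) = 0) \<and>
     (\<Sum>g\<in>F. \<bar>c g\<bar>) \<le> card F * \<delta> / \<sigma>\<^sup>2"
proof -
  obtain c where c: "\<And>g. g \<in> F \<Longrightarrow> (\<integral>w. (V w - (\<Sum>h\<in>F. c h * U h w)) * U g w \<partial>M) = 0"
    using orthogonal_projection_exists[where U=U, OF G F U V] by auto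
  let ?P = "\<lambda>w. \<Sum>h\<in>F. c h * U h w"
  have P: "?P \<in> lin_span S" using U by (rule lin_span_sum)
  have PU: "(\<integral>w. ?P w * U g w \<partial>M) = (\<integral>w. V w * U g w \<partial>M)" if "g \<in> F" for g
  proof -
    have "0 = (\<integral>w. (V w + (-1) * ?P w) * U g w \<partial>M)" using c[OF that] by simp
    also have "\<dots> = (\<integral>w. V w * U g w \<partial>M) + (-1) * (\<integral>w. ?P w * U g w \<partial>M)"
      by (rule integral_lin_comb_mult[OF G V P U[OF that]])
    finally show ?thesis by linarith
  qed
  have "\<sigma>\<^sup>2 * (\<Sum>g\<in>F. (c g)\<^sup>2) \<le> (\<integral>w. ?P w * ?P w \<partial>M)"
    using noise[of c] by (simp only: power2_eq_square)
  also have "\<dots> = (\<Sum>g\<in>F. c g * (\<integral>w. ?P w * U g w \<partial>M))"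
  proof -
    have "(\<integral>w. ?P w * ?P w \<partial>M) = (\<Sum>g\<in>F. c g * (\<integral>w. U g w * ?P w \<partial>M))"
      by (rule integral_sum_mult[where X=U and F=F and c=c, OF G U P])
    also have "(\<lambda>g. \<integral>w. U g w * ?P w \<partial>M) = (\<lambda>g. \<integral>w. ?P w * U g w \<partial>M)"
      by (subst mult.commute) (rule refl)
    finally show ?thesis .
  qed
  also have "\<dots> = (\<Sum>g\<in>F. c g * (\<integral>w. V w * U g w \<partial>M))"
    by (intro sum.cong refl arg_cong2[of _ _ _ _ "(*)"] PU)
  also have "\<dots> \<le> (\<Sum>g\<in>F. \<bar>c g\<bar> * \<delta>)"
  proof (rule sum_mono)
    fix g assume "g \<in> F"
    have "c g * (\<integral>w. V w * U g w \<partial>M) \<le> \<bar>c g\<bar> * \<bar>\<integral>w. V w * U g w \<partial>M\<bar>"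
      by (simp add: abs_mult[symmetric])
    also have "\<dots> \<le> \<bar>c g\<bar> * \<delta>" using cov[OF \<open>g \<in> F\<close>] by (rule mult_left_mono) simp
    finally show "c g * (\<integral>w. V w * U g w \<partial>M) \<le> \<bar>c g\<bar> * \<delta>" .
  qed
  finally have *: "\<sigma>\<^sup>2 * (\<Sum>g\<in>F. (c g)\<^sup>2) \<le> (\<Sum>g\<in>F. \<bar>c g\<bar>) * \<delta>" by (simp add: sum_distrib_right)
  let ?s = "\<Sum>g\<in>F. \<bar>c g\<bar>"
  have "\<sigma>\<^sup>2 * ?s\<^sup>2 \<le> \<sigma>\<^sup>2 * (card F * (\<Sum>g\<in>F. (c g)\<^sup>2))"
    by (intro mult_left_mono sum_abs_square_le) simp
  also have "\<dots> \<le> card F * (?s * \<delta>)"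
    using mult_left_mono[OF *, of "card F"] by (simp add: mult_ac)
  finally have **: "?s * (\<sigma>\<^sup>2 * ?s) \<le> ?s * (card F * \<delta>)" by (simp add: power2_eq_square mult_ac)
  have "?s \<ge> 0" by (simp add: sum_nonneg)
  have "?s \<le> card F * \<delta> / \<sigma>\<^sup>2"
  proof (cases "?s = 0")
    case True then show ?thesis using \<open>\<delta> \<ge> 0\<close> by simp
  next
    case False
    then have "\<sigma>\<^sup>2 * ?s \<le> card F * \<delta>" using ** \<open>?s \<ge> 0\<close> by (simp add: mult_le_cancel_left_pos)
    then show ?thesis using \<open>\<sigma> > 0\<close> by (simp add: field_simps)
  qed
  with c show ?thesis by blast
qed

section \<open>Shifting a standard normal variable\<close>

text \<open>
  The density of the shifted variable is \<open>exp (c * x - c\<^sup>2 / 2)\<close> times the original density, and this factor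
  is at most \<open>exp (c * y)\<close> for \<open>x \<le> y\<close>.
\<close>

lemma std_normal_shift:
  assumes E[measurable]: "E \<in> sets borel" and c: "c \<ge> 0"
  shows "measure std_normal_distribution {x. x + c \<in> E}
     \<le> exp (c * y) * measure std_normal_distribution E + measure std_normal_distribution {y - c<..}"
proof -
  interpret std: prob_space std_normal_distribution by (rule prob_space_std_normal)
  have [measurable]: "{x. x + c \<in> E} \<in> sets borel"
    using measurable_sets[of "\<lambda>x. x + c" borel borel E] by (simp add: vimage_def)
  have sub: "{x. x + c \<in> E} \<subseteq> {x. x + c \<in> E \<and> x + c \<le> y} \<union> {y - c<..}" by auto
  have [measurable]: "{x. x + c \<in> E \<and> x + c \<le> y} \<in> sets borel"
  proof -
    have "{x. x + c \<in> E \<and> x + c \<le> y} = {x. x + c \<in> E} \<inter> {..y - c}" by auto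
    then show ?thesis by simp
  qed
  have "emeasure std_normal_distribution {x. x + c \<in> E \<and> x + c \<le> y}
      = (\<integral>\<^sup>+x. ennreal (std_normal_density x) * indicator {x. x + c \<in> E \<and> x + c \<le> y} x \<partial>lborel)"
    by (subst emeasure_density) auto
  also have "\<dots> = (\<integral>\<^sup>+x. ennreal (std_normal_density ((x + c) - c)) * indicator (E \<inter> {..y}) (x + c) \<partial>lborel)"
    by (intro nn_integral_cong) (auto simp: indicator_def)
  also have "\<dots> = (\<integral>\<^sup>+x. ennreal (std_normal_density (x - c)) * indicator (E \<inter> {..y}) x \<partial>lborel)"
    using nn_integral_real_affine[of "\<lambda>x. ennreal (std_normal_density (x - c)) * indicator (E \<inter> {..y}) x" 1 c]
    by (simp add: add.commute)
  also have "\<dots> \<le> (\<integral>\<^sup>+x. ennreal (exp (c * y)) * (ennreal (std_normal_density x) * indicator E x) \<partial>lborel)"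
  proof (intro nn_integral_mono)
    fix x :: real
    show "ennreal (std_normal_density (x - c)) * indicator (E \<inter> {..y}) x
        \<le> ennreal (exp (c * y)) * (ennreal (std_normal_density x) * indicator E x)"
    proof (cases "x \<in> E \<inter> {..y}")
      case True
      then have "c * x \<le> c * y" using c by (intro mult_left_mono) auto
      moreover have "(x - c)\<^sup>2 = x\<^sup>2 - 2 * (c * x) + c\<^sup>2" by (simp add: power2_diff)
      ultimately have "- (x - c)\<^sup>2 / 2 \<le> c * y + (- x\<^sup>2 / 2)"
        using zero_le_power2[of c] by linarith
      then have "exp (- (x - c)\<^sup>2 / 2) \<le> exp (c * y) * exp (- x\<^sup>2 / 2)" by (simp flip: exp_add)
      then have "std_normal_density (x - c) \<le> exp (c * y) * std_normal_density x"
        unfolding std_normal_density_def by (simp add: field_simps)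
      with True show ?thesis by (simp flip: ennreal_mult add: normal_density_nonneg ennreal_leI)
    qed (auto simp: indicator_def)
  qed
  also have "\<dots> = ennreal (exp (c * y)) * emeasure std_normal_distribution E"
    by (subst nn_integral_cmult) (auto simp: emeasure_density)
  finally have *: "measure std_normal_distribution {x. x + c \<in> E \<and> x + c \<le> y} \<le> exp (c * y) * measure std_normal_distribution E"
    by (simp add: std.emeasure_eq_measure flip: ennreal_mult)
  have "measure std_normal_distribution {x. x + c \<in> E}
     \<le> measure std_normal_distribution ({x. x + c \<in> E \<and> x + c \<le> y} \<union> {y - c<..})"
    by (intro std.finite_measure_mono sub) auto
  also have "\<dots> \<le> measure std_normal_distribution {x. x + c \<in> E \<and> x + c \<le> y} + measure std_normal_distribution {y - c<..}"
    by (intro measure_Un_le) auto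
  finally show ?thesis using * by linarith
qed

lemma pair_std_normal_shift:
  assumes "prob_space M" and E: "E \<in> sets (M \<Otimes>\<^sub>M borel)" and c: "c \<ge> 0"
  shows "measure (M \<Otimes>\<^sub>M std_normal_distribution) {p\<in>space (M \<Otimes>\<^sub>M borel). (fst p, snd p + c) \<in> E}
    \<le> exp (c * y) * measure (M \<Otimes>\<^sub>M std_normal_distribution) E + measure std_normal_distribution {y - c<..}"
proof -
  interpret M: prob_space M by fact
  interpret std: prob_space std_normal_distribution by (rule prob_space_std_normal)
  interpret pair_prob_space M std_normal_distribution ..
  let ?\<gamma> = std_normal_distribution
  have sets_eq: "sets (M \<Otimes>\<^sub>M ?\<gamma>) = sets (M \<Otimes>\<^sub>M borel)" by (intro sets_pair_measure_cong) auto
  let ?E' = "{p\<in>space (M \<Otimes>\<^sub>M borel). (fst p, snd p + c) \<in> E}"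
  have "(\<lambda>p. (fst p, snd p + c)) \<in> M \<Otimes>\<^sub>M borel \<rightarrow>\<^sub>M M \<Otimes>\<^sub>M borel" by measurable
  from measurable_sets[OF this E] have E': "?E' \<in> sets (M \<Otimes>\<^sub>M borel)"
    by (simp add: vimage_def Int_def conj_commute)
  have Ew: "Pair w -` E \<in> sets borel" for w using E by (rule sets_Pair1)
  have Em: "(\<lambda>w. measure ?\<gamma> (Pair w -` E)) \<in> borel_measurable M"
  proof -
    have "(\<lambda>w. emeasure ?\<gamma> (Pair w -` E)) \<in> borel_measurable M"
      using E by (intro std.measurable_emeasure_Pair) (simp add: sets_eq)
    then show ?thesis unfolding measure_def by measurable
  qed
  have "emeasure (M \<Otimes>\<^sub>M ?\<gamma>) ?E' = (\<integral>\<^sup>+w. emeasure ?\<gamma> (Pair w -` ?E') \<partial>M)"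
    using E' by (intro std.emeasure_pair_measure_alt) (simp add: sets_eq)
  also have "\<dots> \<le> (\<integral>\<^sup>+w. ennreal (exp (c * y)) * emeasure ?\<gamma> (Pair w -` E) + ennreal (measure ?\<gamma> {y - c<..}) \<partial>M)"
  proof (intro nn_integral_mono)
    fix w assume "w \<in> space M"
    then have "Pair w -` ?E' = {x. x + c \<in> Pair w -` E}" by (auto simp: space_pair_measure)
    then show "emeasure ?\<gamma> (Pair w -` ?E') \<le> ennreal (exp (c * y)) * emeasure ?\<gamma> (Pair w -` E) + ennreal (measure ?\<gamma> {y - c<..})"
      using std_normal_shift[OF Ew c, of w y]
      by (simp add: std.emeasure_eq_measure flip: ennreal_mult ennreal_plus)
  qed
  also have "\<dots> = ennreal (exp (c * y)) * (\<integral>\<^sup>+w. emeasure ?\<gamma> (Pair w -` E) \<partial>M) + ennreal (measure ?\<gamma> {y - c<..})"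
    using Em by (subst nn_integral_add) (auto simp: nn_integral_cmult std.emeasure_eq_measure M.emeasure_space_1)
  also have "(\<integral>\<^sup>+w. emeasure ?\<gamma> (Pair w -` E) \<partial>M) = emeasure (M \<Otimes>\<^sub>M ?\<gamma>) E"
    using E by (intro std.emeasure_pair_measure_alt[symmetric]) (simp add: sets_eq)
  finally show ?thesis
    by (simp add: emeasure_eq_measure flip: ennreal_mult ennreal_plus)
qed

section \<open>Chaining\<close>

text \<open>
  A continuous path whose increments along dyadic refinements of a grid are small stays close to its values
  on the grid: \<open>t\<close> is approximated by the grid points \<open>s l\<close> to its left at level \<open>l\<close>, and \<open>s (Suc l)\<close> is either
  \<open>s l\<close> or the next point of level \<open>Suc l\<close>. The grid point is given explicitly because it must not depend on
  the path: it has to be the same for all copies.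
\<close>

lemma chaining_path:
  fixes x :: "real \<Rightarrow> real"
  assumes cont: "continuous_on {0..b} x" and b: "b > 0" and m: "m > 0"
    and inc: "\<And>l i. i < m * 2 ^ Suc l \<Longrightarrow>
       \<bar>x (real (Suc i) * (b / m / 2 ^ Suc l)) - x (real i * (b / m / 2 ^ Suc l))\<bar> \<le> e l"
    and e: "\<And>L. (\<Sum>l<L. e l) \<le> \<eta>" and t: "t \<in> {0..b}"
  shows "nat \<lfloor>t / (b / m)\<rfloor> \<le> m"
    and "\<bar>x t - x (real (nat \<lfloor>t / (b / m)\<rfloor>) * (b / m))\<bar> \<le> \<eta>"
proof -
  define q where "q = b / m"
  have q: "q > 0" "q * m = b" using b m by (auto simp: q_def)
  define g where "g l = nat \<lfloor>t * 2 ^ l / q\<rfloor>" for l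
  define s where "s l = real (g l) * (q / 2 ^ l)" for l
  have nn: "t * 2 ^ l / q \<ge> 0" for l using t q by auto
  have g1: "real (g l) \<le> t * 2 ^ l / q" "t * 2 ^ l / q < real (g l) + 1" for l
    using nn[of l] unfolding g_def by linarith+
  have gm: "g l \<le> m * 2 ^ l" for l
  proof -
    have "t * 2 ^ l / q \<le> real (m * 2 ^ l)"
      using t q by (simp add: divide_le_eq mult_ac)
    then show ?thesis using g1(1)[of l] by linarith
  qed
  have s0: "s 0 = real (g 0) * (b / m)" by (simp add: s_def q_def)
  have st: "s l \<le> t" "t - q / 2 ^ l \<le> s l" "0 \<le> s l" for l
  proof -
    have "t * 2 ^ l < (real (g l) + 1) * q" "real (g l) * q \<le> t * 2 ^ l"
      using g1[of l] q by (auto simp: pos_divide_less_eq pos_le_divide_eq)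
    then have "t < (real (g l) + 1) * q / 2 ^ l" "real (g l) * q / 2 ^ l \<le> t"
      by (auto simp: pos_less_divide_eq pos_divide_le_eq)
    then show "s l \<le> t" "t - q / 2 ^ l \<le> s l"
      by (auto simp: s_def distrib_right add_divide_distrib)
    show "0 \<le> s l" using q by (simp add: s_def)
  qed
  have step: "\<bar>x (s (Suc l)) - x (s l)\<bar> \<le> e l" for l
  proof -
    have e0: "0 \<le> e l" using inc[of 0 l] m by auto
    have "t * 2 ^ Suc l / q = 2 * (t * 2 ^ l / q)" by simp
    then have "2 * real (g l) \<le> t * 2 ^ Suc l / q" "t * 2 ^ Suc l / q < 2 * real (g l) + 2"
      using g1[of l] by linarith+
    then have "g (Suc l) = 2 * g l \<or> g (Suc l) = Suc (2 * g l)"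
      using g1[of "Suc l"] by linarith
    then show ?thesis
    proof
      assume "g (Suc l) = 2 * g l"
      then have "s (Suc l) = s l" by (simp add: s_def)
      then show ?thesis using e0 by simp
    next
      assume *: "g (Suc l) = Suc (2 * g l)"
      then have "2 * g l < m * 2 ^ Suc l" using gm[of "Suc l"] by simp
      from inc[OF this] show ?thesis by (simp add: s_def * q_def field_simps)
    qed
  qed
  have close: "\<bar>x (s L) - x (s 0)\<bar> \<le> \<eta>" for L
  proof -
    have "\<bar>x (s L) - x (s 0)\<bar> \<le> (\<Sum>l<L. e l)"
    proof (induction L)
      case (Suc L)
      then show ?case using step[of L] by simp
    qed simp
    with e[of L] show ?thesis by linarith
  qed
  have "(\<lambda>l. q / 2 ^ l) \<longlonglongrightarrow> 0"
    using LIMSEQ_divide_realpow_zero[of 2 q] by simp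
  then have "(\<lambda>l. t - q / 2 ^ l) \<longlonglongrightarrow> t" using tendsto_diff[OF tendsto_const] by fastforce
  then have "s \<longlonglongrightarrow> t"
    by (rule tendsto_sandwich[rotated 2, OF _ tendsto_const]) (use st in auto)
  then have "(\<lambda>l. x (s l)) \<longlonglongrightarrow> x t"
  proof (rule continuous_on_tendsto_compose[OF cont])
    show "t \<in> {0..b}" by (rule t)
    have "s l \<in> {0..b}" for l using st[of l] t by auto
    then show "\<forall>\<^sub>F l in sequentially. s l \<in> {0..b}" by simp
  qed
  then have "(\<lambda>l. \<bar>x (s l) - x (s 0)\<bar>) \<longlonglongrightarrow> \<bar>x t - x (s 0)\<bar>" by (intro tendsto_intros)
  then have "\<bar>x t - x (s 0)\<bar> \<le> \<eta>" by (rule LIMSEQ_le_const2) (use close in auto)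
  moreover have "g 0 = nat \<lfloor>t / (b / m)\<rfloor>" by (simp add: g_def q_def)
  ultimately show "nat \<lfloor>t / (b / m)\<rfloor> \<le> m" "\<bar>x t - x (real (nat \<lfloor>t / (b / m)\<rfloor>) * (b / m))\<bar> \<le> \<eta>"
    using gm[of 0] s0 by auto
qed

section \<open>Independent copies of a stationary Gaussian process\<close>

text \<open>
  The setting after the passage to versions with continuous paths: \<open>Z 1, \<dots>, Z n\<close> are uncorrelated,
  jointly Gaussian, and have correlation function \<open>\<rho>\<close>. Here all paths are continuous, so that exceedance events
  are measurable without completion.
\<close>

locale gaussian_copies = prob_space M for M :: "'b measure" +
  fixes Z :: "nat \<Rightarrow> real \<Rightarrow> 'b \<Rightarrow> real" and n k :: nat and \<rho> :: "real \<Rightarrow> real"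
  assumes k: "1 \<le> k" "k \<le> n"
    and gauss: "gauss_set M ((\<lambda>(j, t). Z j t) ` ({1..n} \<times> {0..}))"
    and cov: "\<And>i j s t. \<lbrakk>i \<in> {1..n}; j \<in> {1..n}; 0 \<le> s; 0 \<le> t\<rbrakk> \<Longrightarrow>
      (\<integral>w. Z i s w * Z j t w \<partial>M) = (if i = j then \<rho> \<bar>t - s\<bar> else 0)"
    and cont: "\<And>j w. j \<in> {1..n} \<Longrightarrow> w \<in> space M \<Longrightarrow> continuous_on {0..} (\<lambda>t. Z j t w)"
    and rho_0: "\<rho> 0 = 1"
begin

abbreviation "S \<equiv> (\<lambda>(j, t). Z j t) ` ({1..n} \<times> {0..})"

lemma Z_span: "j \<in> {1..n} \<Longrightarrow> 0 \<le> t \<Longrightarrow> Z j t \<in> lin_span S"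
  by (rule lin_span_base) force

lemma Z_measurable: "j \<in> {1..n} \<Longrightarrow> 0 \<le> t \<Longrightarrow> Z j t \<in> borel_measurable M"
  using Z_span gauss by (blast intro: centered_gaussian_measurable gauss_setD)

definition hit :: "real \<Rightarrow> real \<Rightarrow> real \<Rightarrow> 'b set" where
  "hit a c u = {w\<in>space M. \<exists>t\<in>{a..c}. rank_exceeds n k (\<lambda>j. Z j t w) u}"

text \<open>
  The set of exceedance times of a fixed level is open in the half-line. The rational points are taken
  relative to \<open>a\<close>, so that events on different intervals are given by the same functional of the shifted process.
\<close>

lemma hit_rational:
  assumes "0 \<le> a" "L > 0" "w \<in> space M"
  shows "(\<exists>t\<in>{a..a+L}. rank_exceeds n k (\<lambda>j. Z j t w) u)
     \<longleftrightarrow> (\<exists>q\<in>\<rat>\<inter>{0..L}. rank_exceeds n k (\<lambda>j. Z j (a + q) w) u)"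
proof
  assume "\<exists>q\<in>\<rat>\<inter>{0..L}. rank_exceeds n k (\<lambda>j. Z j (a + q) w) u"
  then obtain q where "q \<in> {0..L}" "rank_exceeds n k (\<lambda>j. Z j (a + q) w) u" by auto
  then show "\<exists>t\<in>{a..a+L}. rank_exceeds n k (\<lambda>j. Z j t w) u"
    by (intro bexI[of _ "a + q"]) auto
next
  assume "\<exists>t\<in>{a..a+L}. rank_exceeds n k (\<lambda>j. Z j t w) u"
  then obtain t where t: "a \<le> t" "t \<le> a + L" "rank_exceeds n k (\<lambda>j. Z j t w) u" by auto
  obtain d where d: "d > 0" "\<And>s. s \<ge> 0 \<Longrightarrow> \<bar>s - t\<bar> < d \<Longrightarrow> rank_exceeds n k (\<lambda>j. Z j s w) u"
    using open_rank_exceeds[of n "{0..}" "\<lambda>j t. Z j t w" t k u] cont assms t by auto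
  obtain q where q: "q \<in> \<rat>" "0 \<le> q" "q \<le> L" "\<bar>q - (t - a)\<bar> < d"
  proof (cases "t - a < L")
    case True
    then obtain q where "q \<in> \<rat>" "t - a < q" "q < min L (t - a + d)"
      using Rats_dense_in_real[of "t - a" "min L (t - a + d)"] d(1) by auto
    then show ?thesis using t by (intro that[of q]) auto
  next
    case False
    then have "t - a = L" using t by auto
    obtain q where "q \<in> \<rat>" "max 0 (L - d) < q" "q < L"
      using Rats_dense_in_real[of "max 0 (L - d)" L] d(1) assms by auto
    then show ?thesis using \<open>t - a = L\<close> by (intro that[of q]) auto
  qed
  then show "\<exists>q\<in>\<rat>\<inter>{0..L}. rank_exceeds n k (\<lambda>j. Z j (a + q) w) u"
    using d(2)[of "a + q"] assms by (intro bexI[of _ q]) (auto simp: algebra_simps)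
qed

lemma hit_eq_rational:
  assumes "0 \<le> a" "L > 0"
  shows "hit a (a + L) u = {w\<in>space M. \<exists>q\<in>\<rat>\<inter>{0..L}. rank_exceeds n k (\<lambda>j. Z j (a + q) w) u}"
  unfolding hit_def using hit_rational[OF assms] by auto

lemma countable_Rats_Int: "countable (\<rat> \<inter> X)"
  using countable_rat by (rule countable_subset[rotated]) auto

lemma hit_sets: "0 \<le> a \<Longrightarrow> L > 0 \<Longrightarrow> hit a (a + L) u \<in> sets M"
  unfolding hit_eq_rational
  by (intro countable_rank_exceeds_measurable countable_Rats_Int Z_measurable) auto

lemma hit_sets0: "L > 0 \<Longrightarrow> hit 0 L u \<in> sets M"
  using hit_sets[of 0 L u] by simp

lemma hit_antimono: "u \<le> v \<Longrightarrow> hit a c v \<subseteq> hit a c u"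
  unfolding hit_def by (auto elim!: bexI[rotated] rank_exceeds_mono)

lemma hit_stationary:
  assumes "0 \<le> a" "L > 0"
  shows "prob (hit a (a + L) u) = prob (hit 0 L u)"
proof -
  let ?I = "{1..n} \<times> (\<rat> \<inter> {0..L})"
  let ?Q = "\<lambda>x. \<exists>q\<in>\<rat>\<inter>{0..L}. rank_exceeds n k (\<lambda>j. x (j, q)) u"
  have restr: "?Q (\<lambda>i\<in>?I. X i) \<longleftrightarrow> ?Q X" for X :: "nat \<times> real \<Rightarrow> real"
    by (intro bex_cong refl rank_exceeds_cong) auto
  have "prob {w\<in>space M. ?Q (\<lambda>i\<in>?I. (\<lambda>(j, q). Z j (a + q)) i w)}
      = prob {w\<in>space M. ?Q (\<lambda>i\<in>?I. (\<lambda>(j, q). Z j q) i w)}"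
  proof (rule gauss_law_measure_eq)
    show "gauss_set M ((\<lambda>(j, q). Z j (a + q)) ` ?I)" "gauss_set M ((\<lambda>(j, q). Z j q) ` ?I)"
      using assms Z_span by (auto intro!: gauss_set_mono[OF gauss])
    show "{x \<in> space (Pi\<^sub>M ?I (\<lambda>_. borel)). ?Q x} \<in> sets (Pi\<^sub>M ?I (\<lambda>_. borel))"
      by (intro countable_rank_exceeds_measurable countable_Rats_Int measurable_component_singleton) auto
  qed (use assms in \<open>auto simp: cov prob_space_axioms\<close>)
  then show ?thesis
    unfolding restr hit_eq_rational[OF assms] using hit_eq_rational[of 0 L u] assms by simp
qed

lemma hit_lower_bound:
  assumes "L > 0"
  shows "measure std_normal_distribution {u<..} ^ k \<le> prob (hit 0 L u)"
proof -
  let ?I = "{1..k}" and ?P = "PiM {1..k} (\<lambda>_. std_normal_distribution)"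
  let ?Q = "\<lambda>x::nat\<Rightarrow>real. \<forall>i\<in>?I. x i > u"
  interpret P: product_prob_space "\<lambda>_. std_normal_distribution" ?I
    by (intro product_prob_spaceI prob_space_std_normal)
  interpret fP: finite_product_prob_space "\<lambda>_. std_normal_distribution" ?I
    by unfold_locales simp
  have "prob {w\<in>space M. ?Q (\<lambda>i\<in>?I. Z i 0 w)} = measure ?P {x\<in>space ?P. ?Q (\<lambda>i\<in>?I. x i)}"
  proof (rule gauss_law_measure_eq)
    show "gauss_set M ((\<lambda>i. Z i 0) ` ?I)"
      using k Z_span by (intro gauss_set_mono[OF gauss]) auto
    show "gauss_set ?P ((\<lambda>i x. x i) ` ?I)" by (rule gauss_set_white_noise) simp
    show "prob_space ?P" by (rule P.P.prob_space_axioms)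
    show "{x \<in> space (Pi\<^sub>M ?I (\<lambda>_. borel)). ?Q x} \<in> sets (Pi\<^sub>M ?I (\<lambda>_. borel))"
      by (intro sets.sets_Collect_finite_All borel_measurable_less measurable_component_singleton) auto
  qed (use k in \<open>auto simp: cov prob_space_axioms rho_0 white_noise_cov\<close>)
  also have "{x\<in>space ?P. ?Q (\<lambda>i\<in>?I. x i)} = PiE ?I (\<lambda>_. {u<..})"
    by (auto simp: space_PiM PiE_iff extensional_def)
  also have "measure ?P (PiE ?I (\<lambda>_. {u<..})) = measure std_normal_distribution {u<..} ^ k"
    by (subst fP.finite_measure_PiM_emb) (auto)
  finally have "measure std_normal_distribution {u<..} ^ k = prob {w\<in>space M. ?Q (\<lambda>i\<in>?I. Z i 0 w)}" ..
  also have "\<dots> \<le> prob (hit 0 L u)"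
  proof (rule finite_measure_mono[OF _ hit_sets0[OF assms]])
    show "{w\<in>space M. ?Q (\<lambda>i\<in>?I. Z i 0 w)} \<subseteq> hit 0 L u"
    proof
      fix w assume w: "w \<in> {w\<in>space M. ?Q (\<lambda>i\<in>?I. Z i 0 w)}"
      then have "rank_exceeds n k (\<lambda>j. Z j 0 w) u"
        unfolding rank_exceeds_iff_subset using k by (intro bexI[of _ ?I]) auto
      then show "w \<in> hit 0 L u" using w assms by (auto simp: hit_def intro!: bexI[of _ 0])
    qed
  qed
  finally show ?thesis .
qed

text \<open>
  All copies are raised together on \<open>[0, L]\<close> by shifting the single normal variable
  \<open>(Z 1 0 + \<dots> + Z n 0) / sqrt n\<close>, whose covariance with \<open>Z j t\<close> is \<open>\<rho> t / sqrt n\<close>.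
\<close>

lemma hit_level_regularity:
  assumes L: "L > 0" and half: "\<And>t. 0 \<le> t \<Longrightarrow> t \<le> L \<Longrightarrow> \<rho> t \<ge> 1 / 2" and "\<eta> \<ge> 0"
  shows "prob (hit 0 L (u - \<eta>)) \<le> exp (2 * sqrt n * \<eta> * y) * prob (hit 0 L u)
      + measure std_normal_distribution {y - 2 * sqrt n * \<eta><..}"
proof -
  have n: "n > 0" using k by simp
  define D where "D = \<rat> \<inter> {0..L}"
  define c where "c = 2 * sqrt n * \<eta>"
  define \<kappa> where "\<kappa> t = \<rho> t / sqrt n" for t
  \<comment> \<open>G is standard normal and independent of the residuals R, and Z j t = R j t + \<kappa> t * G.\<close>
  define G where "G w = (\<Sum>j\<in>{1..n}. 1 / sqrt n * Z j 0 w)" for w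
  define R where "R j t w = Z j t w + (- \<kappa> t) * G w" for j t w
  have cD: "countable D" unfolding D_def by (rule countable_Rats_Int)
  have D: "0 \<le> q" "q \<le> L" if "q \<in> D" for q using that by (auto simp: D_def)
  have Gs: "G \<in> lin_span S" unfolding G_def[abs_def] using Z_span by (intro lin_span_sum) auto
  have Rs: "R j t \<in> lin_span S" if "j \<in> {1..n}" "0 \<le> t" for j t
    unfolding R_def[abs_def] using Z_span[OF that] Gs by (rule lin_span_add_cmult[rotated])
  have GZ: "(\<integral>w. G w * Z j t w \<partial>M) = \<kappa> t" if "j \<in> {1..n}" "0 \<le> t" for j t
  proof -
    have "(\<integral>w. G w * Z j t w \<partial>M) = (\<Sum>i\<in>{1..n}. 1 / sqrt n * (\<integral>w. Z i 0 w * Z j t w \<partial>M))"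
      unfolding G_def using Z_span that by (intro integral_sum_mult[OF gauss]) auto
    also have "\<dots> = (\<Sum>i\<in>{1..n}. if i = j then \<rho> t / sqrt n else 0)"
      using that by (intro sum.cong) (auto simp: cov)
    finally show ?thesis using that by (simp add: \<kappa>_def)
  qed
  have GG: "(\<integral>w. G w * G w \<partial>M) = 1"
  proof -
    have "(\<integral>w. G w * G w \<partial>M) = (\<Sum>i\<in>{1..n}. 1 / sqrt n * (\<integral>w. Z i 0 w * G w \<partial>M))"
      unfolding G_def using Z_span Gs[unfolded G_def[abs_def]] by (intro integral_sum_mult[OF gauss]) auto
    also have "\<dots> = (\<Sum>i\<in>{1..n}. 1 / sqrt n * (1 / sqrt n))"
      using GZ[of _ 0] by (intro sum.cong) (auto simp: \<kappa>_def rho_0 mult.commute)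
    finally show ?thesis using n by simp
  qed
  have RG: "(\<integral>w. R j t w * G w \<partial>M) = 0" if "j \<in> {1..n}" "0 \<le> t" for j t
    unfolding R_def integral_lin_comb_mult[OF gauss Z_span[OF that] Gs Gs]
    using GZ[OF that] GG by (simp add: mult.commute)
  let ?\<gamma> = std_normal_distribution
  let ?N = "M \<Otimes>\<^sub>M ?\<gamma>"
  interpret std: prob_space ?\<gamma> by (rule prob_space_std_normal)
  interpret N: pair_prob_space M ?\<gamma> ..
  have sets_eq: "sets ?N = sets (M \<Otimes>\<^sub>M borel)" by (intro sets_pair_measure_cong) auto
  have space_eq: "space ?N = space (M \<Otimes>\<^sub>M borel)" by (simp add: space_pair_measure)
  let ?I = "Some ` ({1..n} \<times> D) \<union> {None}"
  define X where "X i = (case i of Some (j, q) \<Rightarrow> R j q | None \<Rightarrow> G)" for i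
  define X' where "X' i = (case i of Some (j, q) \<Rightarrow> (\<lambda>p. R j q (fst p)) | None \<Rightarrow> snd)" for i
  define Q where "Q v x \<longleftrightarrow> (\<exists>q\<in>D. rank_exceeds n k (\<lambda>j. x (Some (j, q)) + \<kappa> q * x None) v)" for v x
  have restr: "Q v (\<lambda>i\<in>?I. f i) \<longleftrightarrow> Q v f" for f v
    unfolding Q_def by (intro bex_cong refl rank_exceeds_cong) auto
  have gp: "gauss_set ?N ((\<lambda>Y p. Y (fst p)) ` S \<union> (\<lambda>Y p. Y (snd p)) ` {\<lambda>x. x})"
    by (intro gauss_set_pair prob_space_axioms std.prob_space_axioms gauss gauss_set_singleton centered_gaussian_std_normal)
  have fst_span: "(\<lambda>p. Y (fst p)) \<in> lin_span ((\<lambda>Y p. Y (fst p)) ` S \<union> (\<lambda>Y p. Y (snd p)) ` {\<lambda>x. x})"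
    if "Y \<in> lin_span S" for Y
    using that by (rule lin_span_pair)
  have transfer: "prob {w\<in>space M. Q v (\<lambda>i. X i w)} = measure ?N {p\<in>space ?N. Q v (\<lambda>i. X' i p)}" for v
  proof -
    have "prob {w\<in>space M. Q v (\<lambda>i\<in>?I. X i w)} = measure ?N {p\<in>space ?N. Q v (\<lambda>i\<in>?I. X' i p)}"
    proof (rule gauss_law_measure_eq)
      show "gauss_set M (X ` ?I)"
        using Gs Rs D by (intro gauss_set_mono[OF gauss]) (auto simp: X_def)
      show "gauss_set ?N (X' ` ?I)"
      proof (rule gauss_set_mono[OF gp], clarify)
        fix i assume "i \<in> ?I"
        then show "X' i \<in> lin_span ((\<lambda>Y p. Y (fst p)) ` S \<union> (\<lambda>Y p. Y (snd p)) ` {\<lambda>x. x})"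
          unfolding X'_def using fst_span[OF Rs] D by (cases i) (force intro: lin_span_base)+
      qed
      show "{x \<in> space (Pi\<^sub>M ?I (\<lambda>_. borel)). Q v x} \<in> sets (Pi\<^sub>M ?I (\<lambda>_. borel))"
        unfolding Q_def
        by (intro countable_rank_exceeds_measurable cD borel_measurable_add borel_measurable_times
             measurable_component_singleton) auto
      fix i j assume "i \<in> ?I" "j \<in> ?I"
      note cv = pair_integral_cov[OF prob_space_axioms std.prob_space_axioms gauss gauss_set_singleton[OF centered_gaussian_std_normal]]
      show "(\<integral>w. X i w * X j w \<partial>M) = (\<integral>p. X' i p * X' j p \<partial>?N)"
        using \<open>i \<in> ?I\<close> \<open>j \<in> ?I\<close> RG GG cv(1)[OF Rs Rs] cv(2)[of "\<lambda>x. x" "\<lambda>x. x"]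
           cv(3)[OF Rs, of _ _ "\<lambda>x. x"] cv(4)[OF Rs, of _ _ "\<lambda>x. x"]
        by (auto simp: X_def X'_def D lin_span_base std_normal_second_moment mult.commute[of "G _" "R _ _ _"])
    qed (auto simp: prob_space_axioms N.prob_space_axioms)
    then show ?thesis unfolding restr .
  qed
  have hitQ: "hit 0 L v = {w\<in>space M. Q v (\<lambda>i. X i w)}" for v
    using hit_eq_rational[of 0 L v] L by (simp add: Q_def X_def R_def D_def)
  define E where "E = {p\<in>space ?N. Q u (\<lambda>i. X' i p)}"
  have "\<And>j q. j \<in> {1..n} \<Longrightarrow> q \<in> D \<Longrightarrow> R j q \<in> borel_measurable M"
    using Rs D by (blast intro: centered_gaussian_measurable gauss_setD[OF gauss])
  then have Rm: "(\<lambda>p. R j q (fst p) + \<kappa> q * snd p) \<in> borel_measurable (M \<Otimes>\<^sub>M borel)"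
    if "j \<in> {1..n}" "q \<in> D" for j q
    using that by (intro borel_measurable_add borel_measurable_times borel_measurable_const
        measurable_snd measurable_compose[OF measurable_fst]) auto
  have Em: "E \<in> sets (M \<Otimes>\<^sub>M borel)"
    unfolding E_def Q_def X'_def space_eq option.case prod.case
    by (intro countable_rank_exceeds_measurable cD Rm)
  have "{p\<in>space ?N. Q (u - \<eta>) (\<lambda>i. X' i p)} \<subseteq> {p\<in>space (M \<Otimes>\<^sub>M borel). (fst p, snd p + c) \<in> E}"
  proof
    fix p assume "p \<in> {p\<in>space ?N. Q (u - \<eta>) (\<lambda>i. X' i p)}"
    then obtain q where p: "p \<in> space ?N" and q: "q \<in> D"
      and r: "rank_exceeds n k (\<lambda>j. R j q (fst p) + \<kappa> q * snd p) (u - \<eta>)"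
      by (auto simp: Q_def X'_def)
    have "\<eta> \<le> \<kappa> q * c"
      using mult_right_mono[OF half[OF D[OF q]], of "2 * \<eta>"] \<open>\<eta> \<ge> 0\<close> n by (simp add: \<kappa>_def c_def)
    then have "rank_exceeds n k (\<lambda>j. R j q (fst p) + \<kappa> q * (snd p + c)) u"
      by (intro rank_exceeds_mono[OF r]) (auto simp: distrib_left)
    then show "p \<in> {p\<in>space (M \<Otimes>\<^sub>M borel). (fst p, snd p + c) \<in> E}"
      using p q by (auto simp: E_def Q_def X'_def space_pair_measure)
  qed
  moreover have "{p\<in>space (M \<Otimes>\<^sub>M borel). (fst p, snd p + c) \<in> E} \<in> sets ?N"
  proof -
    have "(\<lambda>p. (fst p, snd p + c)) \<in> M \<Otimes>\<^sub>M borel \<rightarrow>\<^sub>M M \<Otimes>\<^sub>M borel" by measurable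
    from measurable_sets[OF this Em] show ?thesis
      by (simp add: vimage_def Int_def conj_commute sets_eq)
  qed
  ultimately have "prob (hit 0 L (u - \<eta>)) \<le> measure ?N {p\<in>space (M \<Otimes>\<^sub>M borel). (fst p, snd p + c) \<in> E}"
    unfolding hitQ transfer by (rule N.finite_measure_mono)
  also have "\<dots> \<le> exp (c * y) * measure ?N E + measure ?\<gamma> {y - c<..}"
    by (rule pair_std_normal_shift[OF prob_space_axioms Em]) (simp add: c_def \<open>\<eta> \<ge> 0\<close>)
  also have "measure ?N E = prob (hit 0 L u)" unfolding hitQ transfer E_def ..
  finally show ?thesis unfolding c_def .
qed

lemma increment_second_moment:
  assumes "j \<in> {1..n}" "0 \<le> s" "s \<le> t"
  shows "(\<integral>w. (Z j t w - Z j s w)\<^sup>2 \<partial>M) = 2 * (1 - \<rho> (t - s))"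
proof -
  have Zs: "Z j t \<in> lin_span S" "Z j s \<in> lin_span S" using assms Z_span by auto
  note gi = gauss_set_integrable[OF gauss]
  have "(\<integral>w. (Z j t w - Z j s w)\<^sup>2 \<partial>M) = (\<integral>w. Z j t w * Z j t w + (Z j s w * Z j s w - 2 * (Z j s w * Z j t w)) \<partial>M)"
    by (intro Bochner_Integration.integral_cong) (auto simp: power2_eq_square algebra_simps)
  also have "\<dots> = (\<integral>w. Z j t w * Z j t w \<partial>M) + ((\<integral>w. Z j s w * Z j s w \<partial>M) - 2 * (\<integral>w. Z j s w * Z j t w \<partial>M))"
    using gi[OF Zs(1) Zs(1)] gi[OF Zs(2) Zs(2)] gi[OF Zs(2) Zs(1)] by simp
  finally show ?thesis using assms by (simp add: cov rho_0)
qed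

text \<open>
  The standard deviation of an increment at level \<open>l\<close> of the refinement is of order \<open>2 powr (- \<alpha> * l / 2)\<close>.
  Allowing increments \<open>\<eta> * (1 - \<theta>) * \<theta> ^ l\<close> with \<open>\<theta> = 2 powr (- \<alpha> / 4)\<close> keeps their sum below \<open>\<eta>\<close>, while
  the ratio to the standard deviation grows geometrically. The condition on \<open>K\<close> makes the
  Gaussian tails beat the number \<open>m * 2 ^ Suc l\<close> of increments at every level.
\<close>

lemma chaining_exceptional_set:
  fixes A \<alpha> b \<eta> K :: real and m :: nat
  assumes pos: "A > 0" "\<alpha> > 0" "b > 0" "\<eta> > 0" "m > 0" and a: "a \<ge> 0"
    and incr: "\<And>t. 0 \<le> t \<Longrightarrow> t \<le> b \<Longrightarrow> 1 - \<rho> t \<le> A * t powr \<alpha>"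
  defines "K \<equiv> \<eta>\<^sup>2 * (1 - 2 powr (- \<alpha> / 4))\<^sup>2 / (4 * A * (b / m) powr \<alpha>)"
  assumes K: "K * \<alpha> \<ge> 4"
  shows "\<exists>Bad\<in>sets M. prob Bad \<le> 8 * n * m * exp (- K) \<and>
    (\<forall>w\<in>space M - Bad. \<forall>t\<in>{0..b}. \<exists>i\<le>m. \<forall>j\<in>{1..n}. \<bar>Z j (a + t) w - Z j (a + i * (b / m)) w\<bar> \<le> \<eta>)"
proof -
  define \<theta> where "\<theta> = 2 powr (- \<alpha> / 4)"
  have \<theta>: "0 < \<theta>" "\<theta> < 1" using pos by (auto simp: \<theta>_def powr_less_one)
  define e where "e l = \<eta> * (1 - \<theta>) * \<theta> ^ l" for l :: nat
  define h where "h l = b / m / 2 ^ Suc l" for l :: nat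
  have e0: "e l > 0" for l using \<theta> pos by (simp add: e_def)
  have h0: "h l > 0" for l using pos by (simp add: h_def)
  define bad where "bad j l i = {w\<in>space M. \<bar>Z j (a + real (Suc i) * h l) w - Z j (a + real i * h l) w\<bar> > e l}" for j l i
  have bad_sets: "bad j l i \<in> sets M" if "j \<in> {1..n}" for j l i
    unfolding bad_def using that a h0[of l]
    by (intro borel_measurable_less borel_measurable_abs borel_measurable_diff Z_measurable borel_measurable_const) auto
  have Kl: "K * (1 + l * (\<alpha> / 2 * ln 2)) \<le> (e l)\<^sup>2 / (2 * (2 * A * h l powr \<alpha>))" for l
  proof -
    have hl: "h l powr \<alpha> = (b / m) powr \<alpha> / (2 powr \<alpha>) ^ Suc l"
    proof -
      have "(2 ^ Suc l :: real) powr \<alpha> = (2 powr \<alpha>) ^ Suc l"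
        by (simp add: powr_realpow[symmetric] powr_powr powr_mult_base ring_distribs mult.commute flip: powr_add)
      then show ?thesis unfolding h_def using pos by (subst powr_divide) auto
    qed
    have th: "(\<theta> ^ l)\<^sup>2 * (2 powr \<alpha>) ^ Suc l = 2 powr (\<alpha> / 2 * l + \<alpha>)"
      unfolding \<theta>_def
      by (simp add: powr_realpow[symmetric] powr_powr field_simps flip: powr_add power_mult)
    have "K * (1 + l * (\<alpha> / 2 * ln 2)) \<le> K * 2 powr (\<alpha> / 2 * l + \<alpha>)"
    proof (rule mult_left_mono)
      have "1 + l * (\<alpha> / 2 * ln 2) \<le> exp (l * (\<alpha> / 2 * ln 2))" by (rule exp_ge_add_one_self)
      also have "\<dots> = 2 powr (\<alpha> / 2 * l)" by (simp add: powr_def mult_ac)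
      also have "\<dots> \<le> 2 powr (\<alpha> / 2 * l + \<alpha>)" using pos by simp
      finally show "1 + l * (\<alpha> / 2 * ln 2) \<le> 2 powr (\<alpha> / 2 * l + \<alpha>)" .
      show "0 \<le> K" unfolding K_def using pos by simp
    qed
    also have "\<dots> = (e l)\<^sup>2 / (2 * (2 * A * h l powr \<alpha>))"
      unfolding hl th[symmetric] e_def K_def \<theta>_def[symmetric] power_mult_distrib by simp
    finally show ?thesis .
  qed
  have bad_prob: "prob (bad j l i) \<le> 2 * exp (- K) * (1 / 4) ^ l"
    if j: "j \<in> {1..n}" and i: "i < m * 2 ^ Suc l" for j l i
  proof -
    have t0: "0 \<le> a + real i * h l" "0 \<le> a + real (Suc i) * h l" using a h0[of l] by auto
    have "centered_gaussian M (\<lambda>w. Z j (a + real (Suc i) * h l) w - Z j (a + real i * h l) w)"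
      using j t0 Z_span by (intro gauss_setD[OF gauss] lin_span_diff) auto
    moreover have "(\<integral>w. (Z j (a + real (Suc i) * h l) w - Z j (a + real i * h l) w)\<^sup>2 \<partial>M) \<le> 2 * A * h l powr \<alpha>"
    proof -
      have "(1::real) \<le> 2 ^ Suc l" by (rule one_le_power) simp
      then have "h l \<le> b / m / 1" unfolding h_def using pos by (intro divide_left_mono) auto
      also have "\<dots> \<le> b" using pos by (simp add: divide_le_eq)
      finally have "1 - \<rho> (h l) \<le> A * h l powr \<alpha>" using h0[of l] by (intro incr) auto
      moreover have "(a + real (Suc i) * h l) - (a + real i * h l) = h l" by (simp add: algebra_simps)
      ultimately show ?thesis
        using increment_second_moment[OF j t0(1), of "a + real (Suc i) * h l"] h0[of l]
        by (simp add: algebra_simps)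
    qed
    ultimately have "prob (bad j l i) \<le> 2 * exp (- (e l)\<^sup>2 / (2 * (2 * A * h l powr \<alpha>)))"
      unfolding bad_def using pos h0[of l] e0[of l]
      by (intro centered_gaussian_abs_tail prob_space_axioms) auto
    also have "\<dots> \<le> 2 * exp (- (K * (1 + l * (\<alpha> / 2 * ln 2))))"
      using Kl[of l] by simp
    also have "\<dots> \<le> 2 * exp (- K + - (2 * real l * ln 2))"
    proof -
      have "2 * (l * ln 2) \<le> K * \<alpha> / 2 * (l * ln (2::real))"
        using K by (intro mult_right_mono) auto
      then show ?thesis by (simp add: algebra_simps)
    qed
    also have "\<dots> = 2 * exp (- K) * (1 / 4) ^ l"
    proof -
      have "exp (- (2 * real l * ln 2)) = (exp (- (2 * ln 2))) ^ l"
        by (simp add: exp_of_nat_mult[symmetric] mult_ac)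
      also have "exp (- (2 * ln 2)) = (1 / 4 :: real)"
        by (simp add: exp_minus exp_double)
      finally have "exp (- (2 * real l * ln 2)) = (1 / 4) ^ l" .
      then show ?thesis unfolding exp_add by (simp only: mult.assoc)
    qed
    finally show ?thesis .
  qed
  define BL where "BL l = (\<Union>j\<in>{1..n}. \<Union>i\<in>{..<m * 2 ^ Suc l}. bad j l i)" for l
  have BL_sets: "BL l \<in> sets M" for l unfolding BL_def using bad_sets by (intro sets.finite_UN) auto
  have BL_prob: "prob (BL l) \<le> 4 * n * m * exp (- K) * (1 / 2) ^ l" for l
  proof -
    have "prob (BL l) \<le> (\<Sum>j\<in>{1..n}. prob (\<Union>i\<in>{..<m * 2 ^ Suc l}. bad j l i))"
      unfolding BL_def using bad_sets by (intro measure_UNION_le) auto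
    also have "\<dots> \<le> (\<Sum>j\<in>{1..n}. \<Sum>i\<in>{..<m * 2 ^ Suc l}. prob (bad j l i))"
      using bad_sets by (intro sum_mono measure_UNION_le) auto
    also have "\<dots> \<le> (\<Sum>j\<in>{1..n}. \<Sum>i\<in>{..<m * 2 ^ Suc l}. 2 * exp (- K) * (1 / 4) ^ l)"
      by (intro sum_mono bad_prob) auto
    also have "\<dots> = 4 * n * m * exp (- K) * (2 ^ l * (1 / 4) ^ l)" by simp
    also have "2 ^ l * (1 / 4) ^ l = (1 / 2 :: real) ^ l" by (simp flip: power_mult_distrib)
    finally show ?thesis .
  qed
  define Bad where "Bad = (\<Union>l. BL l)"
  have gs: "(\<lambda>l. 4 * n * m * exp (- K) * (1 / 2) ^ l) sums (4 * n * m * exp (- K) * 2)"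
    using sums_mult[OF geometric_sums[of "1 / 2 :: real"], of "4 * n * m * exp (- K)"] by (simp add: mult.assoc)
  have sm: "summable (\<lambda>l. prob (BL l))"
    using sums_summable[OF gs] by (rule summable_comparison_test'[where N=0]) (use BL_prob in auto)
  have "prob Bad \<le> (\<Sum>l. prob (BL l))"
    unfolding Bad_def using BL_sets sm by (intro finite_measure_subadditive_countably) auto
  also have "\<dots> \<le> 4 * n * m * exp (- K) * 2"
    using suminf_le[OF BL_prob sm sums_summable[OF gs]] sums_unique[OF gs] by simp
  finally have "prob Bad \<le> 8 * n * m * exp (- K)" by simp
  moreover have "\<forall>w\<in>space M - Bad. \<forall>t\<in>{0..b}. \<exists>i\<le>m. \<forall>j\<in>{1..n}. \<bar>Z j (a + t) w - Z j (a + i * (b / m)) w\<bar> \<le> \<eta>"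
  proof (intro ballI)
    fix w t assume w: "w \<in> space M - Bad" and t: "t \<in> {0..b}"
    have sum_e: "(\<Sum>l<N. e l) \<le> \<eta>" for N
    proof -
      have "(\<Sum>l<N. e l) = \<eta> * ((1 - \<theta>) * (\<Sum>l<N. \<theta> ^ l))"
        by (simp add: e_def sum_distrib_left mult.assoc)
      also have "(1 - \<theta>) * (\<Sum>l<N. \<theta> ^ l) = 1 - \<theta> ^ N" using sum_gp_basic[of \<theta>] \<theta>
        by (simp add: one_diff_power_eq)
      also have "\<eta> * (1 - \<theta> ^ N) \<le> \<eta> * 1" using pos \<theta> by (intro mult_left_mono) auto
      finally show ?thesis by simp
    qed
    have path: "nat \<lfloor>t / (b / m)\<rfloor> \<le> m \<and>
        \<bar>Z j (a + t) w - Z j (a + real (nat \<lfloor>t / (b / m)\<rfloor>) * (b / m)) w\<bar> \<le> \<eta>" if j: "j \<in> {1..n}" for j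
    proof -
      have "continuous_on {0..b} (\<lambda>t. Z j (a + t) w)"
        by (rule continuous_on_compose2[OF cont[OF j]]) (use w a in \<open>auto intro!: continuous_intros\<close>)
      moreover have "\<bar>Z j (a + real (Suc i) * (b / m / 2 ^ Suc l)) w - Z j (a + real i * (b / m / 2 ^ Suc l)) w\<bar> \<le> e l"
        if "i < m * 2 ^ Suc l" for i l
        using w j that unfolding Bad_def BL_def bad_def h_def by fastforce
      ultimately show ?thesis
        using chaining_path[of b "\<lambda>t. Z j (a + t) w" m e \<eta> t] pos t sum_e by blast
    qed
    show "\<exists>i\<le>m. \<forall>j\<in>{1..n}. \<bar>Z j (a + t) w - Z j (a + i * (b / m)) w\<bar> \<le> \<eta>"
      using path k by (intro exI[of _ "nat \<lfloor>t / (b / m)\<rfloor>"]) auto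
  qed
  moreover have "Bad \<in> sets M" unfolding Bad_def using BL_sets by auto
  ultimately show ?thesis by blast
qed

end

section \<open>Pairs of blocks\<close>

context gaussian_copies
begin

text \<open>
  The event forces \<open>\<Sum>j\<in>J. Z j s + (1 - \<kappa>) * Z j0 t\<close> to exceed \<open>(k + (1 - \<kappa>)) * v\<close>. The variance of this single
  Gaussian variable is largest when \<open>j0 \<in> J\<close> and \<open>Z j0\<close> has correlation \<open>\<kappa>\<close> between the two times. The
  weight \<open>1 - \<kappa>\<close> is a choice for which the exponent exceeds \<open>k / 2\<close>, the exponent of the exceedance of \<open>k\<close>
  independent variables at one time.
\<close>

lemma joint_exceedance_tail:
  fixes \<kappa> s t v :: real
  assumes J: "J \<subseteq> {1..n}" "card J = k" and j0: "j0 \<in> {1..n}" and st: "0 \<le> s" "s \<le> t"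
    and \<kappa>: "\<rho> (t - s) \<le> \<kappa>" "0 \<le> \<kappa>" "\<kappa> < 1" and v: "v \<ge> 0"
  shows "prob {w\<in>space M. (\<forall>j\<in>J. Z j s w > v) \<and> Z j0 t w > v}
    \<le> exp (- ((k + (1 - \<kappa>))\<^sup>2 / (2 * (k + (1 - \<kappa>)\<^sup>2 + 2 * (1 - \<kappa>) * \<kappa>)) * v\<^sup>2))"
proof -
  define \<theta> where "\<theta> = 1 - \<kappa>"
  define V where "V = k + \<theta>\<^sup>2 + 2 * \<theta> * \<kappa>"
  have \<theta>: "\<theta> > 0" and "V > 0" using \<kappa> k by (auto simp: \<theta>_def V_def add_pos_nonneg)
  have finJ: "finite J" "J \<noteq> {}" using J k by (auto intro: finite_subset)
  define A where "A w = (\<Sum>j\<in>J. 1 * Z j s w)" for w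
  define Y where "Y w = A w + \<theta> * Z j0 t w" for w
  have As: "A \<in> lin_span S" unfolding A_def[abs_def] using J st Z_span by (intro lin_span_sum) auto
  have Zt: "Z j0 t \<in> lin_span S" using j0 st by (intro Z_span) auto
  have Ys: "Y \<in> lin_span S" unfolding Y_def[abs_def] by (rule lin_span_add_cmult[OF Zt As])
  have Zs: "Z j s \<in> lin_span S" if "j \<in> J" for j using that J st by (intro Z_span) auto
  have AZ: "(\<integral>w. A w * Z i r w \<partial>M) = (\<Sum>j\<in>J. \<integral>w. Z j s w * Z i r w \<partial>M)" if "i \<in> {1..n}" "0 \<le> r" for i r
    unfolding A_def using integral_sum_mult[where X="\<lambda>j. Z j s" and c="\<lambda>_. 1", OF gauss Zs Z_span[OF that]] by simp
  have AZt: "(\<integral>w. A w * Z j0 t w \<partial>M) \<le> \<kappa>"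
  proof -
    have "(\<integral>w. A w * Z j0 t w \<partial>M) = (\<Sum>j\<in>J. if j = j0 then \<rho> (t - s) else 0)"
      unfolding AZ[OF j0 order_trans[OF st]] using J st j0 by (intro sum.cong) (auto simp: cov)
    then show ?thesis using finJ \<kappa> by (auto simp: sum.delta)
  qed
  have AA: "(\<integral>w. A w * A w \<partial>M) = k"
  proof -
    have "(\<integral>w. A w * A w \<partial>M) = (\<Sum>j\<in>J. 1 * (\<integral>w. Z j s w * A w \<partial>M))"
      by (subst (1) A_def, rule integral_sum_mult[OF gauss _ As]) (use J st Z_span in auto)
    also have "\<dots> = (\<Sum>j\<in>J. \<Sum>i\<in>J. if i = j then 1 else 0)"
    proof (intro sum.cong refl)
      fix j assume j: "j \<in> J"
      then have "(\<integral>w. Z j s w * A w \<partial>M) = (\<Sum>i\<in>J. \<integral>w. Z i s w * Z j s w \<partial>M)"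
        using AZ[of j s] J st by (auto simp: mult.commute)
      also have "\<dots> = (\<Sum>i\<in>J. if i = j then 1 else 0)"
      proof (rule sum.cong[OF refl])
        fix i assume "i \<in> J"
        with J st j have "i \<in> {1..n}" "j \<in> {1..n}" "0 \<le> s" by auto
        from cov[OF this this(3)] show "(\<integral>w. Z i s w * Z j s w \<partial>M) = (if i = j then 1 else 0)"
          by (simp add: rho_0)
      qed
      finally show "1 * (\<integral>w. Z j s w * A w \<partial>M) = (\<Sum>i\<in>J. if i = j then 1 else 0)" by simp
    qed
    finally show ?thesis using finJ J by (simp add: sum.delta)
  qed
  have ZZ: "(\<integral>w. Z j0 t w * Z j0 t w \<partial>M) = 1" using j0 st by (simp add: cov rho_0)
  have "(\<integral>w. (Y w)\<^sup>2 \<partial>M) = (\<integral>w. A w * Y w \<partial>M) + \<theta> * (\<integral>w. Z j0 t w * Y w \<partial>M)"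
    using integral_lin_comb_mult[OF gauss As Zt Ys, of \<theta>] by (simp add: Y_def power2_eq_square)
  also have "(\<integral>w. A w * Y w \<partial>M) = k + \<theta> * (\<integral>w. A w * Z j0 t w \<partial>M)"
    using integral_lin_comb_mult[OF gauss As Zt As, of \<theta>] AA by (simp add: Y_def mult.commute)
  also have "(\<integral>w. Z j0 t w * Y w \<partial>M) = (\<integral>w. A w * Z j0 t w \<partial>M) + \<theta>"
    using integral_lin_comb_mult[OF gauss As Zt Zt, of \<theta>] ZZ by (simp add: Y_def mult.commute)
  finally have "(\<integral>w. (Y w)\<^sup>2 \<partial>M) = k + \<theta>\<^sup>2 + 2 * \<theta> * (\<integral>w. A w * Z j0 t w \<partial>M)"
    by (simp add: algebra_simps power2_eq_square)
  also have "\<dots> \<le> V" unfolding V_def using AZt \<theta> by simp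
  finally have YV: "(\<integral>w. (Y w)\<^sup>2 \<partial>M) \<le> V" .
  have Ym: "Y \<in> borel_measurable M" by (rule centered_gaussian_measurable[OF gauss_setD[OF gauss Ys]])
  have "prob {w\<in>space M. (\<forall>j\<in>J. Z j s w > v) \<and> Z j0 t w > v} \<le> prob {w\<in>space M. Y w > (k + \<theta>) * v}"
  proof (rule finite_measure_mono)
    show "{w\<in>space M. Y w > (k + \<theta>) * v} \<in> sets M" using Ym by simp
    show "{w\<in>space M. (\<forall>j\<in>J. Z j s w > v) \<and> Z j0 t w > v} \<subseteq> {w\<in>space M. Y w > (k + \<theta>) * v}"
    proof
      fix w assume w: "w \<in> {w\<in>space M. (\<forall>j\<in>J. Z j s w > v) \<and> Z j0 t w > v}"
      then have "(\<Sum>j\<in>J. v) < (\<Sum>j\<in>J. Z j s w)" using finJ by (intro sum_strict_mono) auto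
      moreover have "\<theta> * v < \<theta> * Z j0 t w" using w \<theta> by simp
      ultimately show "w \<in> {w\<in>space M. Y w > (k + \<theta>) * v}"
        using w J by (simp add: Y_def A_def distrib_right)
    qed
  qed
  also have "\<dots> \<le> exp (- ((k + \<theta>) * v)\<^sup>2 / (2 * V))"
    using \<theta> v \<open>V > 0\<close> by (intro centered_gaussian_tail prob_space_axioms gauss_setD[OF gauss Ys] YV) auto
  also have "- ((k + \<theta>) * v)\<^sup>2 / (2 * V) = - ((k + \<theta>)\<^sup>2 / (2 * V) * v\<^sup>2)"
    by (simp add: power_mult_distrib)
  finally show ?thesis unfolding V_def \<theta>_def .
qed

lemma joint_exponent_gt:
  fixes \<kappa> :: real
  assumes "0 \<le> \<kappa>" "\<kappa> < 1"
  shows "(k + (1 - \<kappa>))\<^sup>2 / (2 * (k + (1 - \<kappa>)\<^sup>2 + 2 * (1 - \<kappa>) * \<kappa>)) > k / 2"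
proof -
  define \<theta> where "\<theta> = 1 - \<kappa>"
  have \<theta>: "\<theta> > 0" and V: "k + \<theta>\<^sup>2 + 2 * \<theta> * \<kappa> > 0" using assms k by (auto simp: \<theta>_def add_pos_nonneg)
  have "(k + \<theta>)\<^sup>2 - k * (k + \<theta>\<^sup>2 + 2 * \<theta> * \<kappa>) = (k + 1) * \<theta>\<^sup>2"
    by (simp add: \<theta>_def power2_eq_square algebra_simps)
  also have "\<dots> > 0" using \<theta> by simp
  finally have "k * (k + \<theta>\<^sup>2 + 2 * \<theta> * \<kappa>) < (k + \<theta>)\<^sup>2" by simp
  then have "k / 2 < (k + \<theta>)\<^sup>2 / (2 * (k + \<theta>\<^sup>2 + 2 * \<theta> * \<kappa>))"
    using V by (simp add: field_simps)
  then show ?thesis by (simp add: \<theta>_def)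
qed

text \<open>
  Outside the chaining errors, exceedances in both blocks are visible on the grids at the level \<open>u - \<eta>\<close>. It
  remains to sum over the pairs of grid points, over the set of \<open>k\<close> copies that are large in the first block, and
  over one copy that is large in the second.
\<close>

lemma near_blocks:
  fixes A \<alpha> b \<eta> K \<kappa> :: real and m :: nat
  assumes pos: "A > 0" "\<alpha> > 0" "b > 0" "\<eta> > 0" "m > 0" and a: "a \<ge> 0" "a' \<ge> a + 2 * b"
    and incr: "\<And>t. 0 \<le> t \<Longrightarrow> t \<le> b \<Longrightarrow> 1 - \<rho> t \<le> A * t powr \<alpha>"
    and sep: "\<And>t. b \<le> t \<Longrightarrow> \<rho> t \<le> \<kappa>" "0 \<le> \<kappa>" "\<kappa> < 1"
  defines "K \<equiv> \<eta>\<^sup>2 * (1 - 2 powr (- \<alpha> / 4))\<^sup>2 / (4 * A * (b / m) powr \<alpha>)"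
  assumes K: "K * \<alpha> \<ge> 4" and u: "u \<ge> \<eta>"
  shows "prob (hit a (a + b) u \<inter> hit a' (a' + b) u)
    \<le> (m + 1)\<^sup>2 * 2 ^ n * n * exp (- ((k + (1 - \<kappa>))\<^sup>2 / (2 * (k + (1 - \<kappa>)\<^sup>2 + 2 * (1 - \<kappa>) * \<kappa>)) * (u - \<eta>)\<^sup>2))
      + 2 * (8 * n * m * exp (- K))"
proof -
  define E where "E = exp (- ((k + (1 - \<kappa>))\<^sup>2 / (2 * (k + (1 - \<kappa>)\<^sup>2 + 2 * (1 - \<kappa>) * \<kappa>)) * (u - \<eta>)\<^sup>2))"
  have a'0: "a' \<ge> 0" using a pos by linarith
  obtain B1 where B1: "B1 \<in> sets M" "prob B1 \<le> 8 * n * m * exp (- K)"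
    "\<And>w t. w \<in> space M - B1 \<Longrightarrow> t \<in> {0..b} \<Longrightarrow> \<exists>i\<le>m. \<forall>j\<in>{1..n}. \<bar>Z j (a + t) w - Z j (a + i * (b / m)) w\<bar> \<le> \<eta>"
    using chaining_exceptional_set[OF pos a(1) incr K[unfolded K_def]] unfolding K_def by blast
  obtain B2 where B2: "B2 \<in> sets M" "prob B2 \<le> 8 * n * m * exp (- K)"
    "\<And>w t. w \<in> space M - B2 \<Longrightarrow> t \<in> {0..b} \<Longrightarrow> \<exists>i\<le>m. \<forall>j\<in>{1..n}. \<bar>Z j (a' + t) w - Z j (a' + i * (b / m)) w\<bar> \<le> \<eta>"
    using chaining_exceptional_set[OF pos a'0 incr K[unfolded K_def]] unfolding K_def by blast
  define I where "I = ({..m} \<times> {..m}) \<times> {J. J \<subseteq> {1..n} \<and> card J = k} \<times> {1..n}"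
  define C where "C x = (case x of ((i, i'), J, j0) \<Rightarrow>
     {w\<in>space M. (\<forall>j\<in>J. Z j (a + real i * (b / m)) w > u - \<eta>) \<and> Z j0 (a' + real i' * (b / m)) w > u - \<eta>})" for x
  have finI: "finite I" unfolding I_def by auto
  have grid: "0 \<le> real i * (b / m)" "real i * (b / m) \<le> b" if "i \<le> m" for i
  proof -
    have "real i * (b / m) \<le> real m * (b / m)" using that pos by (intro mult_right_mono) auto
    then show "real i * (b / m) \<le> b" using pos by simp
  qed (use pos in simp)
  have Cs: "C x \<in> sets M" if "x \<in> I" for x
  proof -
    obtain i i' J j0 where x: "x = ((i, i'), J, j0)" by (metis prod.exhaust)
    have finJ: "finite J" and J: "J \<subseteq> {1..n}" and "i \<le> m" "i' \<le> m" "j0 \<in> {1..n}"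
      using that x by (auto simp: I_def intro: finite_subset)
    moreover have "{w\<in>space M. Z j (a + real i * (b / m)) w > u - \<eta>} \<in> sets M" if "j \<in> J" for j
      using that J a grid(1)[OF \<open>i \<le> m\<close>] Z_measurable[of j "a + real i * (b / m)"] by (auto intro: borel_measurable_less)
    moreover have "{w\<in>space M. Z j0 (a' + real i' * (b / m)) w > u - \<eta>} \<in> sets M"
      using a'0 grid(1)[OF \<open>i' \<le> m\<close>] Z_measurable[of j0 "a' + real i' * (b / m)"] \<open>j0 \<in> _\<close> by (auto intro: borel_measurable_less)
    ultimately show ?thesis
      unfolding C_def x by (auto intro!: sets.sets_Collect_conj sets.sets_Collect_finite_All)
  qed
  have Cp: "prob (C x) \<le> E" if "x \<in> I" for x
  proof -
    obtain i i' J j0 where x: "x = ((i, i'), J, j0)" by (metis prod.exhaust)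
    have J: "J \<subseteq> {1..n}" "card J = k" and i: "i \<le> m" "i' \<le> m" and j0: "j0 \<in> {1..n}"
      using that x by (auto simp: I_def)
    show ?thesis
      unfolding C_def x prod.case E_def
      by (rule joint_exceedance_tail[OF J j0 _ _ sep(1) sep(2,3)])
         (use a a'0 u pos grid(1)[OF i(1)] grid(2)[OF i(1)] grid(1)[OF i(2)] in linarith)+
  qed
  have "hit a (a + b) u \<inter> hit a' (a' + b) u \<subseteq> (\<Union>x\<in>I. C x) \<union> (B1 \<union> B2)"
  proof
    fix w assume w: "w \<in> hit a (a + b) u \<inter> hit a' (a' + b) u"
    show "w \<in> (\<Union>x\<in>I. C x) \<union> (B1 \<union> B2)"
    proof (cases "w \<in> B1 \<union> B2")
      case False
      from w obtain t t' where ws: "w \<in> space M" and t: "t \<in> {a..a+b}" "t' \<in> {a'..a'+b}"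
        "rank_exceeds n k (\<lambda>j. Z j t w) u" "rank_exceeds n k (\<lambda>j. Z j t' w) u"
        unfolding hit_def by auto
      obtain i where i: "i \<le> m" "\<And>j. j \<in> {1..n} \<Longrightarrow> \<bar>Z j t w - Z j (a + i * (b / m)) w\<bar> \<le> \<eta>"
        using B1(3)[of w "t - a"] ws False t by auto
      obtain i' where i': "i' \<le> m" "\<And>j. j \<in> {1..n} \<Longrightarrow> \<bar>Z j t' w - Z j (a' + i' * (b / m)) w\<bar> \<le> \<eta>"
        using B2(3)[of w "t' - a'"] ws False t by auto
      have r: "rank_exceeds n k (\<lambda>j. Z j (a + i * (b / m)) w) (u - \<eta>)" "rank_exceeds n k (\<lambda>j. Z j (a' + i' * (b / m)) w) (u - \<eta>)"
        using rank_exceeds_perturb[OF t(3) i(2)] rank_exceeds_perturb[OF t(4) i'(2)] by auto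
      obtain J where J: "J \<subseteq> {1..n}" "card J = k" "\<forall>j\<in>J. Z j (a + i * (b / m)) w > u - \<eta>"
        using r(1) unfolding rank_exceeds_iff_subset by auto
      obtain J' where J': "J' \<subseteq> {1..n}" "card J' = k" "\<forall>j\<in>J'. Z j (a' + i' * (b / m)) w > u - \<eta>"
        using r(2) unfolding rank_exceeds_iff_subset by auto
      from J' k obtain j0 where j0: "j0 \<in> J'" by fastforce
      have "((i, i'), J, j0) \<in> I" using i i' J J' j0 by (auto simp: I_def)
      moreover have "w \<in> C ((i, i'), J, j0)" using ws J J' j0 by (auto simp: C_def)
      ultimately show ?thesis by blast
    qed simp
  qed
  moreover have CU: "(\<Union>x\<in>I. C x) \<in> sets M" using finI Cs by (intro sets.finite_UN)
  ultimately have "prob (hit a (a + b) u \<inter> hit a' (a' + b) u) \<le> prob ((\<Union>x\<in>I. C x) \<union> (B1 \<union> B2))"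
    using B1(1) B2(1) by (intro finite_measure_mono sets.Un)
  also have "\<dots> \<le> prob (\<Union>x\<in>I. C x) + (prob B1 + prob B2)"
    using CU B1(1) B2(1) by (intro order_trans[OF measure_Un_le] add_mono order_refl measure_Un_le sets.Un)
  also have "prob (\<Union>x\<in>I. C x) \<le> (\<Sum>x\<in>I. prob (C x))"
    using finI Cs by (intro measure_UNION_le) auto
  also have "\<dots> \<le> (\<Sum>x\<in>I. E)" by (intro sum_mono Cp)
  also have "\<dots> = card I * E" by simp
  also have "real (card I) \<le> (m + 1)\<^sup>2 * 2 ^ n * n"
  proof -
    have "card {J. J \<subseteq> {1..n} \<and> card J = k} \<le> card (Pow {1..n})" by (intro card_mono) auto
    also have "\<dots> = 2 ^ n" by (simp add: card_Pow)
    finally have "(m + 1)\<^sup>2 * (card {J. J \<subseteq> {1..n} \<and> card J = k} * n) \<le> (m + 1)\<^sup>2 * (2 ^ n * n)"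
      by (intro mult_le_mono order_refl)
    moreover have "card I = (m + 1)\<^sup>2 * (card {J. J \<subseteq> {1..n} \<and> card J = k} * n)"
      unfolding I_def by (simp add: card_cartesian_product power2_eq_square)
    ultimately have "card I \<le> (m + 1)\<^sup>2 * (2 ^ n * n)" by simp
    then have "real (card I) \<le> real ((m + 1)\<^sup>2 * (2 ^ n * n))" by (rule of_nat_mono)
    then show ?thesis by (simp add: mult.assoc)
  qed
  finally have "prob (hit a (a + b) u \<inter> hit a' (a' + b) u) \<le> (m + 1)\<^sup>2 * 2 ^ n * n * E + (prob B1 + prob B2)"
    by (simp add: mult_right_mono E_def)
  then show ?thesis using B1(2) B2(2) unfolding E_def by linarith
qed

text \<open>
  Far apart blocks. The first block is read on a grid, with independent noise of size \<open>\<sigma>\<close> added; regressing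
  the second block on these noisy values uses tiny coefficients, so the residual, which is independent of
  the noisy values, differs from the second block by at most \<open>\<eta>\<close>
  outside an event of tiny probability.
\<close>

lemma far_blocks:
  fixes A \<alpha> b \<eta> K \<sigma> \<delta> y u u' :: real and m :: nat
  assumes pos: "A > 0" "\<alpha> > 0" "b > 0" "\<eta> > 0" "m > 0" and a: "a \<ge> 0" "a' \<ge> 0"
    and incr: "\<And>t. 0 \<le> t \<Longrightarrow> t \<le> b \<Longrightarrow> 1 - \<rho> t \<le> A * t powr \<alpha>"
    and \<delta>: "\<And>s t. s \<in> {a..a+b} \<Longrightarrow> t \<in> {a'..a'+b} \<Longrightarrow> \<bar>\<rho> \<bar>t - s\<bar>\<bar> \<le> \<delta>" "\<delta> \<ge> 0"
  defines "K \<equiv> \<eta>\<^sup>2 * (1 - 2 powr (- \<alpha> / 4))\<^sup>2 / (4 * A * (b / m) powr \<alpha>)"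
  assumes K: "K * \<alpha> \<ge> 4"
    and \<sigma>: "\<sigma> > 0" "y > 0" "\<sigma> * y \<le> \<eta>"
    and small: "n * (m + 1) * \<delta> / \<sigma>\<^sup>2 * (y + \<eta>) \<le> \<eta>"
  shows "prob (hit a (a + b) u \<inter> hit a' (a' + b) u')
    \<le> prob (hit 0 b (u - 3 * \<eta>)) * prob (hit 0 b (u' - 2 * \<eta>))
      + 4 * (8 * n * m * exp (- K) + 4 * (n * (m + 1)) * exp (- y\<^sup>2 / 2))"
proof -
  define \<beta> where "\<beta> = 8 * n * m * exp (- K) + 4 * (n * (m + 1)) * exp (- y\<^sup>2 / 2)"
  obtain B where B: "B \<in> sets M" "prob B \<le> 8 * n * m * exp (- K)"
    "\<And>w t. w \<in> space M - B \<Longrightarrow> t \<in> {0..b} \<Longrightarrow> \<exists>i\<le>m. \<forall>j\<in>{1..n}. \<bar>Z j (a + t) w - Z j (a + i * (b / m)) w\<bar> \<le> \<eta>"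
    using chaining_exceptional_set[OF pos a(1) incr K[unfolded K_def]] unfolding K_def by blast
  define s where "s i = a + real i * (b / m)" for i :: nat
  have s: "0 \<le> s i" "s i \<in> {a..a+b}" if "i \<le> m" for i
  proof -
    have "real i * (b / m) \<le> real m * (b / m)" using that pos by (intro mult_right_mono) auto
    then show "s i \<in> {a..a+b}" "0 \<le> s i" using pos a by (auto simp: s_def)
  qed
  define D where "D = \<rat> \<inter> {0..b}"
  have cD: "countable D" unfolding D_def by (rule countable_Rats_Int)
  have D: "0 \<le> q" "q \<le> b" "0 \<le> a' + q" "a' + q \<in> {a'..a'+b}" if "q \<in> D" for q using that a by (auto simp: D_def)
  define F where "F = {1..n} \<times> {..m}"
  have finF: "finite F" by (simp add: F_def)
  have cardF: "card F = n * (m + 1)" by (simp add: F_def)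
  have F: "fst g \<in> {1..n}" "snd g \<le> m" if "g \<in> F" for g using that by (auto simp: F_def)
  define W where "W = PiM F (\<lambda>_. std_normal_distribution)"
  interpret W: prob_space W unfolding W_def by (intro prob_space_PiM prob_space_std_normal)
  define N where "N = M \<Otimes>\<^sub>M W"
  interpret MW: pair_prob_space M W ..
  interpret N: prob_space N unfolding N_def by (rule MW.prob_space_axioms)
  have GW: "gauss_set W ((\<lambda>g x. x g) ` F)" unfolding W_def by (rule gauss_set_white_noise[OF finF])
  define T where "T = (\<lambda>Y p. Y (fst p)) ` S \<union> (\<lambda>Y p. Y (snd p)) ` ((\<lambda>g x. x g) ` F)"
  have GN: "gauss_set N T"
    unfolding N_def T_def by (rule gauss_set_pair[OF prob_space_axioms W.prob_space_axioms gauss GW])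
  note cv = pair_integral_cov[OF prob_space_axioms W.prob_space_axioms gauss GW, folded N_def]
  have fstT: "(\<lambda>p. Y (fst p)) \<in> lin_span T" if "Y \<in> lin_span S" for Y
    unfolding T_def using that by (rule lin_span_pair)
  have Zs: "Z (fst g) (s (snd g)) \<in> lin_span S" if "g \<in> F" for g
    using F[OF that] s by (intro Z_span) auto
  have noise_span: "(\<lambda>x. x g) \<in> lin_span ((\<lambda>g x. x g) ` F)" if "g \<in> F" for g
    using that by (auto intro: lin_span_base)
  have sndT: "(\<lambda>p. snd p g) \<in> lin_span T" if "g \<in> F" for g
    using lin_span_pair(2)[OF noise_span[OF that]] unfolding T_def .
  define U where "U g p = Z (fst g) (s (snd g)) (fst p) + \<sigma> * snd p g" for g p
  have Us: "U g \<in> lin_span T" if "g \<in> F" for g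
    unfolding U_def[abs_def] using fstT[OF Zs[OF that]] sndT[OF that] by (rule lin_span_add_cmult[rotated])
  define I where "I = {1..n} \<times> D"
  define V where "V \<tau> p = Z (fst \<tau>) (a' + snd \<tau>) (fst p)" for \<tau> and p :: "'b \<times> (nat \<times> nat \<Rightarrow> real)"
  have Vs: "V \<tau> \<in> lin_span T" if "\<tau> \<in> I" for \<tau>
    unfolding V_def[abs_def] using that D by (intro fstT Z_span) (auto simp: I_def)
  have noise: "\<sigma>\<^sup>2 * (\<Sum>g\<in>F. (c g)\<^sup>2) \<le> (\<integral>p. (\<Sum>g\<in>F. c g * U g p)\<^sup>2 \<partial>N)" for c
  proof -
    define X where "X w = (\<Sum>g\<in>F. c g * Z (fst g) (s (snd g)) w)" for w
    define E where "E x = (\<Sum>g\<in>F. c g * (x g :: real))" for x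
    have Xs: "X \<in> lin_span S" unfolding X_def[abs_def] using Zs by (rule lin_span_sum)
    have Es: "E \<in> lin_span ((\<lambda>g x. x g) ` F)" unfolding E_def[abs_def] using noise_span by (rule lin_span_sum)
    have XT: "(\<lambda>p. X (fst p)) \<in> lin_span T" using Xs by (rule fstT)
    have ET: "(\<lambda>p. E (snd p)) \<in> lin_span T" using Es unfolding T_def by (rule lin_span_pair)
    have sum_eq: "(\<Sum>g\<in>F. c g * U g p) = X (fst p) + \<sigma> * E (snd p)" for p
      by (simp add: U_def X_def E_def distrib_left sum.distrib sum_distrib_left mult_ac)
    have YT: "(\<lambda>p. X (fst p) + \<sigma> * E (snd p)) \<in> lin_span T"
      using XT ET by (rule lin_span_add_cmult[rotated])
    have EE: "(\<integral>x. E x * E x \<partial>W) = (\<Sum>g\<in>F. (c g)\<^sup>2)"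
    proof -
      have "(\<integral>x. E x * E x \<partial>W) = (\<Sum>g\<in>F. \<Sum>h\<in>F. c g * c h * (\<integral>x. x g * x h \<partial>W))"
        using W.integral_sum_square[where Z="\<lambda>g x. x g" and J=F and c=c, OF GW noise_span] by (simp add: E_def power2_eq_square)
      also have "\<dots> = (\<Sum>g\<in>F. \<Sum>h\<in>F. if g = h then c g * c h else 0)"
        unfolding W_def by (intro sum.cong refl) (simp add: white_noise_cov[OF finF])
      also have "\<dots> = (\<Sum>g\<in>F. (c g)\<^sup>2)"
        using finF by (intro sum.cong refl) (simp add: power2_eq_square)
      finally show ?thesis .
    qed
    have "(\<integral>p. (\<Sum>g\<in>F. c g * U g p)\<^sup>2 \<partial>N) = (\<integral>p. X (fst p) * (X (fst p) + \<sigma> * E (snd p)) \<partial>N)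
        + \<sigma> * (\<integral>p. E (snd p) * (X (fst p) + \<sigma> * E (snd p)) \<partial>N)"
      unfolding sum_eq using N.integral_lin_comb_mult[OF GN XT ET YT, of \<sigma>] by (simp add: power2_eq_square)
    also have "(\<integral>p. X (fst p) * (X (fst p) + \<sigma> * E (snd p)) \<partial>N) = (\<integral>w. X w * X w \<partial>M)"
      using N.integral_lin_comb_mult[OF GN XT ET XT, of \<sigma>] cv(1)[OF Xs Xs] cv(4)[OF Xs Es] by (simp add: mult.commute)
    also have "(\<integral>p. E (snd p) * (X (fst p) + \<sigma> * E (snd p)) \<partial>N) = \<sigma> * (\<Sum>g\<in>F. (c g)\<^sup>2)"
      using N.integral_lin_comb_mult[OF GN XT ET ET, of \<sigma>] cv(2)[OF Es Es] cv(3)[OF Xs Es] EE by (simp add: mult.commute)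
    finally have "(\<integral>p. (\<Sum>g\<in>F. c g * U g p)\<^sup>2 \<partial>N) = (\<integral>w. X w * X w \<partial>M) + \<sigma>\<^sup>2 * (\<Sum>g\<in>F. (c g)\<^sup>2)"
      by (simp add: power2_eq_square mult.assoc)
    moreover have "0 \<le> (\<integral>w. X w * X w \<partial>M)" by simp
    ultimately show ?thesis by linarith
  qed
  have VU: "\<bar>\<integral>p. V \<tau> p * U g p \<partial>N\<bar> \<le> \<delta>" if "\<tau> \<in> I" "g \<in> F" for \<tau> g
  proof -
    have \<tau>: "fst \<tau> \<in> {1..n}" "snd \<tau> \<in> D" using that by (auto simp: I_def)
    have Zt: "Z (fst \<tau>) (a' + snd \<tau>) \<in> lin_span S" using \<tau> D by (intro Z_span) auto
    have "(\<integral>p. V \<tau> p * U g p \<partial>N) = (\<integral>p. U g p * V \<tau> p \<partial>N)" by (simp add: mult.commute)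
    also have "\<dots> = (\<integral>p. Z (fst g) (s (snd g)) (fst p) * V \<tau> p \<partial>N) + \<sigma> * (\<integral>p. snd p g * V \<tau> p \<partial>N)"
      unfolding U_def by (rule N.integral_lin_comb_mult[OF GN fstT[OF Zs[OF that(2)]] sndT[OF that(2)] Vs[OF that(1)]])
    also have "\<dots> = (\<integral>w. Z (fst g) (s (snd g)) w * Z (fst \<tau>) (a' + snd \<tau>) w \<partial>M)"
      using cv(1)[OF Zs[OF that(2)] Zt] cv(4)[OF Zt noise_span[OF that(2)]] by (simp add: V_def)
    also have "\<bar>\<dots>\<bar> \<le> \<delta>"
      using F[OF that(2)] \<tau> s[OF F(2)[OF that(2)]] D[OF \<tau>(2)] \<delta> by (auto simp: cov)
    finally show ?thesis .
  qed
  have "\<exists>c. \<forall>\<tau>\<in>I. (\<forall>g\<in>F. (\<integral>p. (V \<tau> p - (\<Sum>h\<in>F. c \<tau> h * U h p)) * U g p \<partial>N) = 0) \<and>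
     (\<Sum>g\<in>F. \<bar>c \<tau> g\<bar>) \<le> card F * \<delta> / \<sigma>\<^sup>2"
    using N.ridge_regression[where U=U, OF GN finF Us Vs \<sigma>(1) \<delta>(2) noise VU] by (intro bchoice) blast
  then obtain c where c: "\<And>\<tau> g. \<tau> \<in> I \<Longrightarrow> g \<in> F \<Longrightarrow> (\<integral>p. (V \<tau> p - (\<Sum>h\<in>F. c \<tau> h * U h p)) * U g p \<partial>N) = 0"
    "\<And>\<tau>. \<tau> \<in> I \<Longrightarrow> (\<Sum>g\<in>F. \<bar>c \<tau> g\<bar>) \<le> card F * \<delta> / \<sigma>\<^sup>2" by blast
  define R where "R \<tau> p = V \<tau> p - (\<Sum>h\<in>F. c \<tau> h * U h p)" for \<tau> p
  have Rs: "R \<tau> \<in> lin_span T" if "\<tau> \<in> I" for \<tau>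
    unfolding R_def[abs_def] using Vs[OF that] Us by (intro lin_span_diff lin_span_sum)
  define QU where "QU x \<longleftrightarrow> (\<exists>i\<in>{..m}. rank_exceeds n k (\<lambda>j. x (j, i)) (u - 2 * \<eta>))" for x :: "nat \<times> nat \<Rightarrow> real"
  define QR where "QR x \<longleftrightarrow> (\<exists>q\<in>D. rank_exceeds n k (\<lambda>j. x (j, q)) (u' - \<eta>))" for x :: "nat \<times> real \<Rightarrow> real"
  have restrU: "QU (\<lambda>g\<in>F. f g) \<longleftrightarrow> QU f" for f
    unfolding QU_def by (intro bex_cong refl rank_exceeds_cong) (auto simp: F_def)
  have restrR: "QR (\<lambda>g\<in>I. f g) \<longleftrightarrow> QR f" for f
    unfolding QR_def by (intro bex_cong refl rank_exceeds_cong) (auto simp: I_def)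
  have Um: "U g \<in> borel_measurable N" if "g \<in> F" for g
    by (rule centered_gaussian_measurable[OF gauss_setD[OF GN Us[OF that]]])
  have Rm: "R g \<in> borel_measurable N" if "g \<in> I" for g
    by (rule centered_gaussian_measurable[OF gauss_setD[OF GN Rs[OF that]]])
  define EU where "EU = {p\<in>space N. QU (\<lambda>g. U g p)}"
  define ER where "ER = {p\<in>space N. QR (\<lambda>\<tau>. R \<tau> p)}"
  have EUs: "EU \<in> sets N"
    unfolding EU_def QU_def by (intro countable_rank_exceeds_measurable Um) (auto simp: F_def)
  have ERs: "ER \<in> sets N"
    unfolding ER_def QR_def by (intro countable_rank_exceeds_measurable cD Rm) (auto simp: I_def)
  have indep: "measure N (EU \<inter> ER) = measure N EU * measure N ER"
  proof -
    have "measure N {p\<in>space N. QU (\<lambda>g\<in>F. U g p) \<and> QR (\<lambda>\<tau>\<in>I. R \<tau> p)}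
       = measure N {p\<in>space N. QU (\<lambda>g\<in>F. U g p)} * measure N {p\<in>space N. QR (\<lambda>\<tau>\<in>I. R \<tau> p)}"
    proof (rule N.gauss_uncorrelated_indep[OF GN Us Rs])
      show "{x\<in>space (PiM F (\<lambda>_. borel)). QU x} \<in> sets (PiM F (\<lambda>_. borel))"
        unfolding QU_def by (intro countable_rank_exceeds_measurable measurable_component_singleton) (auto simp: F_def)
      show "{x\<in>space (PiM I (\<lambda>_. borel)). QR x} \<in> sets (PiM I (\<lambda>_. borel))"
        unfolding QR_def by (intro countable_rank_exceeds_measurable cD measurable_component_singleton) (auto simp: I_def)
    qed (auto simp: R_def c)
    moreover have "EU \<inter> ER = {p\<in>space N. QU (\<lambda>g. U g p) \<and> QR (\<lambda>\<tau>. R \<tau> p)}"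
      by (auto simp: EU_def ER_def)
    ultimately show ?thesis unfolding restrU restrR by (simp add: EU_def ER_def)
  qed
  have fst_meas: "fst \<in> N \<rightarrow>\<^sub>M M" unfolding N_def by simp
  have lift_sets: "{p\<in>space N. fst p \<in> E} \<in> sets N" if "E \<in> sets M" for E
    using measurable_sets[OF fst_meas that] by (simp add: vimage_def Int_def conj_commute)
  have lift: "measure N {p\<in>space N. fst p \<in> E} = prob E" if E: "E \<in> sets M" for E
  proof -
    have "{p\<in>space N. fst p \<in> E} = E \<times> space W"
      using sets.sets_into_space[OF E] by (auto simp: N_def space_pair_measure)
    moreover have "emeasure N (E \<times> space W) = emeasure M E * emeasure W (space W)"
      unfolding N_def using E by (intro W.emeasure_pair_measure_Times) auto
    ultimately show ?thesis
      by (simp add: N.emeasure_eq_measure emeasure_eq_measure W.emeasure_eq_measure W.prob_space)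
  qed
  \<comment> \<open>Outside \<open>Bad\<close> the grid values are at most \<open>y\<close>, and the noise terms at most \<open>\<sigma> * y \<le> \<eta>\<close>, so the noisy
     values at most \<open>y + \<eta>\<close>.\<close>
  define LZ where "LZ g = {p\<in>space N. \<bar>Z (fst g) (s (snd g)) (fst p)\<bar> > y}" for g
  define LW where "LW g = {p\<in>space N. \<bar>snd p g\<bar> > y}" for g
  define Bad where "Bad = {p\<in>space N. fst p \<in> B} \<union> ((\<Union>g\<in>F. LZ g) \<union> (\<Union>g\<in>F. LW g))"
  have cgZ: "centered_gaussian N (\<lambda>p. Z (fst g) (s (snd g)) (fst p))" "(\<integral>p. (Z (fst g) (s (snd g)) (fst p))\<^sup>2 \<partial>N) \<le> 1"
    if "g \<in> F" for g
    using gauss_setD[OF GN fstT[OF Zs[OF that]]] cv(1)[OF Zs[OF that] Zs[OF that]] F[OF that] s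
    by (auto simp: power2_eq_square cov rho_0)
  have cgW: "centered_gaussian N (\<lambda>p. snd p g)" "(\<integral>p. (snd p g)\<^sup>2 \<partial>N) \<le> 1" if "g \<in> F" for g
    using gauss_setD[OF GN sndT[OF that]] cv(2)[OF noise_span[OF that] noise_span[OF that]] that
    by (auto simp: power2_eq_square W_def white_noise_cov[OF finF])
  have LZs: "LZ g \<in> sets N" "measure N (LZ g) \<le> 2 * exp (- y\<^sup>2 / 2)" if "g \<in> F" for g
    using centered_gaussian_measurable[OF cgZ(1)[OF that]]
      centered_gaussian_abs_tail[OF N.prob_space_axioms cgZ[OF that], of y] \<sigma> unfolding LZ_def
    by (auto intro: borel_measurable_less)
  have LWs: "LW g \<in> sets N" "measure N (LW g) \<le> 2 * exp (- y\<^sup>2 / 2)" if "g \<in> F" for g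
    using centered_gaussian_measurable[OF cgW(1)[OF that]]
      centered_gaussian_abs_tail[OF N.prob_space_axioms cgW[OF that], of y] \<sigma> unfolding LW_def
    by (auto intro: borel_measurable_less)
  have ULs: "(\<Union>g\<in>F. LZ g) \<in> sets N" "(\<Union>g\<in>F. LW g) \<in> sets N"
    using finF LZs LWs by (intro sets.finite_UN; simp)+
  have Bads: "Bad \<in> sets N" unfolding Bad_def using lift_sets[OF B(1)] ULs by (intro sets.Un)
  have "measure N (\<Union>g\<in>F. LZ g) \<le> (\<Sum>g\<in>F. 2 * exp (- y\<^sup>2 / 2))"
    using finF LZs by (intro order_trans[OF measure_UNION_le] sum_mono) auto
  moreover have "measure N (\<Union>g\<in>F. LW g) \<le> (\<Sum>g\<in>F. 2 * exp (- y\<^sup>2 / 2))"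
    using finF LWs by (intro order_trans[OF measure_UNION_le] sum_mono) auto
  moreover have "measure N Bad \<le> measure N {p\<in>space N. fst p \<in> B} + (measure N (\<Union>g\<in>F. LZ g) + measure N (\<Union>g\<in>F. LW g))"
    unfolding Bad_def using lift_sets[OF B(1)] ULs
    by (intro order_trans[OF measure_Un_le] add_mono order_refl measure_Un_le sets.Un)
  ultimately have Badp: "measure N Bad \<le> \<beta>"
    using B(2) lift[OF B(1)] cardF unfolding \<beta>_def by (simp add: algebra_simps)
  have UZ: "\<bar>Z j (s i) (fst p) - U (j, i) p\<bar> \<le> \<eta>" if "p \<in> space N - Bad" "j \<in> {1..n}" "i \<le> m" for p i j
  proof -
    have "(j, i) \<in> F" using that by (simp add: F_def)
    then have "\<bar>snd p (j, i)\<bar> \<le> y" using that unfolding Bad_def LW_def by force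
    then have "\<sigma> * \<bar>snd p (j, i)\<bar> \<le> \<sigma> * y" using \<sigma> by (intro mult_left_mono) auto
    from order_trans[OF this \<sigma>(3)] show ?thesis using \<sigma>(1) by (simp add: U_def abs_mult)
  qed
  have VR: "\<bar>Z j (a' + q) (fst p) - R (j, q) p\<bar> \<le> \<eta>" if p: "p \<in> space N - Bad" and j: "j \<in> {1..n}" and q: "q \<in> D" for p j q
  proof -
    have \<tau>: "(j, q) \<in> I" using j q by (simp add: I_def)
    have Ub: "\<bar>U g p\<bar> \<le> y + \<eta>" if "g \<in> F" for g
    proof -
      have "\<bar>Z (fst g) (s (snd g)) (fst p)\<bar> \<le> y" using p that unfolding Bad_def LZ_def by force
      then show ?thesis using UZ[OF p, of "fst g" "snd g"] F[OF that] by simp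
    qed
    have "\<bar>\<Sum>h\<in>F. c (j, q) h * U h p\<bar> \<le> (\<Sum>h\<in>F. \<bar>c (j, q) h\<bar> * (y + \<eta>))"
      by (rule order_trans[OF sum_abs sum_mono]) (auto simp: abs_mult intro!: mult_left_mono Ub)
    also have "\<dots> = (\<Sum>h\<in>F. \<bar>c (j, q) h\<bar>) * (y + \<eta>)" by (simp add: sum_distrib_right)
    also have "\<dots> \<le> card F * \<delta> / \<sigma>\<^sup>2 * (y + \<eta>)"
      using c(2)[OF \<tau>] \<sigma> pos by (intro mult_right_mono) auto
    also have "\<dots> \<le> \<eta>" using small by (simp add: cardF)
    finally show ?thesis by (simp add: R_def V_def)
  qed
  have p1: "measure N EU \<le> prob (hit 0 b (u - 3 * \<eta>)) + \<beta>"
  proof -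
    have "EU \<subseteq> {p\<in>space N. fst p \<in> hit a (a + b) (u - 3 * \<eta>)} \<union> Bad"
    proof
      fix p assume p: "p \<in> EU"
      then have ps: "p \<in> space N" by (simp add: EU_def)
      show "p \<in> {p\<in>space N. fst p \<in> hit a (a + b) (u - 3 * \<eta>)} \<union> Bad"
      proof (cases "p \<in> Bad")
        case False
        from p obtain i where i: "i \<le> m" "rank_exceeds n k (\<lambda>j. U (j, i) p) (u - 2 * \<eta>)"
          by (auto simp: EU_def QU_def)
        have "rank_exceeds n k (\<lambda>j. Z j (s i) (fst p)) (u - 3 * \<eta>)"
          using UZ[of p _ i] False ps i(1)
          by (intro rank_exceeds_perturb[OF i(2), of _ \<eta>]) (auto simp: abs_minus_commute)
        then show ?thesis
          using ps s[OF i(1)] measurable_space[OF fst_meas ps] by (auto simp: hit_def intro!: bexI[of _ "s i"])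
      qed simp
    qed
    then have "measure N EU \<le> measure N ({p\<in>space N. fst p \<in> hit a (a + b) (u - 3 * \<eta>)} \<union> Bad)"
      using lift_sets[OF hit_sets[OF a(1) pos(3)]] Bads by (intro N.finite_measure_mono sets.Un)
    also have "\<dots> \<le> measure N {p\<in>space N. fst p \<in> hit a (a + b) (u - 3 * \<eta>)} + measure N Bad"
      using lift_sets[OF hit_sets[OF a(1) pos(3)]] Bads by (intro measure_Un_le)
    finally show ?thesis
      using Badp lift[OF hit_sets[OF a(1) pos(3)]] hit_stationary[OF a(1) pos(3)] by simp
  qed
  have p2: "measure N ER \<le> prob (hit 0 b (u' - 2 * \<eta>)) + \<beta>"
  proof -
    have "ER \<subseteq> {p\<in>space N. fst p \<in> hit a' (a' + b) (u' - 2 * \<eta>)} \<union> Bad"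
    proof
      fix p assume p: "p \<in> ER"
      then have ps: "p \<in> space N" by (simp add: ER_def)
      show "p \<in> {p\<in>space N. fst p \<in> hit a' (a' + b) (u' - 2 * \<eta>)} \<union> Bad"
      proof (cases "p \<in> Bad")
        case False
        from p obtain q where q: "q \<in> D" "rank_exceeds n k (\<lambda>j. R (j, q) p) (u' - \<eta>)"
          by (auto simp: ER_def QR_def)
        have "rank_exceeds n k (\<lambda>j. Z j (a' + q) (fst p)) (u' - 2 * \<eta>)"
          using VR[of p _ q] False ps q(1)
          by (intro rank_exceeds_perturb[OF q(2), of _ \<eta>]) (auto simp: abs_minus_commute)
        then show ?thesis
          using ps D[OF q(1)] measurable_space[OF fst_meas ps] by (auto simp: hit_def intro!: bexI[of _ "a' + q"])
      qed simp
    qed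
    then have "measure N ER \<le> measure N ({p\<in>space N. fst p \<in> hit a' (a' + b) (u' - 2 * \<eta>)} \<union> Bad)"
      using lift_sets[OF hit_sets[OF a(2) pos(3)]] Bads by (intro N.finite_measure_mono sets.Un)
    also have "\<dots> \<le> measure N {p\<in>space N. fst p \<in> hit a' (a' + b) (u' - 2 * \<eta>)} + measure N Bad"
      using lift_sets[OF hit_sets[OF a(2) pos(3)]] Bads by (intro measure_Un_le)
    finally show ?thesis
      using Badp lift[OF hit_sets[OF a(2) pos(3)]] hit_stationary[OF a(2) pos(3)] by simp
  qed
  let ?H = "hit a (a + b) u \<inter> hit a' (a' + b) u'"
  have Hs: "?H \<in> sets M" using hit_sets[OF a(1) pos(3)] hit_sets[OF a(2) pos(3)] by auto
  have "{p\<in>space N. fst p \<in> ?H} \<subseteq> (EU \<inter> ER) \<union> Bad"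
  proof
    fix p assume p: "p \<in> {p\<in>space N. fst p \<in> ?H}"
    show "p \<in> (EU \<inter> ER) \<union> Bad"
    proof (cases "p \<in> Bad")
      case False
      have ps: "p \<in> space N" and fs: "fst p \<in> space M - B" using p False by (auto simp: Bad_def hit_def)
      from p obtain t where t: "t \<in> {a..a+b}" "rank_exceeds n k (\<lambda>j. Z j t (fst p)) u"
        unfolding hit_def by auto
      obtain i where i: "i \<le> m" "\<And>j. j \<in> {1..n} \<Longrightarrow> \<bar>Z j t (fst p) - Z j (s i) (fst p)\<bar> \<le> \<eta>"
        using B(3)[OF fs, of "t - a"] t by (auto simp: s_def)
      have "rank_exceeds n k (\<lambda>j. Z j (s i) (fst p)) (u - \<eta>)"
        using rank_exceeds_perturb[OF t(2) i(2)] by simp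
      then have "rank_exceeds n k (\<lambda>j. U (j, i) p) (u - 2 * \<eta>)"
        by (rule rank_exceeds_perturb[where e=\<eta>]) (use UZ[of p _ i] False ps i(1) in auto)
      then have "p \<in> EU" using ps i(1) by (auto simp: EU_def QU_def)
      have "fst p \<in> hit a' (a' + b) u'" using p by simp
      then obtain q where q: "q \<in> D" "rank_exceeds n k (\<lambda>j. Z j (a' + q) (fst p)) u'"
        unfolding hit_eq_rational[OF a(2) pos(3)] D_def by auto
      have "rank_exceeds n k (\<lambda>j. R (j, q) p) (u' - \<eta>)"
        by (rule rank_exceeds_perturb[OF q(2), where e=\<eta>]) (use VR[of p _ q] False ps q(1) in auto)
      then have "p \<in> ER" using ps q(1) by (auto simp: ER_def QR_def)
      with \<open>p \<in> EU\<close> show ?thesis by simp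
    qed simp
  qed
  then have "measure N {p\<in>space N. fst p \<in> ?H} \<le> measure N ((EU \<inter> ER) \<union> Bad)"
    using EUs ERs Bads by (intro N.finite_measure_mono) auto
  also have "\<dots> \<le> measure N (EU \<inter> ER) + measure N Bad"
    using EUs ERs Bads by (intro measure_Un_le) auto
  finally have H: "prob ?H \<le> measure N EU * measure N ER + \<beta>"
    using lift[OF Hs] indep Badp by simp
  have \<beta>0: "\<beta> \<ge> 0" by (simp add: \<beta>_def)
  have "measure N EU * measure N ER \<le> prob (hit 0 b (u - 3 * \<eta>)) * prob (hit 0 b (u' - 2 * \<eta>)) + 2 * \<beta>"
  proof -
    have "measure N EU * measure N ER \<le> measure N EU * (prob (hit 0 b (u' - 2 * \<eta>)) + \<beta>)"
      using p2 by (rule mult_left_mono) simp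
    also have "\<dots> \<le> measure N EU * prob (hit 0 b (u' - 2 * \<eta>)) + 1 * \<beta>"
      unfolding distrib_left using \<beta>0 by (intro add_left_mono mult_right_mono) auto
    also have "measure N EU * prob (hit 0 b (u' - 2 * \<eta>)) \<le> (prob (hit 0 b (u - 3 * \<eta>)) + \<beta>) * prob (hit 0 b (u' - 2 * \<eta>))"
      using p1 by (rule mult_right_mono) simp
    also have "\<dots> \<le> prob (hit 0 b (u - 3 * \<eta>)) * prob (hit 0 b (u' - 2 * \<eta>)) + \<beta> * 1"
      unfolding distrib_right using \<beta>0 by (intro add_left_mono mult_left_mono) auto
    finally show ?thesis by simp
  qed
  then have "prob ?H \<le> prob (hit 0 b (u - 3 * \<eta>)) * prob (hit 0 b (u' - 2 * \<eta>)) + 4 * \<beta>"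
    using H \<beta>0 by linarith
  then show ?thesis unfolding \<beta>_def .
qed

end

section \<open>A second-moment criterion for infinitely many events\<close>

definition zeta2 :: real where "zeta2 = (\<Sum>d. 1 / (real (Suc d))\<^sup>2)"

lemma summable_zeta2: "summable (\<lambda>d. 1 / (real (Suc d))\<^sup>2)"
  using summable_Suc_iff[of "\<lambda>d. 1 / (real d)\<^sup>2"] inverse_power_summable[of 2, where 'a=real]
  by (simp add: inverse_eq_divide power_divide)

lemma sum_le_zeta2:
  assumes "finite I" "inj_on g I"
  shows "(\<Sum>j\<in>I. 1 / (real (Suc (g j)))\<^sup>2) \<le> zeta2"
proof -
  have "(\<Sum>j\<in>I. 1 / (real (Suc (g j)))\<^sup>2) = (\<Sum>d\<in>g ` I. 1 / (real (Suc d))\<^sup>2)"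
    using assms by (simp add: sum.reindex)
  also have "\<dots> \<le> zeta2" unfolding zeta2_def
    using assms by (intro sum_le_suminf summable_zeta2) auto
  finally show ?thesis .
qed

lemma sum_inverse_square_distance_le:
  assumes "finite I"
  shows "(\<Sum>j\<in>I - {i}. 1 / (real j - real i)\<^sup>2) \<le> 2 * zeta2"
proof -
  have "(\<Sum>j\<in>I - {i}. 1 / (real j - real i)\<^sup>2)
      = (\<Sum>j\<in>{j\<in>I. j < i}. 1 / (real j - real i)\<^sup>2) + (\<Sum>j\<in>{j\<in>I. i < j}. 1 / (real j - real i)\<^sup>2)"
    using assms by (subst sum.union_disjoint[symmetric]) (auto intro!: sum.cong)
  also have "(\<Sum>j\<in>{j\<in>I. j < i}. 1 / (real j - real i)\<^sup>2) = (\<Sum>j\<in>{j\<in>I. j < i}. 1 / (real (Suc (i - j - 1)))\<^sup>2)"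
    by (intro sum.cong refl) (auto simp: of_nat_diff power2_commute)
  also have "\<dots> \<le> zeta2" using assms by (intro sum_le_zeta2) (auto simp: inj_on_def)
  also have "(\<Sum>j\<in>{j\<in>I. i < j}. 1 / (real j - real i)\<^sup>2) = (\<Sum>j\<in>{j\<in>I. i < j}. 1 / (real (Suc (j - i - 1)))\<^sup>2)"
    by (intro sum.cong refl) (auto simp: of_nat_diff)
  also have "\<dots> \<le> zeta2" using assms by (intro sum_le_zeta2) (auto simp: inj_on_def)
  finally show ?thesis by simp
qed

text \<open>
  Chebyshev's inequality for the number \<open>S\<close> of events that occur: if none occurs, \<open>S\<close> deviates from its
  mean \<open>\<mu>\<close> by \<open>\<mu>\<close>. The second error term is summed over the distance of \<open>i\<close> and \<open>j\<close> and contributes a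
  multiple of \<open>\<mu>\<close> to the variance, the third a constant.
\<close>

lemma (in prob_space) second_moment_union:
  fixes A :: "nat \<Rightarrow> 'a set"
  assumes A: "\<And>i. A i \<in> events" and I: "finite I" "0 \<notin> I" and \<epsilon>: "\<epsilon> \<ge> 0"
    and pair: "\<And>i j. i \<in> I \<Longrightarrow> j \<in> I \<Longrightarrow> i < j \<Longrightarrow>
       prob (A i \<inter> A j) \<le> (1 + \<epsilon>) * prob (A i) * prob (A j) + prob (A i) / (real j - real i)\<^sup>2
          + 1 / ((real i)\<^sup>2 * (real j)\<^sup>2)"
    and \<mu>: "\<mu> = (\<Sum>i\<in>I. prob (A i))" "\<mu> > 0"
  shows "1 - prob (\<Union>i\<in>I. A i) \<le> \<epsilon> + (1 + 4 * zeta2) / \<mu> + zeta2\<^sup>2 / \<mu>\<^sup>2"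
proof -
  define p where "p i = prob (A i)" for i
  define S where "S w = (\<Sum>i\<in>I. indicator (A i) w :: real)" for w
  have [measurable]: "A i \<in> sets M" for i by (rule A)
  have Sm[measurable]: "S \<in> borel_measurable M" unfolding S_def[abs_def] by measurable
  have ind: "integrable M (\<lambda>w. indicator (B) w :: real)" if "B \<in> sets M" for B
    using that by (intro integrable_real_indicator) (auto simp: less_top[symmetric])
  have ES: "expectation S = \<mu>"
    unfolding S_def \<mu>(1) by (subst Bochner_Integration.integral_sum) (auto intro: ind)
  have S2: "(S w)\<^sup>2 = (\<Sum>i\<in>I. \<Sum>j\<in>I. indicator (A i \<inter> A j) w)" for w
    unfolding S_def power2_eq_square sum_product by (simp add: indicator_inter_arith)
  have iS2: "integrable M (\<lambda>w. (S w)\<^sup>2)"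
    unfolding S2 by (intro Bochner_Integration.integrable_sum ind) auto
  have "expectation (\<lambda>w. (S w)\<^sup>2) = (\<Sum>i\<in>I. \<Sum>j\<in>I. prob (A i \<inter> A j))"
  proof -
    have "expectation (\<lambda>w. (S w)\<^sup>2) = (\<Sum>i\<in>I. expectation (\<lambda>w. \<Sum>j\<in>I. indicator (A i \<inter> A j) w))"
      unfolding S2 by (intro Bochner_Integration.integral_sum Bochner_Integration.integrable_sum ind) auto
    also have "\<dots> = (\<Sum>i\<in>I. \<Sum>j\<in>I. expectation (indicator (A i \<inter> A j)))"
      by (intro sum.cong refl Bochner_Integration.integral_sum ind) auto
    finally show ?thesis by simp
  qed
  also have "\<dots> \<le> (\<Sum>i\<in>I. \<Sum>j\<in>I. (1 + \<epsilon>) * (p i * p j) + (if i = j then p i else 0)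
       + (if i = j then 0 else (p i + p j) / (real j - real i)\<^sup>2) + 1 / (real i)\<^sup>2 * (1 / (real j)\<^sup>2))"
  proof (intro sum_mono)
    fix i j assume ij: "i \<in> I" "j \<in> I"
    have p0: "p i \<ge> 0" for i by (simp add: p_def)
    have *: "prob (A i \<inter> A j) \<le> (1 + \<epsilon>) * (p i * p j) + (p i + p j) / (real j - real i)\<^sup>2 + 1 / (real i)\<^sup>2 * (1 / (real j)\<^sup>2)"
      if "i \<in> I" "j \<in> I" "i < j" for i j
    proof -
      have "p i / (real j - real i)\<^sup>2 \<le> (p i + p j) / (real j - real i)\<^sup>2"
        using p0 by (intro divide_right_mono) auto
      then show ?thesis using pair[OF that] by (simp add: p_def mult.assoc)
    qed
    consider "i < j" | "j < i" | "i = j" by linarith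
    then show "prob (A i \<inter> A j) \<le> (1 + \<epsilon>) * (p i * p j) + (if i = j then p i else 0)
       + (if i = j then 0 else (p i + p j) / (real j - real i)\<^sup>2) + 1 / (real i)\<^sup>2 * (1 / (real j)\<^sup>2)"
    proof cases
      case 1 then show ?thesis using *[OF ij] by simp
    next
      case 2
      then show ?thesis using *[OF ij(2,1)]
        by (simp add: Int_commute mult.commute add.commute power2_commute)
    next
      case 3
      have "0 \<le> (1 + \<epsilon>) * (p i * p j)" "0 \<le> 1 / (real i)\<^sup>2 * (1 / (real j)\<^sup>2)" using p0 \<epsilon> by auto
      then show ?thesis using 3 by (simp add: p_def)
    qed
  qed
  also have "\<dots> = (1 + \<epsilon>) * \<mu>\<^sup>2 + \<mu> + (\<Sum>i\<in>I. \<Sum>j\<in>I. if i = j then 0 else (p i + p j) / (real j - real i)\<^sup>2)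
       + (\<Sum>i\<in>I. 1 / (real i)\<^sup>2)\<^sup>2"
  proof -
    have "(\<Sum>i\<in>I. \<Sum>j\<in>I. (1 + \<epsilon>) * (p i * p j)) = (1 + \<epsilon>) * \<mu>\<^sup>2"
      unfolding \<mu>(1) p_def[symmetric] power2_eq_square sum_product by (simp only: sum_distrib_left)
    moreover have "(\<Sum>i\<in>I. \<Sum>j\<in>I. 1 / (real i)\<^sup>2 * (1 / (real j)\<^sup>2)) = (\<Sum>i\<in>I. 1 / (real i)\<^sup>2)\<^sup>2"
      unfolding power2_eq_square[of "\<Sum>i\<in>I. 1 / (real i)\<^sup>2"] sum_product ..
    moreover have "(\<Sum>i\<in>I. \<Sum>j\<in>I. if i = j then p i else 0) = \<mu>"
      using I by (simp add: \<mu>(1) p_def)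
    ultimately show ?thesis by (simp only: sum.distrib)
  qed
  finally have E0: "expectation (\<lambda>w. (S w)\<^sup>2) \<le> (1 + \<epsilon>) * \<mu>\<^sup>2 + \<mu>
       + (\<Sum>i\<in>I. \<Sum>j\<in>I. if i = j then 0 else (p i + p j) / (real j - real i)\<^sup>2) + (\<Sum>i\<in>I. 1 / (real i)\<^sup>2)\<^sup>2" .
  have E1: "(\<Sum>i\<in>I. \<Sum>j\<in>I. if i = j then 0 else (p i + p j) / (real j - real i)\<^sup>2) \<le> 4 * zeta2 * \<mu>"
  proof -
    have "(\<Sum>i\<in>I. \<Sum>j\<in>I. if i = j then 0 else (p i + p j) / (real j - real i)\<^sup>2)
       = (\<Sum>i\<in>I. \<Sum>j\<in>I. (if i = j then 0 else p i / (real j - real i)\<^sup>2) + (if i = j then 0 else p j / (real j - real i)\<^sup>2))"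
      by (intro sum.cong refl) (auto simp: add_divide_distrib)
    also have "\<dots> = (\<Sum>i\<in>I. \<Sum>j\<in>I. if i = j then 0 else p i / (real j - real i)\<^sup>2)
        + (\<Sum>i\<in>I. \<Sum>j\<in>I. if i = j then 0 else p j / (real j - real i)\<^sup>2)"
      by (simp add: sum.distrib)
    also have "(\<Sum>i\<in>I. \<Sum>j\<in>I. if i = j then 0 else p j / (real j - real i)\<^sup>2)
        = (\<Sum>i\<in>I. \<Sum>j\<in>I. if i = j then 0 else p i / (real j - real i)\<^sup>2)"
      by (subst sum.swap) (intro sum.cong refl, auto simp: power2_commute)
    also have "(\<Sum>i\<in>I. \<Sum>j\<in>I. if i = j then 0 else p i / (real j - real i)\<^sup>2) \<le> (\<Sum>i\<in>I. p i * (2 * zeta2))"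
    proof (intro sum_mono)
      fix i assume "i \<in> I"
      have "(\<Sum>j\<in>I. if i = j then 0 else p i / (real j - real i)\<^sup>2) = (\<Sum>j\<in>I - {i}. p i * (1 / (real j - real i)\<^sup>2))"
        using I by (intro sum.mono_neutral_cong_right) auto
      also have "\<dots> = p i * (\<Sum>j\<in>I - {i}. 1 / (real j - real i)\<^sup>2)" by (simp add: sum_distrib_left)
      also have "\<dots> \<le> p i * (2 * zeta2)"
        using sum_inverse_square_distance_le[OF I(1)] by (intro mult_left_mono) (auto simp: p_def)
      finally show "(\<Sum>j\<in>I. if i = j then 0 else p i / (real j - real i)\<^sup>2) \<le> p i * (2 * zeta2)" .
    qed
    also have "(\<Sum>i\<in>I. p i * (2 * zeta2)) = 2 * zeta2 * \<mu>"
      by (simp add: \<mu>(1) p_def sum_distrib_left mult.commute)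
    finally show ?thesis by simp
  qed
  have E3: "(\<Sum>i\<in>I. 1 / (real i)\<^sup>2) \<le> zeta2"
  proof -
    have "(\<Sum>i\<in>I. 1 / (real i)\<^sup>2) = (\<Sum>i\<in>I. 1 / (real (Suc (i - 1)))\<^sup>2)"
    proof (intro sum.cong refl)
      fix i assume "i \<in> I"
      then have "i \<noteq> 0" using I by metis
      then show "1 / (real i)\<^sup>2 = 1 / (real (Suc (i - 1)))\<^sup>2" by simp
    qed
    also have "\<dots> \<le> zeta2"
    proof (intro sum_le_zeta2 I(1) inj_onI)
      fix i j assume "i \<in> I" "j \<in> I" "i - 1 = j - 1"
      moreover have "i \<noteq> 0" "j \<noteq> 0" using calculation I by metis+
      ultimately show "i = j" by linarith
    qed
    finally show ?thesis .
  qed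
  have E4: "(\<Sum>i\<in>I. 1 / (real i)\<^sup>2)\<^sup>2 \<le> zeta2\<^sup>2"
    by (intro power_mono E3 sum_nonneg) simp
  have E2: "expectation (\<lambda>w. (S w)\<^sup>2) \<le> (1 + \<epsilon>) * \<mu>\<^sup>2 + \<mu> + 4 * zeta2 * \<mu> + zeta2\<^sup>2"
    using E0 E1 E4 by linarith
  have "variance S = expectation (\<lambda>w. (S w)\<^sup>2) - \<mu>\<^sup>2"
    using variance_eq[OF _ iS2] square_integrable_imp_integrable[OF Sm iS2] ES by simp
  also have "\<dots> \<le> \<epsilon> * \<mu>\<^sup>2 + (1 + 4 * zeta2) * \<mu> + zeta2\<^sup>2" using E2 by (simp add: algebra_simps)
  finally have var: "variance S \<le> \<epsilon> * \<mu>\<^sup>2 + (1 + 4 * zeta2) * \<mu> + zeta2\<^sup>2" .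
  have "1 - prob (\<Union>i\<in>I. A i) = prob (space M - (\<Union>i\<in>I. A i))"
    using I by (subst prob_compl) auto
  also have "\<dots> \<le> prob {w\<in>space M. \<mu> \<le> \<bar>S w - expectation S\<bar>}"
  proof (rule finite_measure_mono)
    show "space M - (\<Union>i\<in>I. A i) \<subseteq> {w\<in>space M. \<mu> \<le> \<bar>S w - expectation S\<bar>}"
      using \<mu>(2) by (auto simp: ES S_def)
  qed auto
  also have "\<dots> \<le> variance S / \<mu>\<^sup>2"
    using Sm iS2 \<mu>(2) by (intro Chebyshev_inequality)
  also have "\<dots> \<le> (\<epsilon> * \<mu>\<^sup>2 + (1 + 4 * zeta2) * \<mu> + zeta2\<^sup>2) / \<mu>\<^sup>2"
    using var by (intro divide_right_mono) auto
  also have "\<dots> = \<epsilon> + (1 + 4 * zeta2) / \<mu> + zeta2\<^sup>2 / \<mu>\<^sup>2"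
    using \<mu>(2) by (simp add: add_divide_distrib power2_eq_square)
  finally show ?thesis .
qed

proposition (in prob_space) second_moment_infinitely_often:
  fixes A :: "nat \<Rightarrow> 'a set"
  assumes A: "\<And>i. A i \<in> events" and div: "\<not> summable (\<lambda>i. prob (A i))"
    and pair: "\<And>\<epsilon>. \<epsilon> > 0 \<Longrightarrow> \<exists>N. \<forall>i j. N \<le> i \<longrightarrow> i < j \<longrightarrow>
       prob (A i \<inter> A j) \<le> (1 + \<epsilon>) * prob (A i) * prob (A j) + prob (A i) / (real j - real i)\<^sup>2
          + 1 / ((real i)\<^sup>2 * (real j)\<^sup>2)"
  shows "AE w in M. \<exists>\<^sub>\<infinity>i. w \<in> A i"
proof -
  have tail: "prob (\<Union>i\<in>{N..}. A i) = 1" for N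
  proof -
    have eps: "1 - prob (\<Union>i\<in>{N..}. A i) \<le> \<epsilon>" if \<epsilon>: "\<epsilon> > 0" for \<epsilon>
    proof -
      from pair[OF \<epsilon>] obtain N1 where N1: "\<And>i j. N1 \<le> i \<Longrightarrow> i < j \<Longrightarrow>
       prob (A i \<inter> A j) \<le> (1 + \<epsilon>) * prob (A i) * prob (A j) + prob (A i) / (real j - real i)\<^sup>2
          + 1 / ((real i)\<^sup>2 * (real j)\<^sup>2)" by blast
      define N2 where "N2 = Suc (N + N1)"
      define \<mu> where "\<mu> L = (\<Sum>i\<in>{N2..<N2+L}. prob (A i))" for L
      have ns: "\<not> summable (\<lambda>i. prob (A (i + N2)))"
        using div summable_iff_shift[of "\<lambda>i. prob (A i)" N2] by simp
      have \<mu>_shift: "\<mu> L = (\<Sum>i<L. prob (A (i + N2)))" for L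
        unfolding \<mu>_def by (rule sum.reindex_bij_witness[of _ "\<lambda>i. i + N2" "\<lambda>i. i - N2"]) auto
      have lim: "filterlim \<mu> at_top sequentially"
        unfolding filterlim_at_top
      proof
        fix B
        have "\<not> (\<forall>L. \<mu> L \<le> B)"
        proof
          assume "\<forall>L. \<mu> L \<le> B"
          then have "summable (\<lambda>i. prob (A (i + N2)))"
            unfolding \<mu>_shift by (intro summableI_nonneg_bounded[of _ B]) auto
          with ns show False by simp
        qed
        then obtain L0 where gt: "\<mu> L0 > B" by (auto simp: not_le)
        have mon: "\<mu> L0 \<le> \<mu> L" if "L \<ge> L0" for L
          unfolding \<mu>_def using that by (intro sum_mono2) auto
        have "\<mu> L \<ge> B" if "L \<ge> L0" for L using gt mon[OF that] by linarith
        then show "\<forall>\<^sub>F L in sequentially. B \<le> \<mu> L" by (rule eventually_sequentiallyI)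
      qed
      have ev: "\<forall>\<^sub>F L in sequentially. 1 - prob (\<Union>i\<in>{N..}. A i) \<le> \<epsilon> + (1 + 4 * zeta2) / \<mu> L + zeta2\<^sup>2 / (\<mu> L)\<^sup>2"
        using lim[unfolded filterlim_at_top_dense, rule_format, of 0]
      proof eventually_elim
        case (elim L)
        have "1 - prob (\<Union>i\<in>{N2..<N2+L}. A i) \<le> \<epsilon> + (1 + 4 * zeta2) / \<mu> L + zeta2\<^sup>2 / (\<mu> L)\<^sup>2"
        proof (rule second_moment_union[OF A])
          fix i j assume "i \<in> {N2..<N2+L}" "i < j"
          then have "N1 \<le> i" by (simp add: N2_def)
          from N1[OF this \<open>i < j\<close>] show "prob (A i \<inter> A j) \<le> (1 + \<epsilon>) * prob (A i) * prob (A j)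
              + prob (A i) / (real j - real i)\<^sup>2 + 1 / ((real i)\<^sup>2 * (real j)\<^sup>2)" .
        next
          show "\<mu> L = (\<Sum>i\<in>{N2..<N2+L}. prob (A i))" by (rule \<mu>_def)
        qed (use elim \<epsilon> in \<open>auto simp: N2_def\<close>)
        moreover have "prob (\<Union>i\<in>{N2..<N2+L}. A i) \<le> prob (\<Union>i\<in>{N..}. A i)"
        proof (intro finite_measure_mono UN_mono)
          show "{N2..<N2+L} \<subseteq> {N..}" by (auto simp: N2_def)
        qed (use A in auto)
        ultimately show ?case by linarith
      qed
      have "(\<lambda>L. \<epsilon> + (1 + 4 * zeta2) / \<mu> L + zeta2\<^sup>2 / (\<mu> L)\<^sup>2) \<longlonglongrightarrow> \<epsilon> + 0 + 0"
      proof (intro tendsto_add tendsto_const)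
        show "(\<lambda>L. (1 + 4 * zeta2) / \<mu> L) \<longlonglongrightarrow> 0"
          by (rule tendsto_divide_0[OF tendsto_const filterlim_at_top_imp_at_infinity[OF lim]])
        show "(\<lambda>L. zeta2\<^sup>2 / (\<mu> L)\<^sup>2) \<longlonglongrightarrow> 0"
          by (rule tendsto_divide_0[OF tendsto_const filterlim_at_top_imp_at_infinity[OF filterlim_pow_at_top[OF _ lim]]]) simp
      qed
      from tendsto_lowerbound[OF this ev] have "1 - prob (\<Union>i\<in>{N..}. A i) \<le> \<epsilon> + 0 + 0" by simp
      then show ?thesis by simp
    qed
    have "1 - prob (\<Union>i\<in>{N..}. A i) \<le> 0"
    proof (rule field_le_epsilon)
      fix e :: real assume "0 < e"
      from eps[OF this] show "1 - prob (\<Union>i\<in>{N..}. A i) \<le> 0 + e" by simp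
    qed
    then show ?thesis using prob_le_1[of "\<Union>i\<in>{N..}. A i"] by linarith
  qed
  have "AE w in M. \<forall>N. w \<in> (\<Union>i\<in>{N..}. A i)"
    unfolding AE_all_countable using AE_prob_1[OF tail] by simp
  then show ?thesis
  proof eventually_elim
    case (elim w)
    have "\<exists>i\<ge>N. w \<in> A i" for N using elim[rule_format, of N] by (simp add: Bex_def)
    then show ?case unfolding INFM_nat_le by simp
  qed
qed

text \<open>
  If \<open>a\<close> is eventually below \<open>b\<close>, the minima are eventually the terms of \<open>a\<close>. Otherwise \<open>a N > b N\<close> for
  arbitrarily large \<open>N\<close>, and then by monotonicity the first \<open>Suc N\<close> minima are all at least
  \<open>b N \<ge> c / sqrt (Suc N)\<close>, so that their sum is at least \<open>c * sqrt (Suc N)\<close>.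
\<close>

lemma min_series_diverges:
  fixes a b :: "nat \<Rightarrow> real"
  assumes a: "antimono a" "\<And>i. a i \<ge> 0" "\<not> summable a"
    and b: "antimono b" "c > 0" "\<And>i. b i \<ge> c / sqrt (Suc i)"
  shows "\<not> summable (\<lambda>i. min (a i) (b i))"
proof
  assume sm: "summable (\<lambda>i. min (a i) (b i))"
  have b0: "b i \<ge> 0" for i
  proof -
    have "0 \<le> c / sqrt (Suc i)" using b(2) by simp
    with b(3)[of i] show ?thesis by linarith
  qed
  show False
  proof (cases "\<forall>\<^sub>F i in sequentially. a i \<le> b i")
    case True
    then have "\<forall>\<^sub>F i in sequentially. min (a i) (b i) = a i" by eventually_elim auto
    from summable_cong[OF this] sm have "summable a" by simp
    with a show False by simp
  next
    case False
    then have inf: "\<exists>N\<ge>N0. a N > b N" for N0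
      unfolding eventually_sequentially by (auto simp: not_le)
    define s where "s = (\<Sum>i. min (a i) (b i))"
    obtain N0 :: nat where N0: "real N0 > (s / c)\<^sup>2" using reals_Archimedean2 by blast
    obtain N where N: "N \<ge> N0" "a N > b N" using inf by blast
    have "(\<Sum>i\<le>N. c / sqrt (Suc N)) = c * (real (Suc N) / sqrt (Suc N))" by simp
    also have "real (Suc N) / sqrt (Suc N) = sqrt (Suc N)" by (rule real_div_sqrt) simp
    finally have "c * sqrt (Suc N) = (\<Sum>i\<le>N. c / sqrt (Suc N))" ..
    also have "\<dots> \<le> (\<Sum>i\<le>N. min (a i) (b i))"
    proof (intro sum_mono)
      fix i assume "i \<in> {..N}"
      then have "a N \<le> a i" "b N \<le> b i" using a(1) b(1) by (auto simp: antimono_def)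
      then show "c / sqrt (Suc N) \<le> min (a i) (b i)" using N(2) b(3)[of N] by auto
    qed
    also have "\<dots> \<le> s" unfolding s_def using sm a b0 by (intro sum_le_suminf) auto
    finally have "sqrt (Suc N) \<le> s / c" using b(2) by (simp add: field_simps)
    then have "(sqrt (Suc N))\<^sup>2 \<le> (s / c)\<^sup>2" by (intro power_mono) auto
    then show False using N0 N(1) by simp
  qed
qed

section \<open>Infinitely many exceedances when the series diverges\<close>

text \<open>
  The conditions on the correlation function in quantitative form, for a block length \<open>b\<close>.
\<close>

locale mixing_gaussian_copies = gaussian_copies M Z n k \<rho>
  for M :: "'b measure" and Z n k \<rho> +
  fixes A \<alpha> b \<kappa> B lam t1 :: real
  assumes par: "A > 0" "\<alpha> > 0" "b > 0" "0 \<le> \<kappa>" "\<kappa> < 1" "lam > 0" "B \<ge> 0"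
    and incr: "\<And>t. 0 \<le> t \<Longrightarrow> t \<le> b \<Longrightarrow> 1 - \<rho> t \<le> A * t powr \<alpha>"
    and half: "\<And>t. 0 \<le> t \<Longrightarrow> t \<le> b \<Longrightarrow> \<rho> t \<ge> 1 / 2"
    and sep: "\<And>t. b \<le> t \<Longrightarrow> \<rho> t \<le> \<kappa>"
    and decay: "\<And>t. t1 \<le> t \<Longrightarrow> \<bar>\<rho> t\<bar> \<le> B * t powr (- 2 * lam)"
begin

definition grid_size :: "nat \<Rightarrow> real \<Rightarrow> nat" where "grid_size a l = nat \<lceil>l ^ a\<rceil>"

definition chain_exponent :: "nat \<Rightarrow> real \<Rightarrow> real" where
  "chain_exponent m \<eta> = \<eta>\<^sup>2 * (1 - 2 powr (- \<alpha> / 4))\<^sup>2 / (4 * A * (b / m) powr \<alpha>)"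

text \<open>
  With a grid of about \<open>l ^ a\<close> points per block the chaining exponent is of order \<open>\<eta>\<^sup>2 * l powr (a * \<alpha>)\<close>. For
  \<open>\<eta> = 1 / l\<^sup>2\<close> and \<open>a * \<alpha> \<ge> 7\<close> this is of order at least \<open>l ^ 3\<close>, so that the chaining errors are at most of order
  \<open>l ^ a * exp (- l\<^sup>2)\<close>. For \<open>l = ln j\<close> this decays faster than every power of \<open>j\<close>.
\<close>

lemma chaining_scale:
  assumes a: "a * \<alpha> \<ge> 7"
  shows "\<forall>\<^sub>F l in at_top. grid_size a l > 0 \<and> real (grid_size a l) + 1 \<le> 3 * l ^ a \<and>
    chain_exponent (grid_size a l) (1 / l\<^sup>2) \<ge> l\<^sup>2 \<and> chain_exponent (grid_size a l) (1 / l\<^sup>2) * \<alpha> \<ge> 4"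
proof -
  define c where "c = (1 - 2 powr (- \<alpha> / 4))\<^sup>2 / (4 * A * b powr \<alpha>)"
  have "2 powr (- \<alpha> / 4) < (1::real)" using par by (simp add: powr_less_one)
  then have c: "c > 0" unfolding c_def using par by simp
  have e1: "\<forall>\<^sub>F l in at_top. c * l ^ 3 \<ge> l\<^sup>2" using c by real_asymp
  have e2: "\<forall>\<^sub>F l::real in at_top. l\<^sup>2 * \<alpha> \<ge> 4" using par by real_asymp
  show ?thesis
    using e1 e2 eventually_ge_at_top[of 1]
  proof eventually_elim
    case (elim l)
    define m where "m = grid_size a l"
    have la: "1 \<le> l ^ a" using elim(3) by (rule one_le_power)
    have m: "l ^ a \<le> real m" "real m \<le> l ^ a + 1"
      using la unfolding m_def grid_size_def by linarith+
    have l0: "l > 0" using elim(3) by linarith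
    have "l ^ 7 = l powr real 7" using powr_realpow[OF l0, of 7] by simp
    also have "\<dots> \<le> l powr (real a * \<alpha>)" using a elim(3) by (intro powr_mono) auto
    also have "\<dots> = (l ^ a) powr \<alpha>" unfolding powr_powr[symmetric] powr_realpow[OF l0] ..
    also have "\<dots> \<le> real m powr \<alpha>" using m(1) la par(2) by (intro powr_mono2) auto
    finally have m7: "l ^ 7 \<le> real m powr \<alpha>" .
    have "l\<^sup>2 \<le> c * l ^ 3" by fact
    also have "l ^ 3 = (1 / l\<^sup>2)\<^sup>2 * l ^ 7"
    proof -
      have "(1 / l\<^sup>2)\<^sup>2 * l ^ 7 = l ^ 3 * (1 / l\<^sup>2 * l\<^sup>2)\<^sup>2" by (simp add: eval_nat_numeral mult_ac)
      then show ?thesis using l0 by simp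
    qed
    also have "c * ((1 / l\<^sup>2)\<^sup>2 * l ^ 7) \<le> c * ((1 / l\<^sup>2)\<^sup>2 * real m powr \<alpha>)"
      using m7 c by (intro mult_left_mono) auto
    also have "\<dots> = chain_exponent m (1 / l\<^sup>2)"
    proof -
      have "(b / m) powr \<alpha> = b powr \<alpha> / real m powr \<alpha>" using par by (subst powr_divide) auto
      then show ?thesis unfolding chain_exponent_def c_def by (simp add: mult_ac)
    qed
    finally have K: "l\<^sup>2 \<le> chain_exponent m (1 / l\<^sup>2)" .
    moreover have "4 \<le> chain_exponent m (1 / l\<^sup>2) * \<alpha>"
      using mult_right_mono[OF K, of \<alpha>] par(2) elim(2) by linarith
    moreover have "m > 0" using m la by (intro Nat.gr0I) auto
    moreover have "real m + 1 \<le> 3 * l ^ a" using m la by linarith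
    ultimately show ?case unfolding m_def by blast
  qed
qed

abbreviation level_prob :: "real \<Rightarrow> real" where "level_prob u \<equiv> prob (hit 0 b u)"

lemma level_prob_antimono: "u \<le> v \<Longrightarrow> level_prob v \<le> level_prob u"
  using hit_antimono[of u v 0 b] hit_sets0[OF par(3)] by (intro finite_measure_mono) auto

lemma level_prob_lower: "u \<ge> 0 \<Longrightarrow> std_normal_density (u + 1) ^ k \<le> level_prob u"
  using hit_lower_bound[OF par(3), of u] std_normal_tail_lower[of u]
    power_mono[OF std_normal_tail_lower[of u], of k] by (simp add: normal_density_nonneg)

text \<open>Gaps of length \<open>b\<close> between the blocks keep the correlation between distinct blocks at most \<open>\<kappa>\<close>.\<close>

definition block_hit :: "real \<Rightarrow> nat \<Rightarrow> real \<Rightarrow> 'b set" where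
  "block_hit a0 i u = hit (a0 + 2 * b * i) (a0 + 2 * b * i + b) u"

lemma block_hit_sets: "a0 \<ge> 0 \<Longrightarrow> block_hit a0 i u \<in> sets M"
  unfolding block_hit_def using par by (intro hit_sets) auto

lemma prob_block_hit: "a0 \<ge> 0 \<Longrightarrow> prob (block_hit a0 i u) = level_prob u"
  unfolding block_hit_def using par by (intro hit_stationary) auto

text \<open>
  Here \<open>l = ln j\<close> and \<open>\<eta> = 1 / l\<^sup>2\<close>, the noise has size \<open>\<sigma> = 1 / l ^ 3\<close>, and Gaussian variables are cut
  off at \<open>y = l\<close>. The shift in \<open>hit_level_regularity\<close> then costs the factor \<open>exp (6 * sqrt n / l)\<close>, which tends to
  \<open>1\<close>, and all cut-off errors are at most of order \<open>l ^ a * exp (- (l - 1)\<^sup>2 / 2)\<close>. The exponent \<open>D\<close> makes the correlation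
  between the blocks at most of order \<open>1 / l ^ (a + 10)\<close>: this beats the number of grid points, of order \<open>l ^ a\<close>,
  the factor \<open>1 / \<sigma>\<^sup>2 = l ^ 6\<close>, the cut-off \<open>l\<close> and the required bound \<open>\<eta>\<close>.
\<close>

lemma far_pairs:
  fixes a D :: nat and a0 \<epsilon> :: real
  assumes a0: "a0 \<ge> 0" and \<epsilon>: "\<epsilon> > 0" and a: "a * \<alpha> \<ge> 7" and D: "2 * lam * D \<ge> a + 10"
  shows "\<forall>\<^sub>F j in sequentially. \<forall>i<j. ln (real j) ^ D \<le> real j - real i \<longrightarrow> (\<forall>u u'.
    prob (block_hit a0 i u \<inter> block_hit a0 j u') \<le> (1 + \<epsilon>) * level_prob u * level_prob u' + 1 / real j ^ 4)"
proof -
  define N where "N = sqrt n"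
  define Q where "Q = B * b powr (- 2 * lam)"
  have N: "N > 0" using k by (simp add: N_def)
  have Q: "Q \<ge> 0" using par by (simp add: Q_def)
  have D0: "D > 0" using D by (intro Nat.gr0I) simp
  have ev: "\<forall>\<^sub>F l in at_top. exp (12 * N / l) \<le> 1 + \<epsilon>" using \<epsilon> N by real_asymp
  have ev2: "\<forall>\<^sub>F l in at_top. exp (6 * N / l) \<le> 2" using N by real_asymp
  have ev3: "\<forall>\<^sub>F l::real in at_top. 6 * N / l\<^sup>2 \<le> 1" using N by real_asymp
  have ev4: "\<forall>\<^sub>F l::real in at_top. 5 * exp (- (l - 1)\<^sup>2 / 2) + 144 * n * l ^ a * exp (- l\<^sup>2 / 2) \<le> exp (- 4 * l)"
  proof -
    have "\<forall>\<^sub>F l::real in at_top. 5 * exp (- (l - 1)\<^sup>2 / 2) + 144 * n * l powr a * exp (- l\<^sup>2 / 2) \<le> exp (- 4 * l)"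
      by real_asymp
    then show ?thesis
      using eventually_gt_at_top[of 0] by eventually_elim (simp add: powr_realpow)
  qed
  have ev5: "\<forall>\<^sub>F l::real in at_top. 3 * n * Q * (l + 1) / l ^ 4 \<le> 1 / l\<^sup>2" using Q by real_asymp
  have ev6: "\<forall>\<^sub>F l::real in at_top. b * l ^ D \<ge> t1"
  proof -
    have "filterlim (\<lambda>l. b * l ^ D) at_top at_top"
      using par D0 by (intro filterlim_tendsto_pos_mult_at_top[OF tendsto_const] filterlim_pow_at_top filterlim_ident) auto
    then show ?thesis by (simp add: filterlim_at_top)
  qed
  have ln_lim: "filterlim (\<lambda>j. ln (real j)) at_top sequentially" by real_asymp
  show ?thesis
    using eventually_compose_filterlim[OF ev ln_lim] eventually_compose_filterlim[OF ev2 ln_lim]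
      eventually_compose_filterlim[OF ev3 ln_lim] eventually_compose_filterlim[OF ev4 ln_lim]
      eventually_compose_filterlim[OF ev5 ln_lim] eventually_compose_filterlim[OF ev6 ln_lim]
      eventually_compose_filterlim[OF chaining_scale[OF a] ln_lim]
      eventually_compose_filterlim[OF eventually_ge_at_top[of 1] ln_lim] eventually_gt_at_top[of 0]
  proof eventually_elim
    case (elim j)
    define l where "l = ln (real j)"
    define m where "m = grid_size a l"
    define \<eta> where "\<eta> = 1 / l\<^sup>2"
    define K where "K = chain_exponent m \<eta>"
    have l: "l \<ge> 1" using elim unfolding l_def by simp
    have m: "m > 0" "real m + 1 \<le> 3 * l ^ a" and K: "l\<^sup>2 \<le> K" "K * \<alpha> \<ge> 4"
      using elim unfolding m_def K_def \<eta>_def l_def by auto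
    have \<eta>: "\<eta> > 0" "\<eta> \<le> 1" using l by (auto simp: \<eta>_def divide_le_eq one_le_power)
    have nm: "real (n * (m + 1)) \<le> real n * (3 * l ^ a)"
      using mult_left_mono[OF m(2), of "real n"] by (simp add: algebra_simps)
    define e where "e = exp (- (l - 1)\<^sup>2 / 2)"
    define F where "F = exp (6 * N / l)"
    have reg: "level_prob (u - 3 * \<eta>) \<le> F * level_prob u + e" for u
    proof -
      have "2 * N * (3 * \<eta>) * l = 6 * N / l" using l by (simp add: \<eta>_def power2_eq_square)
      moreover have "l - 2 * N * (3 * \<eta>) \<ge> l - 1" using elim by (simp add: \<eta>_def l_def)
      then have "measure std_normal_distribution {l - 2 * N * (3 * \<eta>)<..} \<le> exp (- (l - 2 * N * (3 * \<eta>))\<^sup>2 / 2)"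
        using l by (intro std_normal_tail) linarith
      moreover have "exp (- (l - 2 * N * (3 * \<eta>))\<^sup>2 / 2) \<le> e"
        unfolding e_def using \<open>l - 2 * N * (3 * \<eta>) \<ge> l - 1\<close> l by (simp add: power_mono)
      ultimately show ?thesis
        using hit_level_regularity[OF par(3) half, of "3 * \<eta>" u l] \<eta> unfolding F_def N_def by simp
    qed
    show ?case
    proof (intro allI impI)
      fix i u u' assume i: "i < j" and far: "ln (real j) ^ D \<le> real j - real i"
      define \<delta> where "\<delta> = B * (b * l ^ D) powr (- 2 * lam)"
      have lD: "l ^ D \<ge> 1" using l by (rule one_le_power)
      have \<delta>0: "\<delta> \<ge> 0" using par by (simp add: \<delta>_def)
      have \<delta>b: "\<bar>\<rho> \<bar>t - s\<bar>\<bar> \<le> \<delta>"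
        if "s \<in> {a0 + 2 * b * i..a0 + 2 * b * i + b}" "t \<in> {a0 + 2 * b * j..a0 + 2 * b * j + b}" for s t
      proof -
        have "b * l ^ D \<le> b * (real j - real i)" using far par unfolding l_def by (intro mult_left_mono) auto
        moreover have "b * 1 \<le> b * (real j - real i)" using i par by (intro mult_left_mono) auto
        moreover have "2 * b * (real j - real i) - b \<le> t - s" using that by (simp add: algebra_simps)
        ultimately have ts: "b * l ^ D \<le> \<bar>t - s\<bar>" by linarith
        then have "\<bar>\<rho> \<bar>t - s\<bar>\<bar> \<le> B * \<bar>t - s\<bar> powr (- 2 * lam)"
          using elim by (intro decay) (auto simp: l_def)
        also have "\<dots> \<le> \<delta>" unfolding \<delta>_def
          using ts lD par by (intro mult_left_mono powr_mono2') auto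
        finally show ?thesis .
      qed
      have small: "n * (m + 1) * \<delta> / (1 / l ^ 3)\<^sup>2 * (l + \<eta>) \<le> \<eta>"
      proof -
        have "(l ^ D) powr (- 2 * lam) = l powr (- (2 * lam * D))"
          using l by (simp add: powr_realpow[symmetric] powr_powr mult_ac)
        also have "\<dots> \<le> l powr (- real (a + 10))" using D l by (intro powr_mono) auto
        also have "\<dots> = 1 / l ^ (a + 10)" using l by (simp only: powr_minus_divide powr_realpow)
        finally have "Q * (l ^ D) powr (- 2 * lam) \<le> Q * (1 / l ^ (a + 10))"
          using Q by (rule mult_left_mono)
        moreover have "\<delta> = Q * (l ^ D) powr (- 2 * lam)"
          unfolding \<delta>_def Q_def using par(3) lD by (subst powr_mult) auto
        ultimately have "\<delta> \<le> Q * (1 / l ^ (a + 10))" by simp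
        then have "n * (m + 1) * \<delta> \<le> n * (3 * l ^ a) * (Q * (1 / l ^ (a + 10)))"
          using nm \<delta>0 l by (intro mult_mono) auto
        also have "\<dots> = 3 * n * Q / l ^ 10" using l by (simp add: power_add)
        finally have "n * (m + 1) * \<delta> / (1 / l ^ 3)\<^sup>2 \<le> 3 * n * Q / l ^ 10 / (1 / l ^ 3)\<^sup>2"
          by (intro divide_right_mono) auto
        also have "\<dots> = 3 * n * Q / l ^ 4" using l by (simp add: field_simps flip: power_mult power_add)
        finally have "n * (m + 1) * \<delta> / (1 / l ^ 3)\<^sup>2 * (l + \<eta>) \<le> 3 * n * Q / l ^ 4 * (l + 1)"
          using \<eta> l Q by (intro mult_mono) auto
        also have "\<dots> \<le> \<eta>" using elim unfolding \<eta>_def l_def by simp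
        finally show ?thesis .
      qed
      define E where "E = 8 * n * m * exp (- K) + 4 * (n * (m + 1)) * exp (- l\<^sup>2 / 2)"
      have "prob (block_hit a0 i u \<inter> block_hit a0 j u')
         \<le> level_prob (u - 3 * \<eta>) * level_prob (u' - 2 * \<eta>) + 4 * E"
        unfolding block_hit_def E_def K_def chain_exponent_def
        by (rule far_blocks[where \<sigma>="1 / l ^ 3" and \<delta>=\<delta>])
           (use par a0 \<eta> m l \<delta>b \<delta>0 incr K small in \<open>auto simp: K_def chain_exponent_def \<eta>_def power2_eq_square power3_eq_cube\<close>)
      also have "level_prob (u - 3 * \<eta>) * level_prob (u' - 2 * \<eta>) \<le> (F * level_prob u + e) * (F * level_prob u' + e)"
        using reg[of u] order_trans[OF level_prob_antimono reg[of u'], of "u' - 2 * \<eta>"] \<eta>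
        by (intro mult_mono) (auto simp: F_def e_def)
      also have "\<dots> \<le> F\<^sup>2 * (level_prob u * level_prob u') + 5 * e"
      proof -
        have Fe: "0 \<le> F" "F \<le> 2" "0 \<le> e" "e \<le> 1" using elim by (auto simp: F_def e_def l_def)
        have "F * level_prob u * e \<le> 2 * 1 * e" "F * level_prob u' * e \<le> 2 * 1 * e" "e * e \<le> 1 * e"
          using Fe by (intro mult_mono mult_right_mono; simp)+
        then show ?thesis by (simp add: algebra_simps power2_eq_square)
      qed
      also have "F\<^sup>2 = exp (12 * N / l)" unfolding F_def by (simp flip: exp_double)
      also have "exp (12 * N / l) * (level_prob u * level_prob u') \<le> (1 + \<epsilon>) * (level_prob u * level_prob u')"
        using elim unfolding l_def by (intro mult_right_mono) auto
      also have "4 * E \<le> 144 * n * l ^ a * exp (- l\<^sup>2 / 2)"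
      proof -
        have "l\<^sup>2 / 2 \<le> K" using K(1) zero_le_power2[of l] by linarith
        then have "exp (- K) \<le> exp (- l\<^sup>2 / 2)" by simp
        moreover have "real m \<le> 3 * l ^ a" using m(2) by linarith
        ultimately have "real m * exp (- K) \<le> 3 * l ^ a * exp (- l\<^sup>2 / 2)" by (intro mult_mono) auto
        from mult_left_mono[OF this, of "8 * real n"]
        have f1: "8 * n * m * exp (- K) \<le> 24 * (n * l ^ a * exp (- l\<^sup>2 / 2))" by (simp add: mult_ac)
        have "real (4 * (n * (m + 1))) * exp (- l\<^sup>2 / 2) \<le> 4 * (n * (3 * l ^ a)) * exp (- l\<^sup>2 / 2)"
          using nm by (intro mult_right_mono) auto
        also have "\<dots> = 12 * (n * l ^ a * exp (- l\<^sup>2 / 2))" by simp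
        finally have "E \<le> 36 * (n * l ^ a * exp (- l\<^sup>2 / 2))" unfolding E_def using f1 by linarith
        then show ?thesis by simp
      qed
      also have "(1 + \<epsilon>) * (level_prob u * level_prob u') + 5 * e + 144 * n * l ^ a * exp (- l\<^sup>2 / 2)
         \<le> (1 + \<epsilon>) * (level_prob u * level_prob u') + exp (- 4 * l)"
        using elim unfolding e_def l_def by simp
      also have "exp (- 4 * l) = 1 / real j ^ 4"
      proof -
        have "exp (- 4 * l) = 1 / exp l ^ 4" by (simp add: exp_minus inverse_eq_divide flip: exp_of_nat_mult)
        then show ?thesis using elim by (simp add: l_def)
      qed
      finally show "prob (block_hit a0 i u \<inter> block_hit a0 j u') \<le> (1 + \<epsilon>) * level_prob u * level_prob u' + 1 / real j ^ 4"
        by (simp add: mult.assoc)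
    qed
  qed
qed

text \<open>
  A strictly larger quadratic exponent absorbs the bounded shifts of its argument.
\<close>

lemma quadratic_gap:
  fixes c d :: real
  assumes "d < c"
  shows "\<exists>C. \<forall>u. - (c * (u - 1)\<^sup>2) \<le> C - (c - d) / 2 * u\<^sup>2 - d * (u + 1)\<^sup>2"
proof (intro exI allI)
  fix u
  define q where "q = c - d"
  have q: "q > 0" using assms by (simp add: q_def)
  have "0 \<le> (q * u - 2 * (c + d))\<^sup>2 / (2 * q)" using q by simp
  also have "\<dots> = q / 2 * u\<^sup>2 - 2 * (c + d) * u + 2 * (c + d)\<^sup>2 / q"
    using q by (simp add: power2_eq_square field_simps)
  finally have "0 \<le> q / 2 * u\<^sup>2 - 2 * (c + d) * u + 2 * (c + d)\<^sup>2 / q" .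
  then have "0 \<le> (2 * (c + d)\<^sup>2 / q - q) + c * (u - 1)\<^sup>2 - q / 2 * u\<^sup>2 - d * (u + 1)\<^sup>2"
    unfolding q_def by (simp add: power2_eq_square algebra_simps add_divide_distrib diff_divide_distrib)
  then show "- (c * (u - 1)\<^sup>2) \<le> (2 * (c + d)\<^sup>2 / q - q) - (c - d) / 2 * u\<^sup>2 - d * (u + 1)\<^sup>2"
    unfolding q_def by linarith
qed

text \<open>
  For \<open>j - i < (ln j) ^ D\<close> the index \<open>i\<close> is comparable to \<open>j\<close>, so the lower bound on the level gives
  \<open>u\<^sup>2 \<ge> ln j / (4 * k)\<close>. The excess of the joint exponent over \<open>k / 2\<close> therefore yields a negative power of \<open>j\<close>
  relative to \<open>level_prob u\<close>, which outweighs the number of grid points and also \<open>(j - i)\<^sup>2\<close>.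
\<close>

lemma near_pairs:
  fixes a D :: nat and a0 :: real
  assumes a0: "a0 \<ge> 0" and a: "a * \<alpha> \<ge> 7"
  shows "\<forall>\<^sub>F j in sequentially. \<forall>i<j. real j - real i < ln (real j) ^ D \<longrightarrow>
    (\<forall>u u'. sqrt (ln (real i + 2) / (2 * k)) \<le> u \<longrightarrow> u \<le> u' \<longrightarrow>
    prob (block_hit a0 i u \<inter> block_hit a0 j u') \<le> level_prob u / (real j - real i)\<^sup>2 + 1 / real j ^ 4)"
proof -
  define c where "c = (k + (1 - \<kappa>))\<^sup>2 / (2 * (k + (1 - \<kappa>)\<^sup>2 + 2 * (1 - \<kappa>) * \<kappa>))"
  have c: "k / 2 < c" unfolding c_def using joint_exponent_gt par by simp
  then obtain C where C: "\<And>u. - (c * (u - 1)\<^sup>2) \<le> C - (c - k / 2) / 2 * u\<^sup>2 - k / 2 * (u + 1)\<^sup>2"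
    using quadratic_gap by blast
  define q where "q = (c - k / 2) / 2 / (4 * k)"
  define C1 where "C1 = exp C * sqrt (2 * pi) ^ k"
  have k0: "real k > 0" using k by simp
  have q: "q > 0" unfolding q_def using c k0 by simp
  have C1: "C1 \<ge> 0" by (simp add: C1_def)
  have ev1: "\<forall>\<^sub>F l::real in at_top. 9 * 2 ^ n * n * C1 * l ^ (2 * a + 2 * D) \<le> exp (q * l)"
  proof -
    have "\<forall>\<^sub>F l::real in at_top. 9 * 2 ^ n * n * C1 * l powr (2 * a + 2 * D) \<le> exp (q * l)"
      using q by real_asymp
    then show ?thesis
      using eventually_gt_at_top[of 0]
    proof eventually_elim
      case (elim l)
      then show ?case using powr_realpow[of l "2 * a + 2 * D"] by simp
    qed
  qed
  have ev2: "\<forall>\<^sub>F l::real in at_top. 48 * n * l ^ a * exp (- l\<^sup>2) \<le> exp (- 4 * l)"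
  proof -
    have "\<forall>\<^sub>F l::real in at_top. 48 * n * l powr a * exp (- l\<^sup>2) \<le> exp (- 4 * l)"
      by real_asymp
    then show ?thesis
      using eventually_gt_at_top[of 0] by eventually_elim (simp add: powr_realpow)
  qed
  have ev3: "\<forall>\<^sub>F l::real in at_top. l ^ D \<le> exp l / 2"
  proof -
    have "\<forall>\<^sub>F l::real in at_top. l powr D \<le> exp l / 2" by real_asymp
    then show ?thesis
      using eventually_gt_at_top[of 0] by eventually_elim (simp add: powr_realpow)
  qed
  have ev4: "\<forall>\<^sub>F l::real in at_top. l / 2 \<ge> ln 2 \<and> l / (4 * k) \<ge> 1"
    using k0 by (intro eventually_conj) real_asymp+
  have ln_lim: "filterlim (\<lambda>j. ln (real j)) at_top sequentially" by real_asymp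
  show ?thesis
    using eventually_compose_filterlim[OF ev1 ln_lim] eventually_compose_filterlim[OF ev2 ln_lim]
      eventually_compose_filterlim[OF ev3 ln_lim] eventually_compose_filterlim[OF ev4 ln_lim]
      eventually_compose_filterlim[OF chaining_scale[OF a] ln_lim]
      eventually_compose_filterlim[OF eventually_ge_at_top[of 1] ln_lim] eventually_gt_at_top[of 0]
  proof eventually_elim
    case (elim j)
    define l where "l = ln (real j)"
    define m where "m = grid_size a l"
    define \<eta> where "\<eta> = 1 / l\<^sup>2"
    define K where "K = chain_exponent m \<eta>"
    have l: "l \<ge> 1" using elim(6) unfolding l_def by simp
    have j: "exp l = real j" using elim(7) by (simp add: l_def)
    have m: "m > 0" "real m + 1 \<le> 3 * l ^ a" and K: "l\<^sup>2 \<le> K" "K * \<alpha> \<ge> 4"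
      using elim(5) unfolding m_def K_def \<eta>_def l_def by auto
    have \<eta>: "\<eta> > 0" "\<eta> \<le> 1" using l by (auto simp: \<eta>_def divide_le_eq one_le_power)
    show ?case
    proof (intro allI impI)
      fix i u u'
      assume i: "i < j" and near: "real j - real i < ln (real j) ^ D"
        and u: "sqrt (ln (real i + 2) / (2 * k)) \<le> u" "u \<le> u'"
      have "real j - real i < real j / 2" using near elim(3) j unfolding l_def by linarith
      then have "real j / 2 \<le> real i + 2" by linarith
      then have "ln (real j / 2) \<le> ln (real i + 2)" using elim(7) by (subst ln_le_cancel_iff) auto
      moreover have "ln (real j / 2) = l - ln 2" using elim(7) by (simp add: ln_div l_def)
      ultimately have li: "l / 2 \<le> ln (real i + 2)" using elim(4) unfolding l_def by linarith
      have "l / (4 * k) \<le> ln (real i + 2) / (2 * k)"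
        using divide_right_mono[OF li, of "2 * k"] by simp
      also have "\<dots> = (sqrt (ln (real i + 2) / (2 * k)))\<^sup>2" by simp
      also have "\<dots> \<le> u\<^sup>2" using u(1) by (intro power_mono) auto
      finally have u2: "l / (4 * k) \<le> u\<^sup>2" .
      have u0: "u \<ge> 0" using u(1) by (rule order_trans[rotated]) simp
      have "1 \<le> u\<^sup>2" using u2 elim(4) unfolding l_def by linarith
      then have u1: "u \<ge> 1" using u0 power_le_one[of u 2] by (metis linorder_le_cases order_antisym power_one real_sqrt_ge_one real_sqrt_unique)
      let ?p = "level_prob u"
      have "prob (block_hit a0 i u \<inter> block_hit a0 j u') \<le> prob (block_hit a0 i u \<inter> block_hit a0 j u)"
        using hit_antimono[OF u(2)] a0
        by (intro finite_measure_mono sets.Int block_hit_sets Int_mono) (auto simp: block_hit_def)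
      also have "\<dots> \<le> real ((m + 1)\<^sup>2 * 2 ^ n * n) * exp (- (c * (u - \<eta>)\<^sup>2)) + 2 * (8 * n * m * exp (- K))"
      proof -
        have gap: "a0 + 2 * b * real i + 2 * b \<le> a0 + 2 * b * real j"
        proof -
          have "2 * b * (real i + 1) \<le> 2 * b * real j" using i par(3) by (intro mult_left_mono) auto
          then show ?thesis by (simp add: algebra_simps)
        qed
        have "0 \<le> a0 + 2 * b * real i" using a0 par(3) by simp
        from near_blocks[OF par(1-3) \<eta>(1) m(1) this gap incr sep par(4,5) K(2)[unfolded K_def chain_exponent_def], of u]
        show ?thesis using u1 \<eta> unfolding block_hit_def c_def K_def chain_exponent_def by simp
      qed
      also have "real ((m + 1)\<^sup>2 * 2 ^ n * n) * exp (- (c * (u - \<eta>)\<^sup>2)) \<le> ?p / (real j - real i)\<^sup>2"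
      proof -
        have "(u - 1)\<^sup>2 \<le> (u - \<eta>)\<^sup>2" using u1 \<eta> by (intro power_mono) auto
        then have "c * (u - 1)\<^sup>2 \<le> c * (u - \<eta>)\<^sup>2" using c k0 by (intro mult_left_mono) auto
        then have "exp (- (c * (u - \<eta>)\<^sup>2)) \<le> exp (C + (- ((c - k / 2) / 2 * u\<^sup>2)) + (- (k / 2 * (u + 1)\<^sup>2)))"
          using C[of u] by simp
        also have "\<dots> = exp C * exp (- ((c - k / 2) / 2 * u\<^sup>2)) * exp (- (k / 2 * (u + 1)\<^sup>2))"
          by (simp only: exp_add)
        also have "exp (- (k / 2 * (u + 1)\<^sup>2)) = sqrt (2 * pi) ^ k * std_normal_density (u + 1) ^ k"
          by (simp add: std_normal_density_def power_mult_distrib[symmetric] exp_of_nat_mult[symmetric])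
        also have "exp (- ((c - k / 2) / 2 * u\<^sup>2)) \<le> exp (- (q * l))"
        proof -
          have "q * l = (c - k / 2) / 2 * (l / (4 * k))" by (simp add: q_def)
          also have "\<dots> \<le> (c - k / 2) / 2 * u\<^sup>2" using u2 c by (intro mult_left_mono) auto
          finally show ?thesis by simp
        qed
        also have "std_normal_density (u + 1) ^ k \<le> ?p" using u0 by (rule level_prob_lower)
        finally have "exp (- (c * (u - \<eta>)\<^sup>2)) \<le> exp C * exp (- (q * l)) * (sqrt (2 * pi) ^ k * ?p)"
          by (simp add: mult_left_mono mult_right_mono)
        then have e1: "exp (- (c * (u - \<eta>)\<^sup>2)) \<le> C1 * exp (- (q * l)) * ?p" by (simp add: C1_def mult_ac)
        have "real ((m + 1)\<^sup>2 * 2 ^ n * n) = (real m + 1)\<^sup>2 * (2 ^ n * n)" by simp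
        also have "\<dots> \<le> (3 * l ^ a)\<^sup>2 * (2 ^ n * n)"
          using m(2) by (intro mult_right_mono power_mono) auto
        also have "\<dots> = 9 * 2 ^ n * n * l ^ (2 * a)" by (simp add: power_mult_distrib power_mult[symmetric] mult.commute)
        finally have "real ((m + 1)\<^sup>2 * 2 ^ n * n) * exp (- (c * (u - \<eta>)\<^sup>2))
            \<le> 9 * 2 ^ n * n * l ^ (2 * a) * (C1 * exp (- (q * l)) * ?p)"
          using e1 l by (intro mult_mono) auto
        also have "\<dots> \<le> ?p / l ^ (2 * D)"
        proof -
          have "9 * 2 ^ n * n * C1 * l ^ (2 * a) * l ^ (2 * D) \<le> exp (q * l)"
            using elim(1) unfolding l_def by (simp add: power_add mult.assoc)
          then have "9 * 2 ^ n * n * C1 * l ^ (2 * a) * l ^ (2 * D) * exp (- (q * l)) \<le> exp (q * l) * exp (- (q * l))"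
            by (rule mult_right_mono) simp
          also have "exp (q * l) * exp (- (q * l)) = 1" by (simp flip: exp_add)
          finally have "9 * 2 ^ n * n * C1 * l ^ (2 * a) * exp (- (q * l)) \<le> 1 / l ^ (2 * D)"
            using l by (simp add: pos_le_divide_eq mult_ac)
          then have "9 * 2 ^ n * n * C1 * l ^ (2 * a) * exp (- (q * l)) * ?p \<le> 1 / l ^ (2 * D) * ?p"
            by (rule mult_right_mono) simp
          then show ?thesis by (simp add: mult_ac)
        qed
        also have "\<dots> \<le> ?p / (real j - real i)\<^sup>2"
        proof (rule divide_left_mono)
          have "(real j - real i)\<^sup>2 \<le> (l ^ D)\<^sup>2" using near i unfolding l_def by (intro power_mono) auto
          then show "(real j - real i)\<^sup>2 \<le> l ^ (2 * D)" by (simp add: power_mult[symmetric] mult.commute)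
          show "0 < l ^ (2 * D) * (real j - real i)\<^sup>2" using l i by simp
        qed simp
        finally show ?thesis .
      qed
      also have "2 * (8 * n * m * exp (- K)) \<le> 1 / real j ^ 4"
      proof -
        have "real m \<le> 3 * l ^ a" using m(2) by linarith
        moreover have "exp (- K) \<le> exp (- l\<^sup>2)" using K(1) by simp
        ultimately have "real m * exp (- K) \<le> 3 * l ^ a * exp (- l\<^sup>2)" by (intro mult_mono) auto
        from mult_left_mono[OF this, of "16 * real n"]
        have "2 * (8 * n * m * exp (- K)) \<le> 48 * n * l ^ a * exp (- l\<^sup>2)" by (simp add: mult_ac)
        also have "\<dots> \<le> exp (- 4 * l)" using elim(2) unfolding l_def .
        also have "\<dots> = 1 / exp l ^ 4" by (simp add: exp_minus inverse_eq_divide flip: exp_of_nat_mult)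
        finally show ?thesis unfolding j .
      qed
      finally show "prob (block_hit a0 i u \<inter> block_hit a0 j u') \<le> ?p / (real j - real i)\<^sup>2 + 1 / real j ^ 4"
        by simp
    qed
  qed
qed

text \<open>
  The floor for the levels is chosen so low that the corresponding probabilities are at least of order
  \<open>1 / sqrt i\<close>, as \<open>min_series_diverges\<close> requires.
\<close>

lemma floor_level_lower:
  "level_prob (sqrt (ln (real i + 2) / (2 * k))) \<ge> (exp (- real k) / sqrt (2 * pi) ^ k / sqrt 2) / sqrt (Suc i)"
proof -
  define g where "g = sqrt (ln (real i + 2) / (2 * k))"
  have k0: "real k > 0" using k by simp
  have g0: "g \<ge> 0" by (simp add: g_def)
  have g2: "g\<^sup>2 = ln (real i + 2) / (2 * k)" by (simp add: g_def)
  have "(g + 1)\<^sup>2 \<le> 2 * g\<^sup>2 + 2"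
    using zero_le_power2[of "g - 1"] by (simp add: power2_eq_square algebra_simps)
  then have "k / 2 * (g + 1)\<^sup>2 \<le> k / 2 * (2 * g\<^sup>2 + 2)" by (rule mult_left_mono) simp
  also have "\<dots> = ln (real i + 2) / 2 + k" using k0 by (simp add: g2 field_simps)
  finally have "exp (- real k + - (ln (real i + 2) / 2)) \<le> exp (- (k / 2 * (g + 1)\<^sup>2))" by simp
  moreover have "exp (- (ln (real i + 2) / 2)) = 1 / sqrt (real i + 2)"
    by (simp add: exp_minus inverse_eq_divide ln_sqrt[symmetric])
  ultimately have "exp (- real k) * (1 / sqrt (real i + 2)) \<le> exp (- (k / 2 * (g + 1)\<^sup>2))"
    by (simp only: exp_add)
  moreover have "sqrt (real i + 2) \<le> sqrt 2 * sqrt (Suc i)" by (simp flip: real_sqrt_mult)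
  then have "1 / (sqrt 2 * sqrt (Suc i)) \<le> 1 / sqrt (real i + 2)" by (intro divide_left_mono) auto
  then have "exp (- real k) * (1 / (sqrt 2 * sqrt (Suc i))) \<le> exp (- real k) * (1 / sqrt (real i + 2))"
    by (rule mult_left_mono) simp
  ultimately have "exp (- real k) * (1 / (sqrt 2 * sqrt (Suc i))) \<le> exp (- (k / 2 * (g + 1)\<^sup>2))" by linarith
  then have "exp (- real k) * (1 / (sqrt 2 * sqrt (Suc i))) / sqrt (2 * pi) ^ k \<le> exp (- (k / 2 * (g + 1)\<^sup>2)) / sqrt (2 * pi) ^ k"
    by (rule divide_right_mono) simp
  also have "\<dots> = std_normal_density (g + 1) ^ k"
    by (simp add: std_normal_density_def power_mult_distrib power_divide exp_of_nat_mult[symmetric])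
  also have "\<dots> \<le> level_prob g" using g0 by (rule level_prob_lower)
  finally show ?thesis unfolding g_def by (simp add: mult_ac)
qed

text \<open>
  Raising the levels to the floor required by \<open>near_pairs\<close> replaces the probabilities by their minima with
  those of the floor levels. The series still diverges, and exceedances of the raised levels are exceedances of
  the original ones.
\<close>

theorem block_hits_infinitely_often:
  assumes a0: "a0 \<ge> 0" and v: "mono v" and div: "\<not> summable (\<lambda>i. level_prob (v i))"
  shows "AE w in M. \<exists>\<^sub>\<infinity>i. w \<in> block_hit a0 i (v i)"
proof -
  define g where "g i = sqrt (ln (real i + 2) / (2 * k))" for i :: nat
  define u where "u i = max (v i) (g i)" for i
  have k0: "real k > 0" using k by simp
  have gmono: "mono g" unfolding g_def using k0 by (intro monoI real_sqrt_le_mono divide_right_mono) auto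
  have umono: "u i \<le> u j" if "i \<le> j" for i j
    using monoD[OF v that] monoD[OF gmono that] unfolding u_def by auto
  have pu: "level_prob (u i) = min (level_prob (v i)) (level_prob (g i))" for i
    unfolding u_def using level_prob_antimono[of "v i" "g i"] level_prob_antimono[of "g i" "v i"]
    by (auto simp: max_def min_def)
  obtain a :: nat where "7 / \<alpha> < a" using reals_Archimedean2 by blast
  then have a: "a * \<alpha> \<ge> 7" using par by (simp add: field_simps)
  obtain D :: nat where "(a + 10) / (2 * lam) < D" using reals_Archimedean2 by blast
  then have D: "2 * lam * D \<ge> a + 10" using par by (simp add: field_simps)
  have "AE w in M. \<exists>\<^sub>\<infinity>i. w \<in> block_hit a0 i (u i)"
  proof (rule second_moment_infinitely_often)
    show "block_hit a0 i (u i) \<in> events" for i using a0 by (rule block_hit_sets)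
    show "\<not> summable (\<lambda>i. prob (block_hit a0 i (u i)))"
      unfolding prob_block_hit[OF a0] pu
    proof (rule min_series_diverges[OF _ _ div])
      show "antimono (\<lambda>i. level_prob (v i))" "antimono (\<lambda>i. level_prob (g i))"
        using v gmono by (auto intro!: antimonoI level_prob_antimono dest: monoD)
      show "0 < exp (- real k) / sqrt (2 * pi) ^ k / sqrt 2" by simp
      show "(exp (- real k) / sqrt (2 * pi) ^ k / sqrt 2) / sqrt (real (Suc i)) \<le> level_prob (g i)" for i
        unfolding g_def by (rule floor_level_lower)
    qed simp
    fix \<epsilon> :: real assume \<epsilon>: "\<epsilon> > 0"
    have "\<forall>\<^sub>F j in sequentially. \<forall>i<j. i > 0 \<longrightarrow>
       prob (block_hit a0 i (u i) \<inter> block_hit a0 j (u j)) \<le> (1 + \<epsilon>) * level_prob (u i) * level_prob (u j)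
         + level_prob (u i) / (real j - real i)\<^sup>2 + 1 / ((real i)\<^sup>2 * (real j)\<^sup>2)"
      using far_pairs[OF a0 \<epsilon> a D] near_pairs[OF a0 a, of D]
    proof eventually_elim
      case (elim j)
      show ?case
      proof (intro allI impI)
        fix i assume i: "i < j" "0 < i"
        have "(real i)\<^sup>2 * (real j)\<^sup>2 \<le> (real j)\<^sup>2 * (real j)\<^sup>2"
          using i by (intro mult_right_mono power_mono) auto
        then have "1 / real j ^ 4 \<le> 1 / ((real i)\<^sup>2 * (real j)\<^sup>2)"
          using i by (intro divide_left_mono) (auto simp: power4_eq_xxxx power2_eq_square mult.assoc)
        moreover have "0 \<le> (1 + \<epsilon>) * level_prob (u i) * level_prob (u j)" using \<epsilon> by simp
        moreover have "0 \<le> level_prob (u i) / (real j - real i)\<^sup>2" by simp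
        moreover consider "ln (real j) ^ D \<le> real j - real i" | "real j - real i < ln (real j) ^ D" by linarith
        then have "prob (block_hit a0 i (u i) \<inter> block_hit a0 j (u j)) \<le> (1 + \<epsilon>) * level_prob (u i) * level_prob (u j) + 1 / real j ^ 4
          \<or> prob (block_hit a0 i (u i) \<inter> block_hit a0 j (u j)) \<le> level_prob (u i) / (real j - real i)\<^sup>2 + 1 / real j ^ 4"
        proof cases
          case 1
          then show ?thesis using elim(1)[rule_format, OF i(1)] by blast
        next
          case 2
          have "sqrt (ln (real i + 2) / (2 * k)) \<le> u i" by (simp add: u_def g_def)
          then show ?thesis using elim(2)[rule_format, OF i(1) 2 _ umono] i(1) by (meson less_imp_le)
        qed
        ultimately show "prob (block_hit a0 i (u i) \<inter> block_hit a0 j (u j)) \<le> (1 + \<epsilon>) * level_prob (u i) * level_prob (u j)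
         + level_prob (u i) / (real j - real i)\<^sup>2 + 1 / ((real i)\<^sup>2 * (real j)\<^sup>2)" by linarith
      qed
    qed
    then obtain N where N: "\<And>j i. N \<le> j \<Longrightarrow> i < j \<Longrightarrow> i > 0 \<Longrightarrow>
       prob (block_hit a0 i (u i) \<inter> block_hit a0 j (u j)) \<le> (1 + \<epsilon>) * level_prob (u i) * level_prob (u j)
         + level_prob (u i) / (real j - real i)\<^sup>2 + 1 / ((real i)\<^sup>2 * (real j)\<^sup>2)"
      unfolding eventually_sequentially by blast
    show "\<exists>N. \<forall>i j. N \<le> i \<longrightarrow> i < j \<longrightarrow>
       prob (block_hit a0 i (u i) \<inter> block_hit a0 j (u j))
        \<le> (1 + \<epsilon>) * prob (block_hit a0 i (u i)) * prob (block_hit a0 j (u j))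
         + prob (block_hit a0 i (u i)) / (real j - real i)\<^sup>2 + 1 / ((real i)\<^sup>2 * (real j)\<^sup>2)"
      unfolding prob_block_hit[OF a0]
      by (intro exI[of _ "Suc N"] allI impI N) auto
  qed
  then show ?thesis
  proof eventually_elim
    case (elim w)
    have "block_hit a0 i (u i) \<subseteq> block_hit a0 i (v i)" for i
      unfolding block_hit_def by (rule hit_antimono) (simp add: u_def)
    with elim show ?case by (blast intro: INFM_mono)
  qed
qed

end

section \<open>Integrals and series of monotone functions\<close>

lemma antimono_integral_series:
  fixes g :: "real \<Rightarrow> real"
  assumes g: "\<And>u. T \<le> u \<Longrightarrow> 0 \<le> g u" "\<And>u v. T \<le> u \<Longrightarrow> u \<le> v \<Longrightarrow> g v \<le> g u" and h: "h > 0"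
  shows "(\<integral>\<^sup>+u\<in>{T..}. ennreal (g u) \<partial>lborel) < \<infinity> \<longleftrightarrow> summable (\<lambda>i::nat. g (T + i * h))"
proof -
  define I where "I i = {T + real i * h..<T + real (Suc i) * h}" for i
  have mI: "emeasure lborel (I i) = ennreal h" for i
    using h by (simp add: I_def algebra_simps)
  have bI: "I i \<in> sets borel" for i by (simp add: I_def)
  define index where "index u = nat \<lfloor>(u - T) / h\<rfloor>" for u
  have ix: "u \<in> I i \<longleftrightarrow> i = index u" if u: "T \<le> u" for u i
  proof -
    have "(u - T) / h \<ge> 0" using u h by simp
    then have "i = index u \<longleftrightarrow> real i \<le> (u - T) / h \<and> (u - T) / h < real i + 1"
      unfolding index_def by linarith
    also have "\<dots> \<longleftrightarrow> real i * h \<le> u - T \<and> u - T < (real i + 1) * h"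
      using h by (simp add: pos_le_divide_eq pos_divide_less_eq)
    finally show ?thesis by (auto simp: I_def algebra_simps)
  qed
  have below: "u \<notin> I i" if "u < T" for u i
  proof -
    have "T \<le> T + real i * h" using h by simp
    with that show ?thesis by (auto simp: I_def)
  qed
  have step: "(\<Sum>i. ennreal (c i) * indicator (I i) u) = ennreal (c (index u)) * indicator {T..} u" for c :: "nat \<Rightarrow> real" and u
  proof (cases "T \<le> u")
    case True
    have "(\<Sum>i. ennreal (c i) * indicator (I i) u) = (\<Sum>i\<in>{index u}. ennreal (c i) * indicator (I i) u)"
      using ix[OF True] by (intro suminf_finite) auto
    then show ?thesis using ix[OF True] True by simp
  next
    case False
    then have "u \<notin> I i" for i using below by simp
    then show ?thesis using False by simp
  qed
  have int: "(\<integral>\<^sup>+u. ennreal (c (index u)) * indicator {T..} u \<partial>lborel) = ennreal h * (\<Sum>i. ennreal (c i))" for c :: "nat \<Rightarrow> real"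
  proof -
    have "(\<integral>\<^sup>+u. ennreal (c (index u)) * indicator {T..} u \<partial>lborel) = (\<Sum>i. \<integral>\<^sup>+u. ennreal (c i) * indicator (I i) u \<partial>lborel)"
      unfolding step[symmetric] using bI by (intro nn_integral_suminf) auto
    also have "\<dots> = (\<Sum>i. ennreal h * ennreal (c i))"
      using bI mI by (simp add: nn_integral_cmult_indicator mult.commute)
    finally show ?thesis by simp
  qed
  have up: "(\<integral>\<^sup>+u\<in>{T..}. ennreal (g u) \<partial>lborel) \<le> ennreal h * (\<Sum>i. ennreal (g (T + real i * h)))"
    unfolding int[symmetric]
  proof (intro nn_integral_mono)
    fix u
    show "ennreal (g u) * indicator {T..} u \<le> ennreal (g (T + real (index u) * h)) * indicator {T..} u"
    proof (cases "T \<le> u")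
      case True
      then have "u \<in> I (index u)" using ix by simp
      then have "g u \<le> g (T + real (index u) * h)" using h by (intro g) (auto simp: I_def)
      then show ?thesis by (intro mult_right_mono ennreal_leI) auto
    qed simp
  qed
  have low: "ennreal h * (\<Sum>i. ennreal (g (T + real (Suc i) * h))) \<le> (\<integral>\<^sup>+u\<in>{T..}. ennreal (g u) \<partial>lborel)"
    unfolding int[symmetric]
  proof (intro nn_integral_mono)
    fix u
    show "ennreal (g (T + real (Suc (index u)) * h)) * indicator {T..} u \<le> ennreal (g u) * indicator {T..} u"
    proof (cases "T \<le> u")
      case True
      then have "u \<in> I (index u)" using ix by simp
      then have "g (T + real (Suc (index u)) * h) \<le> g u" using True by (intro g) (auto simp: I_def)
      then show ?thesis by (intro mult_right_mono ennreal_leI) auto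
    qed simp
  qed
  have nn: "0 \<le> g (T + real i * h)" for i using h by (intro g) simp
  have nn': "0 \<le> g (T + real (Suc i) * h)" for i using h by (intro g) simp
  show ?thesis
  proof
    assume "(\<integral>\<^sup>+u\<in>{T..}. ennreal (g u) \<partial>lborel) < \<infinity>"
    with low have "ennreal h * (\<Sum>i. ennreal (g (T + real (Suc i) * h))) < \<infinity>" by (rule le_less_trans)
    then have "(\<Sum>i. ennreal (g (T + real (Suc i) * h))) \<noteq> \<infinity>"
      using h by (auto simp: ennreal_mult_top)
    then have "summable (\<lambda>i. g (T + real (Suc i) * h))"
      using nn' by (intro summable_suminf_not_top) auto
    then show "summable (\<lambda>i. g (T + real i * h))"
      using summable_Suc_iff[of "\<lambda>i. g (T + real i * h)"] by simp
  next
    assume "summable (\<lambda>i. g (T + real i * h))"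
    then have "(\<Sum>i. ennreal (g (T + real i * h))) = ennreal (\<Sum>i. g (T + real i * h))"
      using nn by (intro suminf_ennreal_eq summable_sums) auto
    then have "ennreal h * (\<Sum>i. ennreal (g (T + real i * h))) < \<infinity>"
      by (simp add: ennreal_mult_less_top)
    with up show "(\<integral>\<^sup>+u\<in>{T..}. ennreal (g u) \<partial>lborel) < \<infinity>" by (rule le_less_trans)
  qed
qed

lemma not_bdd_above_Collect_iff: "\<not> bdd_above {t. P t} \<longleftrightarrow> (\<forall>c::real. \<exists>t. P t \<and> c < t)"
  unfolding bdd_above_def by (auto simp: not_le)

context gaussian_copies
begin

definition io_event :: "real \<Rightarrow> (real \<Rightarrow> real) \<Rightarrow> 'b set" where
  "io_event T f = {w\<in>space M. \<not> bdd_above {t. T \<le> t \<and> rank_exceeds n k (\<lambda>j. Z j t w) (f t)}}"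

lemma io_event_iff:
  "w \<in> io_event T f \<longleftrightarrow> w \<in> space M \<and> (\<forall>c. \<exists>t. (T \<le> t \<and> rank_exceeds n k (\<lambda>j. Z j t w) (f t)) \<and> c < t)"
  unfolding io_event_def not_bdd_above_Collect_iff by simp

text \<open>
  Since \<open>f\<close> is nondecreasing, an exceedance at \<open>t\<close> persists slightly to the left of \<open>t\<close>; so rational times
  suffice.
\<close>

lemma io_event_sets:
  assumes T: "T \<ge> 0" and f: "mono_on {T..} f"
  shows "io_event T f \<in> sets M"
proof -
  define D where "D m = \<rat> \<inter> {max T (real m)..}" for m :: nat
  have "io_event T f = (\<Inter>m. {w\<in>space M. \<exists>q\<in>D m. rank_exceeds n k (\<lambda>j. Z j q w) (f q)})"
  proof (intro set_eqI iffI)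
    fix w assume w: "w \<in> io_event T f"
    then have ws: "w \<in> space M" by (simp add: io_event_def)
    have "\<exists>q\<in>D m. rank_exceeds n k (\<lambda>j. Z j q w) (f q)" for m
    proof -
      from w obtain t where t: "T \<le> t" "rank_exceeds n k (\<lambda>j. Z j t w) (f t)" "max T (real m) < t"
        unfolding io_event_iff by blast
      obtain d where d: "d > 0" "\<And>s. s \<ge> 0 \<Longrightarrow> \<bar>s - t\<bar> < d \<Longrightarrow> rank_exceeds n k (\<lambda>j. Z j s w) (f t)"
        using open_rank_exceeds[of n "{0..}" "\<lambda>j t. Z j t w" t k "f t"] cont ws t T by auto
      obtain q where q: "q \<in> \<rat>" "max (max T (real m)) (t - d) < q" "q < t"
        using Rats_dense_in_real[of "max (max T (real m)) (t - d)" t] d(1) t(3) by auto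
      have "rank_exceeds n k (\<lambda>j. Z j q w) (f t)" using q T by (intro d(2)) auto
      moreover have "f q \<le> f t" using q t by (intro mono_onD[OF f]) auto
      ultimately have "rank_exceeds n k (\<lambda>j. Z j q w) (f q)"
        by (elim rank_exceeds_mono) linarith
      then show ?thesis using q by (auto simp: D_def)
    qed
    with ws show "w \<in> (\<Inter>m. {w\<in>space M. \<exists>q\<in>D m. rank_exceeds n k (\<lambda>j. Z j q w) (f q)})" by auto
  next
    fix w assume w: "w \<in> (\<Inter>m. {w\<in>space M. \<exists>q\<in>D m. rank_exceeds n k (\<lambda>j. Z j q w) (f q)})"
    have "\<exists>t. (T \<le> t \<and> rank_exceeds n k (\<lambda>j. Z j t w) (f t)) \<and> c < t" for c
    proof -
      obtain m :: nat where "c < real m" using reals_Archimedean2 by blast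
      moreover from w obtain q where "q \<in> D m" "rank_exceeds n k (\<lambda>j. Z j q w) (f q)" by auto
      ultimately show ?thesis by (intro exI[of _ q]) (auto simp: D_def)
    qed
    then show "w \<in> io_event T f"
      using w unfolding io_event_iff by simp
  qed
  also have "\<dots> \<in> sets M"
  proof -
    have "{w\<in>space M. \<exists>q\<in>D m. rank_exceeds n k (\<lambda>j. Z j q w) (f q)} \<in> sets M" for m
    proof (rule countable_rank_exceeds_measurable)
      show "countable (D m)" unfolding D_def by (rule countable_Rats_Int)
      show "Z j q \<in> borel_measurable M" if "q \<in> D m" "j \<in> {1..n}" for q j
        using that T by (intro Z_measurable) (auto simp: D_def)
    qed
    then show ?thesis by (intro sets.countable_INT') auto
  qed
  finally show ?thesis .
qed

lemma io_event_null:
  fixes T :: real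
  assumes T: "T \<ge> 0" and f: "mono_on {T..} f" and sm: "summable (\<lambda>i::nat. prob (hit 0 1 (f (T + i))))"
  shows "prob (io_event T f) = 0"
proof -
  have "AE w in M. \<forall>\<^sub>F i in sequentially. w \<in> space M - hit (T + real i) (T + real i + 1) (f (T + real i))"
  proof (rule borel_cantelli_AE1)
    show "hit (T + real i) (T + real i + 1) (f (T + real i)) \<in> events" for i
      using T by (intro hit_sets) auto
    have "prob (hit (T + real i) (T + real i + 1) (f (T + real i))) = prob (hit 0 1 (f (T + real i)))" for i
      using T by (intro hit_stationary) auto
    then show "summable (\<lambda>i. prob (hit (T + real i) (T + real i + 1) (f (T + real i))))" using sm by simp
  qed (simp add: less_top[symmetric])
  then have "AE w in M. w \<notin> io_event T f"
  proof eventually_elim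
    case (elim w)
    then obtain i0 where i0: "\<And>i. i \<ge> i0 \<Longrightarrow> w \<notin> hit (T + real i) (T + real i + 1) (f (T + real i))"
      unfolding eventually_sequentially by blast
    show ?case
    proof
      assume w: "w \<in> io_event T f"
      then obtain t where t: "T \<le> t" "rank_exceeds n k (\<lambda>j. Z j t w) (f t)" "T + real i0 < t"
        unfolding io_event_iff by blast
      define i where "i = nat \<lfloor>t - T\<rfloor>"
      have i: "real i \<le> t - T" "t - T \<le> real i + 1" "i0 \<le> i" using t unfolding i_def by linarith+
      have "f (T + real i) \<le> f t" using i by (intro mono_onD[OF f]) auto
      then have "rank_exceeds n k (\<lambda>j. Z j t w) (f (T + real i))"
        using t(2) by (elim rank_exceeds_mono) linarith
      then have "w \<in> hit (T + real i) (T + real i + 1) (f (T + real i))"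
        using w i by (auto simp: hit_def io_event_def intro!: bexI[of _ t])
      with i0[OF i(3)] show False by simp
    qed
  qed
  then show ?thesis using io_event_sets[OF T f] by (simp add: prob_eq_0)
qed

lemma unit_hit_le:
  assumes b: "b > 0"
  shows "prob (hit 0 1 u) \<le> real (nat \<lceil>1 / b\<rceil>) * prob (hit 0 b u)"
proof -
  define m where "m = nat \<lceil>1 / b\<rceil>"
  have "hit 0 1 u \<subseteq> (\<Union>i\<in>{..<m}. hit (real i * b) (real i * b + b) u)"
  proof
    fix w assume "w \<in> hit 0 1 u"
    then obtain t where w: "w \<in> space M" and t: "0 \<le> t" "t \<le> 1" "rank_exceeds n k (\<lambda>j. Z j t w) u"
      by (auto simp: hit_def)
    define i where "i = min (nat \<lfloor>t / b\<rfloor>) (m - 1)"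
    have "0 \<le> t / b" "t / b \<le> 1 / b" "0 < 1 / b" using t b by (auto simp: divide_right_mono)
    then have "i < m" "real i \<le> t / b" "t / b \<le> real i + 1" unfolding i_def m_def by linarith+
    then have "i < m" "real i * b \<le> t" "t \<le> real i * b + b" using b by (auto simp: field_simps)
    then show "w \<in> (\<Union>i\<in>{..<m}. hit (real i * b) (real i * b + b) u)"
      using w t(3) by (auto simp: hit_def intro!: bexI[of _ i] bexI[of _ t])
  qed
  moreover have s: "hit (real i * b) (real i * b + b) u \<in> sets M" for i using b by (intro hit_sets) auto
  ultimately have "prob (hit 0 1 u) \<le> prob (\<Union>i\<in>{..<m}. hit (real i * b) (real i * b + b) u)"
    by (intro finite_measure_mono) auto
  also have "\<dots> \<le> (\<Sum>i\<in>{..<m}. prob (hit (real i * b) (real i * b + b) u))"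
    using s by (intro measure_UNION_le) auto
  also have "\<dots> = (\<Sum>i\<in>{..<m}. prob (hit 0 b u))"
    using b by (intro sum.cong refl hit_stationary) auto
  finally show ?thesis by (simp add: m_def)
qed

end

context mixing_gaussian_copies
begin

text \<open>
  The level on a block is the value of \<open>f\<close> at the start of the next block, an upper bound for \<open>f\<close> on the block
  itself.
\<close>

lemma io_event_full:
  assumes T: "T \<ge> 0" and f: "mono_on {T..} f" and ns: "\<not> summable (\<lambda>i::nat. prob (hit 0 1 (f (T + i * (2 * b)))))"
  shows "prob (io_event T f) = 1"
proof -
  define v where "v i = f (T + real (Suc i) * (2 * b))" for i
  have v: "mono v"
    unfolding v_def using par(3) by (intro monoI mono_onD[OF f]) (auto intro!: mult_right_mono)
  have "\<not> summable (\<lambda>i. level_prob (f (T + real i * (2 * b))))"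
  proof
    assume "summable (\<lambda>i. level_prob (f (T + real i * (2 * b))))"
    then have "summable (\<lambda>i. real (nat \<lceil>1 / b\<rceil>) * level_prob (f (T + real i * (2 * b))))"
      by (rule summable_mult)
    then have "summable (\<lambda>i. prob (hit 0 1 (f (T + real i * (2 * b)))))"
      by (rule summable_comparison_test'[where N=0]) (use unit_hit_le[OF par(3)] in simp)
    with ns show False by simp
  qed
  then have "\<not> summable (\<lambda>i. level_prob (v i))"
    unfolding v_def using summable_Suc_iff[of "\<lambda>i. level_prob (f (T + real i * (2 * b)))"] by simp
  from block_hits_infinitely_often[OF T v this]
  have "AE w in M. w \<in> io_event T f"
  proof (rule AE_mp, intro AE_I2 impI)
    fix w assume ws: "w \<in> space M" and io: "\<exists>\<^sub>\<infinity>i. w \<in> block_hit T i (v i)"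
    have "\<exists>t. (T \<le> t \<and> rank_exceeds n k (\<lambda>j. Z j t w) (f t)) \<and> c < t" for c
    proof -
      obtain i0 :: nat where "(c - T) / (2 * b) < real i0" using reals_Archimedean2 by blast
      then have i0: "c < T + 2 * b * real i0" using par(3) by (simp add: field_simps)
      from io obtain i where i: "i \<ge> i0" "w \<in> block_hit T i (v i)" unfolding INFM_nat_le by blast
      then obtain t where t: "T + 2 * b * real i \<le> t" "t \<le> T + 2 * b * real i + b" "rank_exceeds n k (\<lambda>j. Z j t w) (v i)"
        unfolding block_hit_def hit_def by auto
      have "2 * b * real i0 \<le> 2 * b * real i" "0 \<le> 2 * b * real i" using i(1) par(3) by (auto intro!: mult_left_mono)
      then have ct: "c < t" "T \<le> t" using i0 t by linarith+
      have "f t \<le> v i" unfolding v_def using ct t par(3) by (intro mono_onD[OF f]) (auto simp: algebra_simps)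
      then have "rank_exceeds n k (\<lambda>j. Z j t w) (f t)" using t(3) by (elim rank_exceeds_mono) linarith
      then show ?thesis using ct by blast
    qed
    then show "w \<in> io_event T f"
      using ws unfolding io_event_iff by simp
  qed
  then show ?thesis using io_event_sets[OF T f] by (simp add: prob_eq_1)
qed

end

section \<open>From the processes to their continuous modifications\<close>

lemma completion_eq_outside_null:
  assumes "A \<subseteq> space M" "E \<in> sets M" "N0 \<in> null_sets M" "\<And>w. w \<in> space M - N0 \<Longrightarrow> w \<in> A \<longleftrightarrow> w \<in> E"
  shows "A \<in> sets (completion M)" and "emeasure (completion M) A = emeasure M E"
proof -
  have E: "E \<subseteq> space M" using assms(2) by (rule sets.sets_into_space)
  have N0: "N0 \<in> sets M" using assms(3) by auto
  have A: "A = (E - N0) \<union> (A \<inter> N0)"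
  proof (rule set_eqI)
    fix w
    show "w \<in> A \<longleftrightarrow> w \<in> (E - N0) \<union> (A \<inter> N0)"
    proof (cases "w \<in> space M - N0")
      case True
      with assms(4)[OF this] show ?thesis by simp
    next
      case False
      with assms(1) E show ?thesis by blast
    qed
  qed
  show "A \<in> sets (completion M)"
    by (rule sets_completionI[OF A _ assms(3)]) (use assms(2) N0 in auto)
  have nul: "A \<inter> N0 \<in> null_sets (completion M)"
    by (rule null_sets_completion_subset[OF _ null_sets_completionI[OF assms(3)]]) simp
  have EN: "E - N0 \<in> sets M" using assms(2) N0 by (rule sets.Diff)
  have "emeasure (completion M) ((E - N0) \<union> (A \<inter> N0)) = emeasure (completion M) (E - N0)"
    by (rule emeasure_Un_null_set[OF _ nul]) (use EN in simp)
  also have "\<dots> = emeasure M (E - N0)" using EN by simp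
  also have "\<dots> = emeasure M E" by (rule emeasure_Diff_null_set[OF assms(3,2)])
  finally show "emeasure (completion M) A = emeasure M E" unfolding A[symmetric] .
qed

lemma gaussian_variable_centered:
  assumes "prob_space M" "gaussian_variable M Y" "(\<integral>w. Y w \<partial>M) = 0"
  shows "centered_gaussian M Y"
proof -
  interpret prob_space M by fact
  interpret std: prob_space std_normal_distribution by (rule prob_space_std_normal)
  have [measurable]: "Y \<in> borel_measurable M" using assms(2) by (simp add: gaussian_variable_def)
  consider \<mu> where "AE w in M. Y w = \<mu>"
    | \<mu> \<sigma> where "\<sigma> > 0" "distributed M lborel Y (\<lambda>x. ennreal (normal_density \<mu> \<sigma> x))"
    using assms(2) by (auto simp: gaussian_variable_def)
  then show ?thesis
  proof cases
    case 1
    then have "(\<integral>w. Y w \<partial>M) = (\<integral>w. \<mu> \<partial>M)" by (intro integral_cong_AE) auto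
    then have "\<mu> = 0" using assms(3) by (simp add: prob_space)
    then have "distr M borel Y = distr M borel (\<lambda>_. 0)" using 1 by (intro distr_cong_AE) auto
    also have "\<dots> = return borel 0" by (rule distr_const) simp
    also have "\<dots> = distr std_normal_distribution borel (\<lambda>_. 0)"
      by (rule std.distr_const[symmetric]) simp
    also have "\<dots> = distr std_normal_distribution borel (\<lambda>x. 0 * x)"
      by (intro distr_cong) auto
    finally show ?thesis
      unfolding centered_gaussian_def by (intro conjI exI[of _ "0::real"]) (assumption | simp)+
  next
    case 2
    then have "\<mu> = 0" using normal_distributed_expectation[of \<sigma> Y \<mu>] assms(3) by simp
    with 2 have "distributed M lborel (\<lambda>x. Y x / \<sigma>) std_normal_density"
      using normal_standard_normal_convert[of \<sigma> Y 0] by simp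
    then have d: "distr M lborel (\<lambda>x. Y x / \<sigma>) = std_normal_distribution" by (simp add: distributed_def)
    have "distr M borel Y = distr M borel (\<lambda>w. \<sigma> * (Y w / \<sigma>))" using 2 by (intro distr_cong) auto
    also have "\<dots> = distr (distr M lborel (\<lambda>w. Y w / \<sigma>)) borel (\<lambda>x. \<sigma> * x)"
      by (subst distr_distr) (auto simp: o_def)
    finally show ?thesis unfolding centered_gaussian_def d using 2 by (intro conjI exI[of _ \<sigma>]) auto
  qed
qed

lemma lin_span_image_sum:
  assumes "Y \<in> lin_span (X ` I)"
  shows "\<exists>J c. finite J \<and> J \<subseteq> I \<and> Y = (\<lambda>w. \<Sum>i\<in>J. c i * X i w)"
  using assms
proof induction
  case lin_span_zero
  show ?case by (intro exI[of _ "{}"]) auto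
next
  case (lin_span_step Y Z d)
  then obtain J c i where J: "finite J" "J \<subseteq> I" "Y = (\<lambda>w. \<Sum>i\<in>J. c i * X i w)" and i: "i \<in> I" "Z = X i" by auto
  define c' where "c' j = (if j \<in> J then c j else 0) + (if j = i then d else 0)" for j
  have "(\<Sum>j\<in>insert i J. c' j * X j w) = Y w + d * Z w" for w
  proof -
    have "(\<Sum>j\<in>insert i J. c' j * X j w) = (\<Sum>j\<in>insert i J. (if j \<in> J then c j else 0) * X j w) + (\<Sum>j\<in>insert i J. (if j = i then d else 0) * X j w)"
      by (simp add: c'_def distrib_right sum.distrib)
    also have "(\<Sum>j\<in>insert i J. (if j \<in> J then c j else 0) * X j w) = (\<Sum>j\<in>J. c j * X j w)"
      using J(1) by (intro sum.mono_neutral_cong_right) auto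
    also have "(\<Sum>j\<in>insert i J. (if j = i then d else 0) * X j w) = (\<Sum>j\<in>{i}. d * X j w)"
      using J(1) by (intro sum.mono_neutral_cong_right) auto
    finally show ?thesis by (simp add: J(3) i(2))
  qed
  then show ?case using J i by (intro exI[of _ "insert i J"] exI[of _ c']) auto
qed

lemma sample_path_measurable:
  assumes "\<And>t. 0 \<le> t \<Longrightarrow> Y t \<in> borel_measurable M"
  shows "sample_path Y \<in> M \<rightarrow>\<^sub>M path_space"
  unfolding sample_path_def[abs_def] using assms by (intro measurable_restrict) auto

lemma process_law_integral:
  assumes Y: "\<And>t. 0 \<le> t \<Longrightarrow> Y t \<in> borel_measurable M" and st: "0 \<le> s" "0 \<le> t"
  shows "(\<integral>x. x s * x t \<partial>process_law M Y) = (\<integral>w. Y s w * Y t w \<partial>M)"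
proof -
  have [measurable]: "(\<lambda>x. x t) \<in> borel_measurable path_space" if "0 \<le> t" for t
    using that by (intro measurable_component_singleton) auto
  show ?thesis
    unfolding process_law_def using st
    by (subst integral_distr[OF sample_path_measurable[OF Y]]) (auto simp: sample_path_def)
qed

lemma process_law_distr_sum:
  assumes Y: "\<And>t. 0 \<le> t \<Longrightarrow> Y t \<in> borel_measurable M" and J: "J \<subseteq> {0..}"
  shows "distr (process_law M Y) borel (\<lambda>x. \<Sum>t\<in>J. c t * x t) = distr M borel (\<lambda>w. \<Sum>t\<in>J. c t * Y t w)"
proof -
  have m: "(\<lambda>x. \<Sum>t\<in>J. c t * x t) \<in> borel_measurable path_space"
    using J by (intro borel_measurable_sum borel_measurable_times borel_measurable_const measurable_component_singleton) auto
  show ?thesis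
    unfolding process_law_def
    by (subst distr_distr[OF m sample_path_measurable[OF Y]])
       (auto simp: o_def sample_path_def intro!: distr_cong sum.cong dest: subsetD[OF J])
qed

lemma order_stat_bdd_above:
  assumes r: "1 \<le> r" "r \<le> n" and cont: "\<And>j. j \<in> {1..n} \<Longrightarrow> continuous_on {0..} (\<lambda>t. Xs j t w)"
  shows "bdd_above ((\<lambda>t. order_stat r n Xs t w) ` {0..1})"
proof -
  have "\<exists>c. \<forall>t\<in>{0..1}. Xs j t w \<le> c" if "j \<in> {1..n}" for j
  proof -
    have "continuous_on {0..1} (\<lambda>t. Xs j t w)" using cont[OF that] by (rule continuous_on_subset) auto
    then have "bounded ((\<lambda>t. Xs j t w) ` {0..1})" by (intro compact_imp_bounded compact_continuous_image) auto
    then have "bdd_above ((\<lambda>t. Xs j t w) ` {0..1})" by (rule bounded_imp_bdd_above)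
    then show ?thesis by (auto simp: bdd_above_def)
  qed
  then obtain c where c: "\<And>j t. j \<in> {1..n} \<Longrightarrow> t \<in> {0..1} \<Longrightarrow> Xs j t w \<le> c j" by metis
  define C where "C = Max (c ` {1..n})"
  have C: "Xs j t w \<le> C" if "j \<in> {1..n}" "t \<in> {0..1}" for j t
    using c[OF that] that unfolding C_def by (intro order_trans[OF _ Max_ge]) auto
  have "order_stat r n Xs t w \<le> C" if "t \<in> {0..1}" for t
  proof (rule ccontr)
    assume "\<not> order_stat r n Xs t w \<le> C"
    then have "order_stat r n Xs t w > C" by simp
    then have "rank_exceeds n (n + 1 - r) (\<lambda>j. Xs j t w) C" unfolding order_stat_gt_iff[OF r] .
    then have "0 < card {j\<in>{1..n}. Xs j t w > C}" unfolding rank_exceeds_def using r by linarith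
    then obtain j where "j \<in> {1..n}" "Xs j t w > C" by (metis (no_types, lifting) Collect_empty_eq card.empty less_irrefl)
    with C[OF this(1) that] show False by simp
  qed
  then show ?thesis by (intro bdd_aboveI2)
qed

lemma centered_gaussian_cong_AE:
  assumes "centered_gaussian M Y" "Y' \<in> borel_measurable M" "AE w in M. Y w = Y' w"
  shows "centered_gaussian M Y'"
proof -
  have "distr M borel Y = distr M borel Y'"
    using assms by (intro distr_cong_AE) (auto dest: centered_gaussian_measurable)
  then show ?thesis using assms(1,2) by (simp add: centered_gaussian_def)
qed

theorem theorem1:
  fixes N :: "'a measure" and X :: "real \<Rightarrow> 'a \<Rightarrow> real"
    and M :: "'b measure" and Xs :: "nat \<Rightarrow> real \<Rightarrow> 'b \<Rightarrow> real"
    and \<alpha> C lam T :: real and n r :: nat and f :: "real \<Rightarrow> real"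
  assumes "prob_space N" and "prob_space M"
    and "gaussian_process N X" and "stationary_process N X" and "continuous_paths_ae N X"
    and "\<And>t. t \<ge> 0 \<Longrightarrow> (\<integral>w. X t w \<partial>N) = 0"
    and "\<And>t. t \<ge> 0 \<Longrightarrow> (\<integral>w. (X t w)\<^sup>2 \<partial>N) = 1"
    and "0 < \<alpha>" and "\<alpha> \<le> 2" and "C > 0"
    and "(\<lambda>t. corr_fun N X t - (1 - C * \<bar>t\<bar> powr \<alpha>)) \<in> o[at_right 0](\<lambda>t. \<bar>t\<bar> powr \<alpha>)"
    and "\<And>s. s > 0 \<Longrightarrow> (SUP t\<in>{s..}. \<bar>corr_fun N X t\<bar>) < 1"
    and "lam > 0" and "corr_fun N X \<in> O[at_top](\<lambda>t. t powr (-2 * lam))"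
    and "1 \<le> r" and "r \<le> n"
    and "\<And>j. j \<in> {1..n} \<Longrightarrow> copy_of_process N X M (Xs j)"
    and "independent_processes M Xs {1..n}"
    and "T > 0" and "\<And>t. t \<ge> T \<Longrightarrow> f t > 0" and "mono_on {T..} f"
  shows "exceeds_io M T f (order_stat r n Xs) \<in> sets (completion M) \<and>
    (test_integral M T f (order_stat r n Xs) < \<infinity> \<longrightarrow>
       measure (completion M) (exceeds_io M T f (order_stat r n Xs)) = 0) \<and>
    (test_integral M T f (order_stat r n Xs) = \<infinity> \<longrightarrow>
       measure (completion M) (exceeds_io M T f (order_stat r n Xs)) = 1)"
proof -
  note zero_mean = assms(6) and unit_variance = assms(7) and copies = assms(17) and rn = assms(15,16)
  interpret N: prob_space N by fact
  interpret M: prob_space M by fact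
  define \<rho> where "\<rho> = corr_fun N X"
  define k where "k = n + 1 - r"
  have k: "1 \<le> k" "k \<le> n" using rn by (auto simp: k_def)

  have gv: "gaussian_variable N (\<lambda>w. \<Sum>t\<in>J. c t * X t w)" if "finite J" "J \<subseteq> {0..}" for J c
    using assms(3) that unfolding gaussian_process_def by blast
  have Xm: "X t \<in> borel_measurable N" if "0 \<le> t" for t
    using gv[of "{t}" "\<lambda>_. 1"] that by (simp add: gaussian_variable_def)
  have X2: "integrable N (\<lambda>w. (X t w)\<^sup>2)" if "0 \<le> t" for t
    using unit_variance[OF that] not_integrable_integral_eq[of N "\<lambda>w. (X t w)\<^sup>2"] by fastforce
  have X1: "integrable N (X t)" if "0 \<le> t" for t
    by (rule N.square_integrable_imp_integrable[OF Xm[OF that] X2[OF that]])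
  have cgX: "centered_gaussian N (\<lambda>w. \<Sum>t\<in>J. c t * X t w)" if J: "finite J" "J \<subseteq> {0..}" for J c
  proof (rule gaussian_variable_centered[OF assms(1) gv[OF J]])
    have "(\<integral>w. (\<Sum>t\<in>J. c t * X t w) \<partial>N) = (\<Sum>t\<in>J. \<integral>w. c t * X t w \<partial>N)"
      using J X1 by (intro Bochner_Integration.integral_sum integrable_mult_right) auto
    also have "\<dots> = 0" using J zero_mean by (intro sum.neutral) auto
    finally show "(\<integral>w. (\<Sum>t\<in>J. c t * X t w) \<partial>N) = 0" .
  qed
  have XXs: "(\<integral>w. X (s + d) w * X s w \<partial>N) = \<rho> d" if sd: "0 \<le> s" "0 \<le> d" for s d
  proof -
    have law: "process_law N (\<lambda>t. X (t + s)) = process_law N X"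
      using assms(4) sd unfolding stationary_process_def by blast
    have "(\<integral>w. X (d + s) w * X (0 + s) w \<partial>N) = (\<integral>x. x d * x 0 \<partial>process_law N (\<lambda>t. X (t + s)))"
      using sd by (intro process_law_integral[symmetric] Xm) auto
    also have "\<dots> = (\<integral>w. X d w * X 0 w \<partial>N)"
      unfolding law using sd by (intro process_law_integral Xm) auto
    finally show ?thesis by (simp add: \<rho>_def corr_fun_def add.commute)
  qed
  have XX: "(\<integral>w. X s w * X t w \<partial>N) = \<rho> \<bar>t - s\<bar>" if "0 \<le> s" "0 \<le> t" for s t
    using XXs[of s "t - s"] XXs[of t "s - t"] that
    by (cases "s \<le> t") (auto simp: mult.commute)
  have rho0: "\<rho> 0 = 1"
    using unit_variance[of 0] by (simp add: \<rho>_def corr_fun_def power2_eq_square)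
  have rho1: "\<bar>\<rho> t\<bar> \<le> 1" if "0 \<le> t" for t
  proof -
    have i: "integrable N (\<lambda>w. ((X t w)\<^sup>2 + (X 0 w)\<^sup>2) / 2)" using X2[OF that] X2[of 0] by auto
    have le: "\<bar>X t w * X 0 w\<bar> \<le> ((X t w)\<^sup>2 + (X 0 w)\<^sup>2) / 2" for w
      using sum_squares_bound[of "\<bar>X t w\<bar>" "\<bar>X 0 w\<bar>"] by (simp add: abs_mult)
    have ip: "integrable N (\<lambda>w. X t w * X 0 w)"
    proof (rule Bochner_Integration.integrable_bound[OF i])
      show "AE w in N. norm (X t w * X 0 w) \<le> norm (((X t w)\<^sup>2 + (X 0 w)\<^sup>2) / 2)"
        using order_trans[OF le abs_ge_self] by simp
    qed (use Xm[OF that] Xm[of 0] in simp)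
    have "\<bar>\<rho> t\<bar> \<le> (\<integral>w. \<bar>X t w * X 0 w\<bar> \<partial>N)"
      unfolding \<rho>_def corr_fun_def by (rule integral_abs_bound)
    also have "\<dots> \<le> (\<integral>w. ((X t w)\<^sup>2 + (X 0 w)\<^sup>2) / 2 \<partial>N)"
      by (rule integral_mono[OF integrable_abs[OF ip] i le])
    also have "\<dots> = 1" using X2[OF that] X2[of 0] unit_variance[OF that] unit_variance[of 0] by simp
    finally show ?thesis .
  qed

  \<comment> \<open>The block length \<open>b\<close> is chosen so small that on \<open>[0, b]\<close> the error term in the expansion of \<open>\<rho>\<close> is dominated
     by the main term and correlations are at least 1 / 2.\<close>
  have "\<forall>\<^sub>F t in at_right 0. \<bar>\<rho> t - (1 - C * \<bar>t\<bar> powr \<alpha>)\<bar> \<le> C * \<bar>t\<bar> powr \<alpha>"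
    using landau_o.smallD[OF assms(11) assms(10)] by (simp add: \<rho>_def)
  moreover have "\<forall>\<^sub>F t in at_right 0. 2 * C * t powr \<alpha> \<le> 1 / 2"
    using assms(8,10) by real_asymp
  ultimately have "\<forall>\<^sub>F t in at_right 0. \<bar>\<rho> t - (1 - C * \<bar>t\<bar> powr \<alpha>)\<bar> \<le> C * \<bar>t\<bar> powr \<alpha> \<and> 2 * C * t powr \<alpha> \<le> 1 / 2"
    by (rule eventually_conj)
  then obtain b0 where b0: "b0 > 0" and small: "\<And>t. 0 < t \<Longrightarrow> t < b0 \<Longrightarrow>
      \<bar>\<rho> t - (1 - C * \<bar>t\<bar> powr \<alpha>)\<bar> \<le> C * \<bar>t\<bar> powr \<alpha> \<and> 2 * C * t powr \<alpha> \<le> 1 / 2"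
    unfolding eventually_at_right_field by auto
  define b where "b = b0 / 2"
  have b: "b > 0" using b0 by (simp add: b_def)
  have incr: "1 - \<rho> t \<le> 2 * C * t powr \<alpha>" and half: "1 / 2 \<le> \<rho> t" if "0 \<le> t" "t \<le> b" for t
  proof -
    have "1 - \<rho> t \<le> 2 * C * t powr \<alpha> \<and> 1 / 2 \<le> \<rho> t"
    proof (cases "t = 0")
      case True then show ?thesis using rho0 assms(10) by simp
    next
      case False
      then have t: "0 < t" "t < b0" using that b0 by (auto simp: b_def)
      have "\<bar>t\<bar> = t" using t by simp
      then show ?thesis using small[OF t] by (simp add: abs_le_iff)
    qed
    then show "1 - \<rho> t \<le> 2 * C * t powr \<alpha>" "1 / 2 \<le> \<rho> t" by auto
  qed
  define \<kappa> where "\<kappa> = (SUP t\<in>{b..}. \<bar>\<rho> t\<bar>)"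
  have bdd: "bdd_above ((\<lambda>t. \<bar>\<rho> t\<bar>) ` {b..})" using rho1 b by (intro bdd_aboveI2[of _ _ 1]) auto
  have sep': "\<bar>\<rho> t\<bar> \<le> \<kappa>" if "b \<le> t" for t
    unfolding \<kappa>_def using that by (intro cSUP_upper bdd) auto
  have \<kappa>: "0 \<le> \<kappa>" "\<kappa> < 1"
    using sep'[of b] assms(12)[OF b] by (auto simp: \<kappa>_def \<rho>_def)
  obtain B where B: "B > 0" and "\<forall>\<^sub>F t in at_top. norm (\<rho> t) \<le> B * norm (t powr (- 2 * lam))"
    using landau_o.bigE[OF assms(14)] unfolding \<rho>_def by metis
  then obtain t1 where decay: "\<And>t. t1 \<le> t \<Longrightarrow> \<bar>\<rho> t\<bar> \<le> B * t powr (- 2 * lam)"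
    unfolding eventually_at_top_linorder by auto

  have Xsm: "Xs j t \<in> borel_measurable M" if "j \<in> {1..n}" "0 \<le> t" for j t
    using copies[OF that(1)] that(2) by (simp add: copy_of_process_def)
  have Xslaw: "process_law M (Xs j) = process_law N X" if "j \<in> {1..n}" for j
    using copies[OF that] by (simp add: copy_of_process_def)
  have "AE w in M. \<forall>j\<in>{1..n}. continuous_on {0..} (\<lambda>t. Xs j t w)"
  proof (rule AE_finite_allI)
    show "AE w in M. continuous_on {0..} (\<lambda>t. Xs j t w)" if "j \<in> {1..n}" for j
      using copies[OF that] by (simp add: copy_of_process_def continuous_paths_ae_def)
  qed simp
  from eventually_ae_filter[THEN iffD1, OF this]
  obtain N0 where N0: "N0 \<in> null_sets M"
    and sub: "{w\<in>space M. \<not> (\<forall>j\<in>{1..n}. continuous_on {0..} (\<lambda>t. Xs j t w))} \<subseteq> N0" by blast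
  have cont: "continuous_on {0..} (\<lambda>t. Xs j t w)" if "w \<in> space M - N0" "j \<in> {1..n}" for w j
    using sub that by blast
  \<comment> \<open>On the null set where some path is discontinuous, all copies are replaced by zero.\<close>
  define Z where "Z j t w = (if w \<in> N0 then 0 else Xs j t w)" for j t w
  have N0s: "N0 \<in> sets M" using N0 by auto
  have N0_AE: "AE w in M. w \<notin> N0" using N0 by (rule AE_not_in)
  let ?I = "{1..n} \<times> {0..} :: (nat \<times> real) set"
  have gauss_copy: "gauss_set M (Xs j ` {0..})" if j: "j \<in> {1..n}" for j
    unfolding gauss_set_def
  proof
    fix Y assume "Y \<in> lin_span (Xs j ` {0..})"
    from lin_span_image_sum[OF this]
    obtain J c where J: "finite J" "J \<subseteq> {0..}" and Y: "Y = (\<lambda>w. \<Sum>t\<in>J. c t * Xs j t w)"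
      by blast
    have "distr M borel Y = distr (process_law M (Xs j)) borel (\<lambda>x. \<Sum>t\<in>J. c t * x t)"
      unfolding Y by (rule process_law_distr_sum[OF Xsm[OF j] J(2), symmetric])
    also have "\<dots> = distr N borel (\<lambda>w. \<Sum>t\<in>J. c t * X t w)"
      unfolding Xslaw[OF j] by (rule process_law_distr_sum[OF Xm J(2)])
    finally have "distr M borel Y = distr N borel (\<lambda>w. \<Sum>t\<in>J. c t * X t w)" .
    moreover have "Y \<in> borel_measurable M"
      unfolding Y using J Xsm[OF j] by (intro borel_measurable_sum borel_measurable_times borel_measurable_const) auto
    ultimately show "centered_gaussian M Y"
      using cgX[OF J, of c] by (simp add: centered_gaussian_def)
  qed
  have indep: "M.indep_vars (\<lambda>_. path_space) (\<lambda>j. sample_path (Xs j)) {1..n}"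
    using assms(18) by (simp add: independent_processes_def)
  have gaussXs: "gauss_set M (\<Union>j\<in>{1..n}. Xs j ` {0..})"
  proof (rule gauss_set_indep_Union[OF assms(2) _ indep gauss_copy])
    fix j Y assume "Y \<in> Xs j ` {0..}"
    then obtain t where t: "0 \<le> t" "Y = Xs j t" by auto
    show "\<exists>F\<in>borel_measurable path_space. Y = (\<lambda>w. F (sample_path (Xs j) w))"
      using t by (intro bexI[of _ "\<lambda>x. x t"]) (auto simp: sample_path_def intro!: measurable_component_singleton)
  qed auto
  have modification: "\<exists>Y'\<in>lin_span (\<Union>j\<in>{1..n}. Xs j ` {0..}). Y = (\<lambda>w. if w \<in> N0 then 0 else Y' w)"
    if "Y \<in> lin_span ((\<lambda>(j, t). Z j t) ` ?I)" for Y
    using that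
  proof induction
    case lin_span_zero
    show ?case by (rule bexI[OF _ lin_span.lin_span_zero]) auto
  next
    case (lin_span_step Y V c)
    then obtain Y' where Y': "Y' \<in> lin_span (\<Union>j\<in>{1..n}. Xs j ` {0..})" "Y = (\<lambda>w. if w \<in> N0 then 0 else Y' w)" by auto
    from lin_span_step obtain j t where jt: "j \<in> {1..n}" "0 \<le> t" "V = Z j t" by auto
    show ?case
    proof (rule bexI)
      show "(\<lambda>w. Y' w + c * Xs j t w) \<in> lin_span (\<Union>j\<in>{1..n}. Xs j ` {0..})"
        using Y'(1) jt by (intro lin_span.lin_span_step) auto
      show "(\<lambda>w. Y w + c * V w) = (\<lambda>w. if w \<in> N0 then 0 else Y' w + c * Xs j t w)"
        by (auto simp: Y'(2) jt(3) Z_def)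
    qed
  qed
  have gaussZ: "gauss_set M ((\<lambda>(j, t). Z j t) ` ?I)"
    unfolding gauss_set_def
  proof
    fix Y assume "Y \<in> lin_span ((\<lambda>(j, t). Z j t) ` ?I)"
    from modification[OF this] obtain Y' where Y': "Y' \<in> lin_span (\<Union>j\<in>{1..n}. Xs j ` {0..})"
      "Y = (\<lambda>w. if w \<in> N0 then 0 else Y' w)" by auto
    have cg: "centered_gaussian M Y'" by (rule gauss_setD[OF gaussXs Y'(1)])
    show "centered_gaussian M Y"
    proof (rule centered_gaussian_cong_AE[OF cg])
      show "Y \<in> borel_measurable M"
        unfolding Y'(2) using N0s centered_gaussian_measurable[OF cg] by (intro measurable_If_set) auto
      show "AE w in M. Y' w = Y w" using N0_AE by eventually_elim (simp add: Y'(2))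
    qed
  qed
  have Zm: "Z j t \<in> borel_measurable M" if "j \<in> {1..n}" "0 \<le> t" for j t
    unfolding Z_def[abs_def] using N0s Xsm[OF that] by (intro measurable_If_set) auto
  have covZ: "(\<integral>w. Z i s w * Z j t w \<partial>M) = (if i = j then \<rho> \<bar>t - s\<bar> else 0)"
    if "i \<in> {1..n}" "j \<in> {1..n}" "0 \<le> s" "0 \<le> t" for i j s t
  proof -
    have "(\<integral>w. Z i s w * Z j t w \<partial>M) = (\<integral>w. Xs i s w * Xs j t w \<partial>M)"
    proof (rule integral_cong_AE)
      show "AE w in M. Z i s w * Z j t w = Xs i s w * Xs j t w"
        using N0_AE by eventually_elim (simp add: Z_def)
    qed (intro borel_measurable_times Zm Xsm that)+
    also have "\<dots> = (if i = j then \<rho> \<bar>t - s\<bar> else 0)"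
    proof (cases "i = j")
      case True
      have "(\<integral>w. Xs j s w * Xs j t w \<partial>M) = (\<integral>w. X s w * X t w \<partial>N)"
        using process_law_integral[of "Xs j" M, OF Xsm[OF that(2)] that(3,4)]
          process_law_integral[of X N, OF Xm that(3,4)] Xslaw[OF that(2)] by simp
      then show ?thesis using True XX[OF that(3,4)] by simp
    next
      case False
      define \<tau> where "\<tau> l = (if l = i then s else t)" for l
      have iv: "M.indep_vars (\<lambda>_. borel) (\<lambda>l w. sample_path (Xs l) w (\<tau> l)) {i, j}"
        using that by (intro M.indep_vars_compose2[OF M.indep_vars_subset[OF indep]])
          (auto simp: \<tau>_def intro!: measurable_component_singleton)
      have sp: "sample_path (Xs l) w (\<tau> l) = Xs l (\<tau> l) w" for l w
        using that by (simp add: sample_path_def \<tau>_def)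
      have cgl: "centered_gaussian M (Xs l (\<tau> l))" if "l \<in> {i, j}" for l
        using that \<open>i \<in> _\<close> \<open>j \<in> _\<close> \<open>0 \<le> s\<close> \<open>0 \<le> t\<close>
        by (intro gauss_setD[OF gaussXs] lin_span_base) (auto simp: \<tau>_def)
      have "(\<integral>w. (\<Prod>l\<in>{i, j}. Xs l (\<tau> l) w) \<partial>M) = (\<Prod>l\<in>{i, j}. \<integral>w. Xs l (\<tau> l) w \<partial>M)"
        by (rule M.indep_vars_lebesgue_integral[OF _ iv[unfolded sp] centered_gaussian_integrable(1)[OF cgl]]) auto
      also have "\<dots> = 0" using centered_gaussian_integrable(3)[OF cgl, of i] False by simp
      finally show ?thesis using False by (simp add: \<tau>_def)
    qed
    finally show ?thesis .
  qed
  have contZ: "continuous_on {0..} (\<lambda>t. Z j t w)" if "j \<in> {1..n}" "w \<in> space M" for j w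
    using cont[of w j] that by (cases "w \<in> N0") (auto simp: Z_def)
  interpret G: mixing_gaussian_copies M Z n k \<rho> "2 * C" \<alpha> b \<kappa> B lam t1
  proof unfold_locales
    show "\<rho> t \<le> \<kappa>" if "b \<le> t" for t using sep'[OF that] by linarith
  qed (use k gaussZ covZ contZ rho0 assms(8,10,13) b \<kappa> B incr half decay in auto)

  have rank: "order_stat r n Xs t w > x \<longleftrightarrow> rank_exceeds n k (\<lambda>j. Z j t w) x" if "w \<in> space M - N0" for t w x
    unfolding order_stat_gt_iff[OF rn] k_def using that by (intro rank_exceeds_cong) (simp add: Z_def)
  have io: "exceeds_io M T f (order_stat r n Xs) \<in> sets (completion M)"
    "emeasure (completion M) (exceeds_io M T f (order_stat r n Xs)) = emeasure M (G.io_event T f)"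
  proof -
    have sub: "exceeds_io M T f (order_stat r n Xs) \<subseteq> space M" by (auto simp: exceeds_io_def)
    have s: "G.io_event T f \<in> sets M" using assms(19,21) by (intro G.io_event_sets) auto
    have eq: "w \<in> exceeds_io M T f (order_stat r n Xs) \<longleftrightarrow> w \<in> G.io_event T f" if "w \<in> space M - N0" for w
      using that rank[OF that] by (simp add: exceeds_io_def G.io_event_def)
    show "exceeds_io M T f (order_stat r n Xs) \<in> sets (completion M)"
      "emeasure (completion M) (exceeds_io M T f (order_stat r n Xs)) = emeasure M (G.io_event T f)"
      using completion_eq_outside_null[OF sub s N0 eq] by auto
  qed
  have sup: "emeasure (completion M) (sup_exceeds M (order_stat r n Xs) x) = ennreal (M.prob (G.hit 0 1 x))" for x
  proof -
    have sub: "sup_exceeds M (order_stat r n Xs) x \<subseteq> space M" by (auto simp: sup_exceeds_def)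
    have eq: "w \<in> sup_exceeds M (order_stat r n Xs) x \<longleftrightarrow> w \<in> G.hit 0 1 x" if w: "w \<in> space M - N0" for w
    proof -
      have "bdd_above ((\<lambda>t. order_stat r n Xs t w) ` {0..1})"
        using cont[OF w] by (intro order_stat_bdd_above[OF rn]) auto
      then have "(SUP t\<in>{0..1}. order_stat r n Xs t w) > x \<longleftrightarrow> (\<exists>t\<in>{0..1}. order_stat r n Xs t w > x)"
        by (intro less_cSUP_iff) auto
      then show ?thesis using w rank[OF w] by (simp add: sup_exceeds_def G.hit_def)
    qed
    show ?thesis
      using completion_eq_outside_null(2)[OF sub G.hit_sets0 N0 eq] by (simp add: M.emeasure_eq_measure)
  qed
  have test: "test_integral M T f (order_stat r n Xs) < \<infinity> \<longleftrightarrow> summable (\<lambda>i::nat. M.prob (G.hit 0 1 (f (T + i * h))))"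
    if "h > 0" for h
    unfolding test_integral_def sup
  proof (rule antimono_integral_series[OF _ _ that])
    fix u v assume "T \<le> u" "u \<le> v"
    then have "f u \<le> f v" by (intro mono_onD[OF assms(21)]) auto
    then show "M.prob (G.hit 0 1 (f v)) \<le> M.prob (G.hit 0 1 (f u))"
      by (intro M.finite_measure_mono G.hit_antimono G.hit_sets0) auto
  qed simp
  have meas: "measure (completion M) (exceeds_io M T f (order_stat r n Xs)) = M.prob (G.io_event T f)"
    using io(2) by (simp add: measure_def)
  show ?thesis
  proof (intro conjI impI)
    show "exceeds_io M T f (order_stat r n Xs) \<in> sets (completion M)" by (rule io(1))
    assume "test_integral M T f (order_stat r n Xs) < \<infinity>"
    then have "summable (\<lambda>i::nat. M.prob (G.hit 0 1 (f (T + i * 1))))" using test[of 1] by simp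
    then show "measure (completion M) (exceeds_io M T f (order_stat r n Xs)) = 0"
      unfolding meas using assms(19,21) by (intro G.io_event_null) auto
  next
    assume "test_integral M T f (order_stat r n Xs) = \<infinity>"
    then have "\<not> summable (\<lambda>i::nat. M.prob (G.hit 0 1 (f (T + i * (2 * b)))))" using test[of "2 * b"] b by simp
    then show "measure (completion M) (exceeds_io M T f (order_stat r n Xs)) = 1"
      unfolding meas using assms(19,21) by (intro G.io_event_full) auto
  qed
qed

end
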